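(* Let $\mathcal{A}, \mathcal{B}$ be $AW^{*}$-algebras, regarded as unital $C^{*}$-subalgebras of $\mathcal{B}(H)$ for a Hilbert space $H$, and let $\sigma$ be a symmetric Kubo-Ando mean. A surjective map $\phi: \mathcal{A}^{++} \rightarrow \mathcal{B}^{++}$ preserves the norm of $\sigma$, i.e. $$\|A \,\sigma\, B\| = \|\phi(A)\,\sigma\,\phi(B)\| \quad \text{for all } A, B \in \mathcal{A}^{++},$$ if and only if there is a Jordan $\ast$-isomorphism $J : \mathcal{A} \rightarrow \mathcal{B}$ which extends $\phi$, i.e. $\phi(A) = J(A)$ holds for all $A \in \mathcal{A}^{++}$.
   Context: $\mathcal{B}(H)$ is the algebra of bounded operators on the Hilbert space $H$ and $I$ denotes the identity. For a unital $C^{*}$-algebra $\mathcal{A}$, $\mathcal{A}^{+}$ is its positive semi-definite cone (positive elements) and $\mathcal{A}^{++}$ its positive definite cone (positive invertible elements). An $AW^{*}$-algebra is a (unital) $C^{*}$-algebra in which the right annihilator of every non-empty subset $S$ is of the form $P\mathcal{A}$ for some projection $P \in \mathcal{A}$. A Kubo-Ando connection is a binary operation $\sigma$ on $\mathcal{B}(H)^{++}$ such that: (i) if $A \leq C$ and $B \leq D$, then $A \sigma B \leq C \sigma D$; (ii) $C(A\sigma B)C \leq (CAC)\sigma(CBC)$; (iii) if $A_n \downarrow A$ and $B_n \downarrow B$, then $A_n \sigma B_n \downarrow A\sigma B$, where $X_n \downarrow X$ means that the sequence $(X_n)$ of self-adjoint operators is monotonic decreasing and converges to $X$ in the strong operator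 topology. A Kubo-Ando mean is a Kubo-Ando connection with $I\sigma I = I$. By the Kubo-Ando theorem, the connections correspond bijectively to operator monotone functions $f:(0,\infty)\to(0,\infty)$ (the representing function of $\sigma$, given by $f(x)I = I\sigma(xI)$), with $$A\sigma B = A^{1/2} f\left(A^{-1/2} B A^{-1/2}\right) A^{1/2}, \qquad A, B \in \mathcal{B}(H)^{++};$$ $\sigma$ is a mean iff $f(1)=1$. The connection $\sigma$ is symmetric if $A\sigma B = B\sigma A$ for all $A,B$; equivalently $f(x) = x f(x^{-1})$ for all $x>0$. A Jordan $\ast$-isomorphism is a bijective linear map $J:\mathcal{A}\to\mathcal{B}$ such that $J(A^{*}) = J(A)^{*}$ and $J(AB+BA) = J(A)J(B)+J(B)J(A)$ for all $A,B\in\mathcal{A}$. *)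

theory Defs
  imports "HOL-Analysis.Analysis"
begin

section \<open>Complex Hilbert spaces\<close>

class scaleC =
  fixes scaleC :: "complex \<Rightarrow> 'a \<Rightarrow> 'a"  (infixr "*\<^sub>C" 75)

text \<open>The inner product is linear in its first and conjugate linear in its second argument.\<close>

class complex_inner = scaleC + real_normed_vector +
  fixes cinner :: "'a \<Rightarrow> 'a \<Rightarrow> complex"
  assumes scaleC_add_right: "c *\<^sub>C (x + y) = c *\<^sub>C x + c *\<^sub>C y"
    and scaleC_add_left: "(c + d) *\<^sub>C x = c *\<^sub>C x + d *\<^sub>C x"
    and scaleC_scaleC: "c *\<^sub>C d *\<^sub>C x = (c * d) *\<^sub>C x"
    and scaleR_scaleC: "r *\<^sub>R x = complex_of_real r *\<^sub>C x"
    and cinner_commute: "cinner x y = cnj (cinner y x)"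
    and cinner_add_left: "cinner (x + y) z = cinner x z + cinner y z"
    and cinner_scaleC_left: "cinner (c *\<^sub>C x) y = c * cinner x y"
    and cinner_ge_zero: "0 \<le> Re (cinner x x)"
    and cinner_eq_zero_iff: "cinner x x = 0 \<longleftrightarrow> x = 0"
    and norm_eq_sqrt_cinner: "norm x = sqrt (Re (cinner x x))"

class chilbert_space = complex_inner + complete_space

instance chilbert_space \<subseteq> banach ..

lemma norm_scaleC: "norm (c *\<^sub>C x) = cmod c * norm (x :: 'a :: complex_inner)"
proof -
  have real: "Im (cinner x x) = 0"
    using arg_cong[OF cinner_commute[of x x], of Im] by simp
  have "cinner (c *\<^sub>C x) (c *\<^sub>C x) = c * cnj (c * cinner x x)"
    by (metis cinner_commute cinner_scaleC_left)
  also have "\<dots> = complex_of_real ((cmod c)\<^sup>2) * cinner x x"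
    by (metis (no_types, lifting) cinner_commute complex_cnj_mult complex_norm_square mult.assoc)
  finally have "Re (cinner (c *\<^sub>C x) (c *\<^sub>C x)) = (cmod c)\<^sup>2 * Re (cinner x x)"
    using real by simp
  then show ?thesis
    by (simp add: norm_eq_sqrt_cinner real_sqrt_mult)
qed

instantiation complex :: chilbert_space
begin

definition scaleC_complex :: "complex \<Rightarrow> complex \<Rightarrow> complex"
  where "scaleC_complex c x = c * x"

definition cinner_complex :: "complex \<Rightarrow> complex \<Rightarrow> complex"
  where "cinner_complex x y = x * cnj y"

instance
proof
  fix x :: complex
  show "norm x = sqrt (Re (cinner x x))"
    by (simp add: cinner_complex_def cmod_def power2_eq_square)
qed (auto simp: scaleC_complex_def cinner_complex_def scaleR_conv_of_real algebra_simps)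

end


section \<open>Bounded operators on a complex Hilbert space\<close>

text \<open>
  The library type of bounded operators consists of the real-linear ones; the algebra
  $B(H)$ is the subset of the complex-linear ones.  Its norm, sum, composition
  and identity are those of the library type.
\<close>

definition BH :: "('h \<Rightarrow>\<^sub>L 'h :: chilbert_space) set"
  where "BH = {T. \<forall>c x. blinfun_apply T (c *\<^sub>C x) = c *\<^sub>C blinfun_apply T x}"

instantiation blinfun :: (real_normed_vector, complex_inner) scaleC
begin

lift_definition scaleC_blinfun :: "complex \<Rightarrow> 'a \<Rightarrow>\<^sub>L 'b \<Rightarrow> 'a \<Rightarrow>\<^sub>L 'b"
  is "\<lambda>c f x. c *\<^sub>C f x"
proof -
  fix c :: complex and f :: "'a \<Rightarrow> 'b"
  assume "bounded_linear f"
  then interpret f: bounded_linear f .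
  obtain K where K: "\<And>x. norm (f x) \<le> norm x * K"
    using f.bounded by blast
  show "bounded_linear (\<lambda>x. c *\<^sub>C f x)"
  proof (rule bounded_linear_intro[where K = "cmod c * K"])
    fix x y :: 'a and r :: real
    show "c *\<^sub>C f (x + y) = c *\<^sub>C f x + c *\<^sub>C f y"
      by (simp add: f.add scaleC_add_right)
    show "c *\<^sub>C f (r *\<^sub>R x) = r *\<^sub>R c *\<^sub>C f x"
      by (simp add: f.scaleR scaleR_scaleC scaleC_scaleC mult.commute)
    show "norm (c *\<^sub>C f x) \<le> norm x * (cmod c * K)"
      using mult_left_mono[OF K[of x], of "cmod c"]
      by (simp add: norm_scaleC mult.left_commute)
  qed
qed

instance ..

end

definition adj :: "('h \<Rightarrow>\<^sub>L 'h) \<Rightarrow> ('h \<Rightarrow>\<^sub>L 'h :: chilbert_space)"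
  where "adj T = (THE S. S \<in> BH \<and> (\<forall>x y. cinner (blinfun_apply T x) y = cinner x (blinfun_apply S y)))"

definition positive_op :: "('h \<Rightarrow>\<^sub>L 'h :: chilbert_space) \<Rightarrow> bool"
  where "positive_op T \<longleftrightarrow> T \<in> BH \<and> (\<forall>x. cinner (blinfun_apply T x) x \<in> \<real>\<^sub>\<ge>\<^sub>0)"

definition op_le :: "('h \<Rightarrow>\<^sub>L 'h) \<Rightarrow> ('h \<Rightarrow>\<^sub>L 'h :: chilbert_space) \<Rightarrow> bool"  (infix "\<preceq>" 50)
  where "S \<preceq> T \<longleftrightarrow> positive_op (T - S)"


section \<open>Operator algebras\<close>

definition unital_cstar_subalgebra :: "('h \<Rightarrow>\<^sub>L 'h :: chilbert_space) set \<Rightarrow> bool"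
  where "unital_cstar_subalgebra \<A> \<longleftrightarrow>
    \<A> \<subseteq> BH \<and> id_blinfun \<in> \<A> \<and>
    (\<forall>S\<in>\<A>. \<forall>T\<in>\<A>. S + T \<in> \<A>) \<and>
    (\<forall>c. \<forall>T\<in>\<A>. c *\<^sub>C T \<in> \<A>) \<and>
    (\<forall>S\<in>\<A>. \<forall>T\<in>\<A>. S o\<^sub>L T \<in> \<A>) \<and>
    (\<forall>T\<in>\<A>. adj T \<in> \<A>) \<and>
    closed \<A>"

definition projection :: "('h \<Rightarrow>\<^sub>L 'h :: chilbert_space) \<Rightarrow> bool"
  where "projection P \<longleftrightarrow> P \<in> BH \<and> P o\<^sub>L P = P \<and> adj P = P"

definition right_annihilator ::
    "('h \<Rightarrow>\<^sub>L 'h :: chilbert_space) set \<Rightarrow> ('h \<Rightarrow>\<^sub>L 'h) set \<Rightarrow> ('h \<Rightarrow>\<^sub>L 'h) set"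
  where "right_annihilator \<A> S = {X \<in> \<A>. \<forall>s\<in>S. s o\<^sub>L X = 0}"

definition AW_star_subalgebra :: "('h \<Rightarrow>\<^sub>L 'h :: chilbert_space) set \<Rightarrow> bool"
  where "AW_star_subalgebra \<A> \<longleftrightarrow>
    unital_cstar_subalgebra \<A> \<and>
    (\<forall>S. S \<subseteq> \<A> \<and> S \<noteq> {} \<longrightarrow>
      (\<exists>P\<in>\<A>. projection P \<and> right_annihilator \<A> S = (\<lambda>X. P o\<^sub>L X) ` \<A>))"

text \<open>The positive definite cone of \<open>\<A>\<close>; the inverse is required to lie in \<open>\<A>\<close>.\<close>

definition pd_cone :: "('h \<Rightarrow>\<^sub>L 'h :: chilbert_space) set \<Rightarrow> ('h \<Rightarrow>\<^sub>L 'h) set"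
  where "pd_cone \<A> =
    {T \<in> \<A>. positive_op T \<and> (\<exists>S\<in>\<A>. S o\<^sub>L T = id_blinfun \<and> T o\<^sub>L S = id_blinfun)}"

definition jordan_star_iso ::
    "('h \<Rightarrow>\<^sub>L 'h :: chilbert_space) set \<Rightarrow> ('h \<Rightarrow>\<^sub>L 'h) set \<Rightarrow> (('h \<Rightarrow>\<^sub>L 'h) \<Rightarrow> ('h \<Rightarrow>\<^sub>L 'h)) \<Rightarrow> bool"
  where "jordan_star_iso \<A> \<B> J \<longleftrightarrow>
    bij_betw J \<A> \<B> \<and>
    (\<forall>S\<in>\<A>. \<forall>T\<in>\<A>. J (S + T) = J S + J T) \<and>
    (\<forall>c. \<forall>T\<in>\<A>. J (c *\<^sub>C T) = c *\<^sub>C J T) \<and>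
    (\<forall>T\<in>\<A>. J (adj T) = adj (J T)) \<and>
    (\<forall>S\<in>\<A>. \<forall>T\<in>\<A>. J ((S o\<^sub>L T) + (T o\<^sub>L S)) = (J S o\<^sub>L J T) + (J T o\<^sub>L J S))"


section \<open>Kubo-Ando means\<close>

text \<open>Monotone decreasing convergence in the strong operator topology.\<close>

definition decreases_to ::
    "(nat \<Rightarrow> ('h \<Rightarrow>\<^sub>L 'h :: chilbert_space)) \<Rightarrow> ('h \<Rightarrow>\<^sub>L 'h) \<Rightarrow> bool"
  where "decreases_to X L \<longleftrightarrow>
    (\<forall>n. X n \<in> BH \<and> adj (X n) = X n) \<and> (\<forall>n. X (Suc n) \<preceq> X n) \<and>
    (\<forall>x. (\<lambda>n. blinfun_apply (X n) x) \<longlonglongrightarrow> blinfun_apply L x)"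

text \<open>
  A connection is a binary operation on the positive definite cone of $B(H)$; the values
  of \<open>\<sigma>\<close> outside that cone are irrelevant.  In the transformer inequality, $C$ ranges over
  the same cone, so that $CAC$ and $CBC$ are again arguments of the operation.
\<close>

definition kubo_ando_connection ::
    "(('h \<Rightarrow>\<^sub>L 'h) \<Rightarrow> ('h \<Rightarrow>\<^sub>L 'h) \<Rightarrow> ('h \<Rightarrow>\<^sub>L 'h :: chilbert_space)) \<Rightarrow> bool"
  where "kubo_ando_connection \<sigma> \<longleftrightarrow>
    (\<forall>A\<in>pd_cone BH. \<forall>B\<in>pd_cone BH. \<sigma> A B \<in> pd_cone BH) \<and>
    (\<forall>A\<in>pd_cone BH. \<forall>B\<in>pd_cone BH. \<forall>C\<in>pd_cone BH. \<forall>D\<in>pd_cone BH.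
      A \<preceq> C \<and> B \<preceq> D \<longrightarrow> \<sigma> A B \<preceq> \<sigma> C D) \<and>
    (\<forall>A\<in>pd_cone BH. \<forall>B\<in>pd_cone BH. \<forall>C\<in>pd_cone BH.
      C o\<^sub>L \<sigma> A B o\<^sub>L C \<preceq> \<sigma> (C o\<^sub>L A o\<^sub>L C) (C o\<^sub>L B o\<^sub>L C)) \<and>
    (\<forall>As Bs. \<forall>A\<in>pd_cone BH. \<forall>B\<in>pd_cone BH.
      (\<forall>n. As n \<in> pd_cone BH) \<and> (\<forall>n. Bs n \<in> pd_cone BH) \<and>
      decreases_to As A \<and> decreases_to Bs B \<longrightarrow>
      decreases_to (\<lambda>n. \<sigma> (As n) (Bs n)) (\<sigma> A B))"

definition kubo_ando_mean ::
    "(('h \<Rightarrow>\<^sub>L 'h) \<Rightarrow> ('h \<Rightarrow>\<^sub>L 'h) \<Rightarrow> ('h \<Rightarrow>\<^sub>L 'h :: chilbert_space)) \<Rightarrow> bool"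
  where "kubo_ando_mean \<sigma> \<longleftrightarrow>
    kubo_ando_connection \<sigma> \<and> \<sigma> id_blinfun id_blinfun = id_blinfun"

definition symmetric_connection ::
    "(('h \<Rightarrow>\<^sub>L 'h) \<Rightarrow> ('h \<Rightarrow>\<^sub>L 'h) \<Rightarrow> ('h \<Rightarrow>\<^sub>L 'h :: chilbert_space)) \<Rightarrow> bool"
  where "symmetric_connection \<sigma> \<longleftrightarrow>
    (\<forall>A\<in>pd_cone BH. \<forall>B\<in>pd_cone BH. \<sigma> A B = \<sigma> B A)"

end

theory Submission
  imports Defs
begin

text \<open>
  A symmetric Kubo-Ando mean acts on the cone by \<open>1 \<sigma> D = f(D)\<close>, and the proof rests on three observations
  about spectral projections.

  The order is encoded in the norms of means (\<open>order_iff_norm_mean\<close>): \<open>A \<le> B\<close> holds if and only if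
  \<open>\<parallel>A \<sigma> X\<parallel> \<le> \<parallel>B \<sigma> X\<parallel>\<close> for all \<open>X\<close> in the cone. One tests with \<open>X\<close> having two spectral values,
  a large one on a projection \<open>P\<close>. What \<open>\<parallel>A \<sigma> X\<parallel>\<close> measures depends on the behaviour of \<open>f\<close> at \<open>0\<close>. If
  \<open>f(0+) = 0\<close> or if \<open>f\<close> has infinite slope at \<open>0\<close>, the value of \<open>X\<close> on \<open>1 - P\<close> is sent to \<open>0\<close> and the
  norm measures the compression of \<open>A\<^sup>-\<^sup>1\<close> to \<open>P\<close>, up to an error that the slope absorbs
  (\<open>order_of_steep\<close>). If \<open>f(0+) > 0\<close> and the slope is finite, then \<open>A \<sigma> X\<close> is close to
  \<open>f(0+) X + f'(0+) A\<close> for large \<open>X\<close> and the norm measures the compression of \<open>A\<close> to \<open>P\<close>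
  (\<open>order_of_affine\<close>). In an AW*-algebra there are enough projections \<open>P\<close> on which such compressions are
  almost scalar (\<open>narrow_proj\<close>), and then the two cases decide the order of \<open>A\<close> and \<open>B\<close>.

  Hence a surjection that preserves the norm of the mean is an order isomorphism of the cones. It fixes the
  positive scalars, because \<open>A \<sigma> A = A\<close> and the multiple \<open>t\<close> of the identity is the largest element of norm
  \<open>t\<close>.

  An order isomorphism \<open>\<phi>\<close> that fixes the scalars is linear. Inside an order interval \<open>[s, t]\<close> the elements
  \<open>s P + t (1 - P)\<close> with \<open>P\<close> a projection can be recognized from the order alone (\<open>sharp_imp_two_valued\<close>,
  \<open>two_valued_imp_sharp\<close>), so \<open>\<phi>\<close> induces a bijection \<open>\<tau>\<close> of the projections. Comparing \<open>X\<close> with two-valued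
  elements shows the norm of its compression to \<open>P\<close>; thus the compressions of \<open>X\<close> to \<open>P\<close> and of \<open>\<phi> X\<close> to
  \<open>\<tau> P\<close> have the same norm (\<open>\<tau>_compress_iff\<close>), and where compressions are almost scalar this norm is
  additive. The linear extension of \<open>\<phi>\<close> maps projections to projections, so it preserves squares of
  combinations of orthogonal projections, and these are dense.

  Conversely, a Jordan isomorphism maps spectral projections of \<open>D\<close> to spectral projections of its image,
  hence approximations of \<open>f(D)\<close> to approximations of \<open>f\<close> at the image (\<open>norm_mean_le\<close>).

  All of this takes place in a type of complex linear operators, which forms an ordered normed algebra.
  The representation \<open>1 \<sigma> D = f(D)\<close> enters only through bounds for \<open>1 \<sigma> D\<close> on spectral projections of \<open>D\<close>
  (\<open>mean_local_mono\<close>).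
\<close>

section \<open>Adjoints of bounded operators on a Hilbert space\<close>

lemma cinner_add_right: "cinner x (y + z) = cinner x y + cinner x (z :: 'h :: complex_inner)"
  by (subst (1 2 3) cinner_commute) (simp add: cinner_add_left)

lemma cinner_scaleC_right: "cinner x (c *\<^sub>C y) = cnj c * cinner x (y :: 'h :: complex_inner)"
  by (subst (1 2) cinner_commute) (simp add: cinner_scaleC_left)

lemma cinner_scaleR_left: "cinner (r *\<^sub>R x) y = complex_of_real r * cinner x (y :: 'h :: complex_inner)"
  by (simp add: scaleR_scaleC cinner_scaleC_left)

lemma cinner_scaleR_right: "cinner x (r *\<^sub>R y) = complex_of_real r * cinner x (y :: 'h :: complex_inner)"
  by (simp add: scaleR_scaleC cinner_scaleC_right)

lemma cinner_minus_left: "cinner (- x) y = - cinner x (y :: 'h :: complex_inner)"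
  using cinner_scaleR_left[of "-1" x y] by simp

lemma cinner_minus_right: "cinner x (- y) = - cinner x (y :: 'h :: complex_inner)"
  using cinner_scaleR_right[of x "-1" y] by simp

lemma cinner_diff_left: "cinner (x - y) z = cinner x z - cinner y (z :: 'h :: complex_inner)"
  using cinner_add_left[of x "- y" z] by (simp add: cinner_minus_left)

lemma cinner_diff_right: "cinner x (y - z) = cinner x y - cinner x (z :: 'h :: complex_inner)"
  using cinner_add_right[of x y "- z"] by (simp add: cinner_minus_right)

lemma cinner_zero_left [simp]: "cinner 0 x = 0" and cinner_zero_right [simp]: "cinner x 0 = 0"
  for x :: "'h :: complex_inner"
  using cinner_scaleR_left[of 0 0 x] cinner_scaleR_right[of x 0 0] by simp_all

lemmas cinner_simps = cinner_add_left cinner_add_right cinner_diff_left cinner_diff_right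
  cinner_scaleC_left cinner_scaleC_right cinner_scaleR_left cinner_scaleR_right
  cinner_minus_left cinner_minus_right

lemma scaleC_one [simp]: "1 *\<^sub>C x = (x :: 'h :: complex_inner)"
  using scaleR_scaleC[of 1 x] by simp

lemma cinner_self: "cinner x x = complex_of_real ((norm x)\<^sup>2)" for x :: "'h :: complex_inner"
proof -
  have "Im (cinner x x) = 0"
    using arg_cong[OF cinner_commute[of x x], of Im] by simp
  moreover have "Re (cinner x x) = (norm x)\<^sup>2"
    by (simp add: norm_eq_sqrt_cinner cinner_ge_zero)
  ultimately show ?thesis
    by (simp add: complex_eq_iff)
qed

lemma norm_sq_add:
  "(norm (x + y))\<^sup>2 = (norm x)\<^sup>2 + 2 * Re (cinner x y) + (norm y)\<^sup>2" for x y :: "'h :: complex_inner"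
proof -
  have "cinner (x + y) (x + y) = cinner x x + (cinner x y + cnj (cinner x y)) + cinner y y"
    by (simp add: cinner_add_left cinner_add_right cinner_commute[of y x])
  then show ?thesis
    unfolding complex_add_cnj cinner_self of_real_add[symmetric] of_real_eq_iff .
qed

lemma Re_cinner_le: "Re (cinner x y) \<le> norm x * norm y" for x y :: "'h :: complex_inner"
proof -
  have "(norm (x + y))\<^sup>2 \<le> (norm x + norm y)\<^sup>2"
    by (intro power_mono norm_triangle_ineq) simp
  then show ?thesis
    by (simp add: norm_sq_add power2_sum)
qed

lemma norm_cinner_le: "cmod (cinner x y) \<le> norm x * norm y" for x y :: "'h :: complex_inner"
proof (cases "cinner x y = 0")
  case False
  define c where "c = cnj (sgn (cinner x y))"
  have "cmod c = 1"
    using False by (simp add: c_def norm_sgn)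
  have "c * cinner x y = complex_of_real (cmod (cinner x y))"
    using False by (simp add: c_def sgn_div_norm scaleR_conv_of_real complex_norm_square[symmetric]
        power2_eq_square mult.commute[of "cnj _"] field_simps)
  then have "cmod (cinner x y) = Re (cinner (c *\<^sub>C x) y)"
    by (simp add: cinner_scaleC_left)
  also have "\<dots> \<le> norm (c *\<^sub>C x) * norm y"
    by (rule Re_cinner_le)
  finally show ?thesis
    using \<open>cmod c = 1\<close> by (simp add: norm_scaleC)
qed (simp)

text \<open>
  The representing vector minimizes \<open>x \<mapsto> \<parallel>x\<parallel>\<^sup>2 - 2 r x\<close>; by the
  parallelogram identity every minimizing sequence is Cauchy.
\<close>

lemma riesz_real:
  fixes r :: "'h :: chilbert_space \<Rightarrow> real"
  assumes "bounded_linear r"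
  shows "\<exists>z. \<forall>x. r x = Re (cinner x z)"
proof -
  interpret r: bounded_linear r by fact
  obtain K where K: "\<And>x. \<bar>r x\<bar> \<le> norm x * K"
    using r.bounded by auto
  define g where "g x = (norm x)\<^sup>2 - 2 * r x" for x
  have g_below: "- K\<^sup>2 \<le> g x" for x
  proof -
    have "0 \<le> (norm x - K)\<^sup>2" by simp
    then show ?thesis
      using K[of x] unfolding g_def power2_diff by argo
  qed
  define m where "m = Inf (range g)"
  have bdd: "bdd_below (range g)"
    using g_below by (auto intro!: bdd_belowI)
  have m_le: "m \<le> g x" for x
    unfolding m_def by (rule cInf_lower[OF _ bdd]) simp
  have "\<exists>x. g x < m + inverse (real (Suc n))" for n
  proof -
    have "Inf (range g) < m + inverse (real (Suc n))"
      by (simp add: m_def)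
    then show ?thesis
      using cInf_lessD[of "range g"] by auto
  qed
  then obtain X where X: "\<And>n. g (X n) < m + inverse (real (Suc n))"
    by metis
  have parallelogram: "(norm (x - y))\<^sup>2 \<le> 2 * (g x - m) + 2 * (g y - m)" for x y
  proof -
    have "(norm (x - y))\<^sup>2 = (norm x)\<^sup>2 - 2 * Re (cinner x y) + (norm y)\<^sup>2"
      using norm_sq_add[of x "- y"] by (simp add: cinner_simps)
    moreover have "m \<le> g ((1/2) *\<^sub>R (x + y))" by (rule m_le)
    moreover have "g ((1/2) *\<^sub>R (x + y)) = ((norm x)\<^sup>2 + 2 * Re (cinner x y) + (norm y)\<^sup>2) / 4 - (r x + r y)"
      unfolding g_def norm_scaleR norm_sq_add[symmetric] r.scaleR r.add
        by (simp add: power_mult_distrib power_divide add_divide_distrib)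
    ultimately show ?thesis
      unfolding g_def by argo
  qed
  have "Cauchy X"
  proof (rule metric_CauchyI)
    fix e :: real assume "0 < e"
    then obtain N where N: "inverse (real (Suc N)) < e\<^sup>2 / 4"
      using reals_Archimedean[of "e\<^sup>2 / 4"] by auto
    have small: "g (X n) - m < e\<^sup>2 / 4" if "N \<le> n" for n
    proof -
      have "inverse (real (Suc n)) \<le> inverse (real (Suc N))"
        using that by (simp add: le_imp_inverse_le)
      then show ?thesis using X[of n] N by linarith
    qed
    show "\<exists>M. \<forall>k\<ge>M. \<forall>n\<ge>M. dist (X k) (X n) < e"
    proof (intro exI[of _ N] allI impI)
      fix k n assume "N \<le> k" "N \<le> n"
      then have "(norm (X k - X n))\<^sup>2 < e\<^sup>2"
        using parallelogram[of "X k" "X n"] small[OF \<open>N \<le> k\<close>] small[OF \<open>N \<le> n\<close>] by argo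
      then show "dist (X k) (X n) < e"
        using \<open>0 < e\<close> by (simp add: dist_norm power2_less_imp_less)
    qed
  qed
  then obtain z where z: "X \<longlonglongrightarrow> z"
    using Cauchy_convergent convergent_def by blast
  have "(\<lambda>n. g (X n)) \<longlonglongrightarrow> g z"
    unfolding g_def by (intro tendsto_intros z r.tendsto)
  moreover have "(\<lambda>n. m + inverse (real (Suc n))) \<longlonglongrightarrow> m + 0"
    by (intro tendsto_intros LIMSEQ_inverse_real_of_nat)
  ultimately have "g z \<le> m + 0"
    using X by (intro LIMSEQ_le) (auto intro: less_imp_le)
  then have min: "g z \<le> g x" for x
    using m_le[of x] by simp
  have "r h = Re (cinner h z)" for h
  proof -
    define b where "b = r h - Re (cinner h z)"
    have quad: "2 * s * b \<le> s\<^sup>2 * (norm h)\<^sup>2" for s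
    proof -
      have "g (s *\<^sub>R h + z) = s\<^sup>2 * (norm h)\<^sup>2 + 2 * s * Re (cinner h z) + (norm z)\<^sup>2 - 2 * s * r h - 2 * r z"
        by (simp add: g_def norm_sq_add r.add r.scaleR cinner_simps power_mult_distrib)
      then show ?thesis
        using min[of "s *\<^sub>R h + z"] by (simp add: g_def b_def algebra_simps)
    qed
    have "b = 0"
    proof (rule ccontr)
      assume "b \<noteq> 0"
      define d where "d = (norm h)\<^sup>2 + 1"
      have "0 < d" by (simp add: d_def add_nonneg_pos)
      have "2 * (b / d) * b \<le> (b / d)\<^sup>2 * (norm h)\<^sup>2" by (rule quad)
      also have "\<dots> \<le> (b / d)\<^sup>2 * d" by (intro mult_left_mono) (auto simp: d_def)
      finally have "2 * b\<^sup>2 / d \<le> b\<^sup>2 / d"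
        using \<open>0 < d\<close> by (simp add: power2_eq_square)
      then show False
        using \<open>0 < d\<close> \<open>b \<noteq> 0\<close> by (simp add: divide_le_cancel)
    qed
    then show ?thesis by (simp add: b_def)
  qed
  then show ?thesis by blast
qed

lemma BH_I: "(\<And>c x. blinfun_apply T (c *\<^sub>C x) = c *\<^sub>C blinfun_apply T x) \<Longrightarrow> T \<in> BH"
  and BH_D: "T \<in> BH \<Longrightarrow> blinfun_apply T (c *\<^sub>C x) = c *\<^sub>C blinfun_apply T x"
  by (auto simp: BH_def)

lemma cinner_left_ext: "(\<And>x. cinner x y = cinner x z) \<Longrightarrow> y = (z :: 'h :: complex_inner)"
  using cinner_eq_zero_iff[of "y - z"] by (simp add: cinner_diff_right)

text \<open>
  A complex linear functional is determined by its real part, so it is enough to represent \<open>Re \<langle>T x, y\<rangle>\<close>;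
  the imaginary part is recovered by replacing \<open>x\<close> with \<open>\<i> x\<close>.
\<close>

lemma adjoint_exists:
  fixes T :: "'h \<Rightarrow>\<^sub>L 'h :: chilbert_space"
  assumes "T \<in> BH"
  shows "\<exists>S \<in> BH. \<forall>x y. cinner (blinfun_apply T x) y = cinner x (blinfun_apply S y)"
proof -
  have re: "\<exists>z. \<forall>x. Re (cinner (blinfun_apply T x) y) = Re (cinner x z)" for y
  proof (rule riesz_real)
    show "bounded_linear (\<lambda>x. Re (cinner (blinfun_apply T x) y))"
    proof (rule bounded_linear_intro[where K = "norm T * norm y"])
      fix x
      have "norm (Re (cinner (blinfun_apply T x) y)) \<le> norm (blinfun_apply T x) * norm y"
        using abs_Re_le_cmod norm_cinner_le order_trans unfolding real_norm_def by blast
      also have "\<dots> \<le> norm T * norm x * norm y"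
        by (intro mult_right_mono norm_blinfun) simp
      finally show "norm (Re (cinner (blinfun_apply T x) y)) \<le> norm x * (norm T * norm y)"
        by (simp add: ac_simps)
    qed (simp_all add: blinfun.add_right blinfun.scaleR_right cinner_simps)
  qed
  then obtain S where S: "\<And>x y. Re (cinner (blinfun_apply T x) y) = Re (cinner x (S y))"
    by metis
  have adj: "cinner (blinfun_apply T x) y = cinner x (S y)" for x y
  proof (rule complex_eqI)
    show "Im (cinner (blinfun_apply T x) y) = Im (cinner x (S y))"
      using S[of "\<i> *\<^sub>C x" y] by (simp add: BH_D[OF assms] cinner_simps)
  qed (rule S)
  have S_lin: "S (x + y) = S x + S y" "S (c *\<^sub>C x) = c *\<^sub>C S x" for x y c
    by (rule cinner_left_ext, simp add: adj[symmetric] cinner_simps)+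
  have "bounded_linear S"
  proof (rule bounded_linear_intro[where K = "norm T"])
    fix x
    have "(norm (S x))\<^sup>2 = Re (cinner (blinfun_apply T (S x)) x)"
      by (simp add: adj cinner_self)
    also have "\<dots> \<le> norm (blinfun_apply T (S x)) * norm x"
      by (rule Re_cinner_le)
    also have "\<dots> \<le> norm T * norm (S x) * norm x"
      by (intro mult_right_mono norm_blinfun) simp
    finally have "norm (S x) * norm (S x) \<le> norm (S x) * (norm x * norm T)"
      by (simp add: power2_eq_square ac_simps)
    then show "norm (S x) \<le> norm x * norm T"
      by (cases "S x = 0") auto
  qed (simp_all add: S_lin scaleR_scaleC)
  then have app: "blinfun_apply (Blinfun S) = S"
    by (rule bounded_linear_Blinfun_apply)
  show ?thesis
    by (intro bexI[of _ "Blinfun S"] BH_I) (simp_all add: app adj S_lin)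
qed

lemma adj_unique:
  assumes "S \<in> BH" and "\<And>x y. cinner (blinfun_apply T x) y = cinner x (blinfun_apply S y)"
  shows "adj T = S"
  unfolding adj_def
proof (rule the_equality)
  fix R assume R: "R \<in> BH \<and> (\<forall>x y. cinner (blinfun_apply T x) y = cinner x (blinfun_apply R y))"
  show "R = S"
  proof (rule blinfun_eqI, rule cinner_left_ext)
    show "cinner x (blinfun_apply R y) = cinner x (blinfun_apply S y)" for x y
      using R assms(2)[of x y] by simp
  qed
qed (use assms in blast)

lemma
  assumes "T \<in> BH"
  shows adj_BH: "adj T \<in> BH"
    and cinner_adj: "cinner (blinfun_apply T x) y = cinner x (blinfun_apply (adj T) y)"
proof -
  obtain S where S: "S \<in> BH" "\<And>x y. cinner (blinfun_apply T x) y = cinner x (blinfun_apply S y)"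
    using adjoint_exists[OF assms] by blast
  then have "adj T = S" by (rule adj_unique)
  then show "adj T \<in> BH" "cinner (blinfun_apply T x) y = cinner x (blinfun_apply (adj T) y)"
    using S by simp_all
qed

section \<open>The ordered algebra of bounded operators\<close>

lemma scaleC_scaleR: "c *\<^sub>C (r *\<^sub>R x) = r *\<^sub>R (c *\<^sub>C x :: 'h :: complex_inner)"
  by (simp add: scaleR_scaleC scaleC_scaleC mult.commute)

lemma scaleC_zero [simp]: "c *\<^sub>C 0 = (0 :: 'h :: complex_inner)"
  using scaleC_scaleR[of c 0 0] by simp

lemma scaleC_minus: "c *\<^sub>C (- x) = - (c *\<^sub>C x :: 'h :: complex_inner)"
  using scaleC_scaleR[of c "- 1" x] by simp

lemma scaleC_diff: "c *\<^sub>C (x - y) = c *\<^sub>C x - (c *\<^sub>C y :: 'h :: complex_inner)"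
  using scaleC_add_right[of c x "- y"] by (simp add: scaleC_minus)

text \<open>
  As a type of its own the algebra carries the library's notation and simplification rules for ordered
  normed rings. It is not an instance of the class of unital rings, since \<open>0 = 1\<close> on the zero space.
\<close>

typedef (overloaded) 'h oper = "BH :: ('h :: chilbert_space \<Rightarrow>\<^sub>L 'h) set"
  by (rule exI[of _ 0]) (simp add: BH_I)

setup_lifting type_definition_oper

instantiation oper :: (chilbert_space) real_normed_vector
begin

lift_definition zero_oper :: "'a oper" is 0
  by (rule BH_I) simp
lift_definition plus_oper :: "'a oper \<Rightarrow> 'a oper \<Rightarrow> 'a oper" is "(+)"
  by (rule BH_I) (simp add: BH_D blinfun.add_left scaleC_add_right)
lift_definition minus_oper :: "'a oper \<Rightarrow> 'a oper \<Rightarrow> 'a oper" is "(-)"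
  by (rule BH_I) (simp add: BH_D blinfun.diff_left scaleC_diff)
lift_definition uminus_oper :: "'a oper \<Rightarrow> 'a oper" is "uminus"
  by (rule BH_I) (simp add: BH_D blinfun.minus_left scaleC_minus)
lift_definition scaleR_oper :: "real \<Rightarrow> 'a oper \<Rightarrow> 'a oper" is "(*\<^sub>R)"
  by (rule BH_I) (simp add: BH_D blinfun.scaleR_left scaleC_scaleR)
lift_definition norm_oper :: "'a oper \<Rightarrow> real" is norm .
definition dist_oper :: "'a oper \<Rightarrow> 'a oper \<Rightarrow> real" where "dist_oper S T = norm (S - T)"
definition sgn_oper :: "'a oper \<Rightarrow> 'a oper" where "sgn_oper T = inverse (norm T) *\<^sub>R T"
definition uniformity_oper :: "('a oper \<times> 'a oper) filter"
  where "uniformity_oper = (INF e\<in>{0<..}. principal {(S, T). dist S T < e})"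
definition open_oper :: "'a oper set \<Rightarrow> bool"
  where "open_oper U = (\<forall>S\<in>U. eventually (\<lambda>(S', T). S' = S \<longrightarrow> T \<in> U) uniformity)"

lemmas oper_rep = Rep_oper_inject[symmetric] zero_oper.rep_eq plus_oper.rep_eq minus_oper.rep_eq
  uminus_oper.rep_eq scaleR_oper.rep_eq norm_oper.rep_eq

instance
proof
  fix R S T :: "'a oper" and a b :: real and U :: "'a oper set"
  show "R + S + T = R + (S + T)" "S + T = T + S" "0 + S = S" "- S + S = 0" "S - T = S + - T"
    "a *\<^sub>R (S + T) = a *\<^sub>R S + a *\<^sub>R T" "(a + b) *\<^sub>R S = a *\<^sub>R S + b *\<^sub>R S"
    "a *\<^sub>R b *\<^sub>R S = (a * b) *\<^sub>R S" "1 *\<^sub>R S = S" "norm S = 0 \<longleftrightarrow> S = 0"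
    "norm (a *\<^sub>R S) = \<bar>a\<bar> * norm S" "norm (S + T) \<le> norm S + norm T"
    by (simp_all add: oper_rep scaleR_add_right scaleR_add_left norm_triangle_ineq)
  show "dist S T = norm (S - T)" by (rule dist_oper_def)
  show "sgn S = inverse (norm S) *\<^sub>R S" by (rule sgn_oper_def)
  show "uniformity = (INF e\<in>{0<..}. principal {(S, T :: 'a oper). dist S T < e})" by (rule uniformity_oper_def)
  show "open U = (\<forall>S\<in>U. eventually (\<lambda>(S', T). S' = S \<longrightarrow> T \<in> U) uniformity)" by (rule open_oper_def)
qed

end

lemma closed_BH: "closed (BH :: ('h \<Rightarrow>\<^sub>L 'h :: chilbert_space) set)"
proof -
  have scaleC_lim: "bounded_linear (\<lambda>x. c *\<^sub>C x :: 'h)" for c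
    by (rule bounded_linear_intro[where K = "cmod c"])
      (simp_all add: scaleC_add_right scaleC_scaleR norm_scaleC)
  have "closed {T :: 'h \<Rightarrow>\<^sub>L 'h. blinfun_apply T (c *\<^sub>C x) = c *\<^sub>C blinfun_apply T x}" for c and x :: 'h
    by (intro closed_Collect_eq bounded_linear.continuous_on[OF scaleC_lim] continuous_intros)
  then have "closed (\<Inter>c. \<Inter>x :: 'h. {T :: 'h \<Rightarrow>\<^sub>L 'h. blinfun_apply T (c *\<^sub>C x) = c *\<^sub>C blinfun_apply T x})"
    by (auto intro!: closed_INT)
  moreover have "BH = (\<Inter>c. \<Inter>x :: 'h. {T :: 'h \<Rightarrow>\<^sub>L 'h. blinfun_apply T (c *\<^sub>C x) = c *\<^sub>C blinfun_apply T x})"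
    by (auto simp: BH_def)
  ultimately show ?thesis by simp
qed

instance oper :: (chilbert_space) banach
proof
  fix X :: "nat \<Rightarrow> 'a oper"
  assume "Cauchy X"
  have dist: "dist (Rep_oper S) (Rep_oper T) = dist S T" for S T :: "'a oper"
    by (simp add: dist_norm norm_oper.rep_eq minus_oper.rep_eq)
  have "Cauchy (\<lambda>n. Rep_oper (X n))"
    using \<open>Cauchy X\<close> by (simp add: Cauchy_def dist)
  then obtain L where L: "(\<lambda>n. Rep_oper (X n)) \<longlonglongrightarrow> L"
    using Cauchy_convergent convergent_def by blast
  then have "L \<in> BH"
    by (rule closed_sequentially[OF closed_BH Rep_oper])
  then have "dist (X n) (Abs_oper L) = dist (Rep_oper (X n)) L" for n
    by (simp only: dist[symmetric] Abs_oper_inverse)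
  moreover have "(\<lambda>n. dist (Rep_oper (X n)) L) \<longlonglongrightarrow> 0"
    using L by (rule tendsto_dist_iff[THEN iffD1])
  ultimately have "X \<longlonglongrightarrow> Abs_oper L"
    by (subst tendsto_dist_iff) simp
  then show "convergent X"
    by (rule convergentI)
qed

instantiation oper :: (chilbert_space) "{real_normed_algebra, monoid_mult}"
begin

lift_definition times_oper :: "'a oper \<Rightarrow> 'a oper \<Rightarrow> 'a oper" is "(o\<^sub>L)"
  by (rule BH_I) (simp add: BH_D)
lift_definition one_oper :: "'a oper" is id_blinfun
  by (rule BH_I) simp

instance
proof
  fix R S T :: "'a oper" and a b :: real
  show "norm (S * T) \<le> norm S * norm T"
    by (simp add: norm_oper.rep_eq times_oper.rep_eq norm_blinfun_compose)
  show "R * S * T = R * (S * T)" "1 * S = S" "S * 1 = S"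
    "(R + S) * T = R * T + S * T" "R * (S + T) = R * S + R * T"
    "(a *\<^sub>R S) * T = a *\<^sub>R (S * T)" "S * (a *\<^sub>R T) = a *\<^sub>R (S * T)"
    unfolding oper_rep times_oper.rep_eq one_oper.rep_eq
    by (rule blinfun_eqI, simp add: blinfun.add_left blinfun.add_right blinfun.scaleR_left blinfun.scaleR_right)+
qed

end

lift_definition app :: "'h oper \<Rightarrow> 'h \<Rightarrow> 'h :: chilbert_space" is blinfun_apply .
lift_definition star :: "'h oper \<Rightarrow> 'h :: chilbert_space oper" is adj by (rule adj_BH)
lift_definition scaleCo :: "complex \<Rightarrow> 'h oper \<Rightarrow> 'h :: chilbert_space oper" is scaleC
  by (rule BH_I) (simp add: scaleC_blinfun.rep_eq BH_D scaleC_scaleC mult.commute)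

lemma oper_eqI: "(\<And>x. app S x = app T x) \<Longrightarrow> S = T"
  by (auto simp: app.rep_eq Rep_oper_inject[symmetric] intro: blinfun_eqI)

lemma app_simps [simp]:
  "app (S + T) x = app S x + app T x" "app (S - T) x = app S x - app T x" "app (- T) x = - app T x"
  "app (r *\<^sub>R T) x = r *\<^sub>R app T x" "app (S * T) x = app S (app T x)" "app 0 x = 0" "app 1 x = x"
  "app (scaleCo c T) x = c *\<^sub>C app T x"
  by (simp_all add: app.rep_eq oper_rep times_oper.rep_eq one_oper.rep_eq scaleCo.rep_eq blinfun.add_left
      blinfun.diff_left blinfun.minus_left blinfun.scaleR_left scaleC_blinfun.rep_eq)

lemma app_linear [simp]:
  "app T (x + y) = app T x + app T y" "app T (x - y) = app T x - app T y" "app T (- x) = - app T x"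
  "app T (r *\<^sub>R x) = r *\<^sub>R app T x" "app T (c *\<^sub>C x) = c *\<^sub>C app T x" "app T 0 = 0"
  by (simp_all add: app.rep_eq BH_D[OF Rep_oper] blinfun.add_right blinfun.diff_right blinfun.minus_right blinfun.scaleR_right)

lemma norm_app_le: "norm (app T x) \<le> norm T * norm x"
  by (simp add: app.rep_eq norm_oper.rep_eq norm_blinfun)

lemma norm_oper_le: "0 \<le> K \<Longrightarrow> (\<And>x. norm (app T x) \<le> K * norm x) \<Longrightarrow> norm T \<le> K"
  by (simp add: app.rep_eq norm_oper.rep_eq norm_blinfun_bound)

lemma cinner_app_left: "cinner (app T x) y = cinner x (app (star T) y)"
  by (simp add: app.rep_eq star.rep_eq cinner_adj[OF Rep_oper])

lemma star_unique: "(\<And>x y. cinner (app T x) y = cinner x (app S y)) \<Longrightarrow> star T = S"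
  by (simp add: app.rep_eq star.rep_eq Rep_oper_inject[symmetric] adj_unique[OF Rep_oper])

lemma cinner_app_right: "cinner x (app T y) = cinner (app (star T) x) y"
  using cinner_app_left[of T y x] by (metis cinner_commute)

lemma star_simps [simp]:
  "star (S + T) = star S + star T" "star (S - T) = star S - star T" "star (- T) = - star T"
  "star (r *\<^sub>R T) = r *\<^sub>R star T" "star (S * T) = star T * star S" "star 0 = (0 :: 'h :: chilbert_space oper)"
  "star 1 = (1 :: 'h oper)" "star (star T) = T" "star (scaleCo c T) = scaleCo (cnj c) (star T)"
  by (rule star_unique; simp add: cinner_simps cinner_app_left; fail | rule star_unique, rule cinner_app_right[symmetric])+

lemma norm_star [simp]: "norm (star T) = norm T"
proof -
  have "norm (star T) \<le> norm T" for T :: "'a oper"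
  proof (rule norm_oper_le)
    fix x
    have "(norm (app (star T) x))\<^sup>2 = Re (cinner (app T (app (star T) x)) x)"
      by (simp add: cinner_app_left cinner_self)
    also have "\<dots> \<le> norm T * norm (app (star T) x) * norm x"
      using Re_cinner_le norm_app_le by (meson mult_right_mono norm_ge_zero order_trans)
    finally have "norm (app (star T) x) * norm (app (star T) x) \<le> norm (app (star T) x) * (norm T * norm x)"
      by (simp add: power2_eq_square ac_simps)
    then show "norm (app (star T) x) \<le> norm T * norm x"
      by (cases "app (star T) x = 0") auto
  qed simp
  from this[of T] this[of "star T"] show ?thesis by simp
qed

definition nonneg_oper :: "'h :: chilbert_space oper \<Rightarrow> bool"
  where "nonneg_oper T \<longleftrightarrow> (\<forall>x. cinner (app T x) x \<in> \<real>\<^sub>\<ge>\<^sub>0)"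

lemma nonneg_oper_selfadjoint:
  assumes "nonneg_oper T"
  shows "star T = T"
proof (rule star_unique)
  fix x y
  have im: "Im (cinner (app T z) z) = 0" for z
    using assms by (auto simp: nonneg_oper_def complex_nonneg_Reals_iff)
  have 1: "Im (cinner (app T x) y) + Im (cinner (app T y) x) = 0"
    using im[of "x + y"] im[of x] im[of y] by (simp add: cinner_simps)
  have 2: "Re (cinner (app T x) y) = Re (cinner (app T y) x)"
    using im[of "x + \<i> *\<^sub>C y"] im[of x] im[of y] by (simp add: cinner_simps)
  have "cinner (app T x) y = cnj (cinner (app T y) x)"
    using 1 2 by (simp add: complex_eq_iff)
  then show "cinner (app T x) y = cinner x (app T y)"
    by (metis cinner_commute)
qed

lemma nonneg_oper_iff: "nonneg_oper T \<longleftrightarrow> star T = T \<and> (\<forall>x. 0 \<le> Re (cinner (app T x) x))"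
proof -
  have "Im (cinner (app T x) x) = 0" if "star T = T" for x
    using arg_cong[OF cinner_commute[of "app T x" x], of Im] that by (simp add: cinner_app_left)
  then show ?thesis
    using nonneg_oper_selfadjoint[of T] by (auto simp: nonneg_oper_def complex_nonneg_Reals_iff)
qed

lemma Re_complex_of_real_mult: "Re (complex_of_real r * z) = r * Re z"
  by simp

text \<open>
  With \<open>U = t - T\<close> and \<open>V = t + T\<close> one has \<open>U V U + V U V = 2 t (t\<^sup>2 - T\<^sup>2)\<close>, and the left hand side is
  positive. Only the degenerate case \<open>t = 0\<close> has to be treated by polarization.
\<close>

lemma norm_le_of_nonneg:
  fixes T :: "'h :: chilbert_space oper"
  assumes "nonneg_oper (t *\<^sub>R 1 - T)" "nonneg_oper (t *\<^sub>R 1 + T)" "0 \<le> t"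
  shows "norm T \<le> t"
proof (rule norm_oper_le)
  have sa: "star T = T"
    using assms(2) by (simp add: nonneg_oper_iff)
  fix x :: 'h
  define U V where "U = t *\<^sub>R 1 - T" and "V = t *\<^sub>R 1 + T"
  have UV: "star U = U" "star V = V" by (simp_all add: U_def V_def sa)
  have conj: "0 \<le> Re (cinner (app (B * A * B) x) x)" if "nonneg_oper A" "star B = B" for A B
    using that by (simp add: nonneg_oper_iff cinner_app_left[of B])
  have "U * V * U + V * U * V = (2 * t) *\<^sub>R (t\<^sup>2 *\<^sub>R 1 - T * T)"
    by (simp add: U_def V_def algebra_simps power2_eq_square scaleR_2 flip: scaleR_add_left)
  then have "Re (cinner (app (U * V * U + V * U * V) x) x) = Re (cinner (app ((2 * t) *\<^sub>R (t\<^sup>2 *\<^sub>R 1 - T * T)) x) x)"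
    by simp
  then have "(2 * t) * Re (cinner (app (t\<^sup>2 *\<^sub>R 1 - T * T) x) x)
      = Re (cinner (app (U * V * U) x) x) + Re (cinner (app (V * U * V) x) x)"
    by (simp only: app_simps(1,4) cinner_add_left cinner_scaleR_left Re_complex_of_real_mult plus_complex.sel)
  also have "0 \<le> \<dots>"
    using conj[of V U] conj[of U V] assms(1,2) UV by (simp only: U_def[symmetric] V_def[symmetric] add_nonneg_nonneg)
  finally have ge: "0 \<le> (2 * t) * (t\<^sup>2 * (norm x)\<^sup>2 - (norm (app T x))\<^sup>2)"
    by (simp add: cinner_simps cinner_self cinner_app_left[of T] sa power2_eq_square)
  show "norm (app T x) \<le> t * norm x"
  proof (cases "t = 0")
    case False
    then have "(norm (app T x))\<^sup>2 \<le> (t * norm x)\<^sup>2"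
      using ge \<open>0 \<le> t\<close> by (simp add: zero_le_mult_iff power_mult_distrib)
    then show ?thesis
      using power2_le_imp_le \<open>0 \<le> t\<close> by (metis mult_nonneg_nonneg norm_ge_zero)
  next
    case True
    have z: "Re (cinner (app T y) y) = 0" for y
      using assms(1,2) True by (simp add: nonneg_oper_iff cinner_simps) (meson dual_order.antisym neg_0_le_iff_le)
    have "Re (cinner (app T x) y) + Re (cinner (app T y) x) = 0" for y
      using z[of "x + y"] z[of x] z[of y] by (simp add: cinner_simps)
    from this[of "app T x"] have "(norm (app T x))\<^sup>2 = 0"
      by (simp add: cinner_app_left[of T "app T x"] sa cinner_self)
    then show ?thesis by (simp add: True)
  qed
qed fact

instantiation oper :: (chilbert_space) ordered_real_vector
begin

definition less_eq_oper :: "'a oper \<Rightarrow> 'a oper \<Rightarrow> bool" where "S \<le> T \<longleftrightarrow> nonneg_oper (T - S)"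
definition less_oper :: "'a oper \<Rightarrow> 'a oper \<Rightarrow> bool" where "S < T \<longleftrightarrow> S \<le> T \<and> \<not> T \<le> (S :: 'a oper)"

instance
proof
  fix R S T :: "'a oper" and a b :: real
  show "S < T \<longleftrightarrow> S \<le> T \<and> \<not> T \<le> S" by (rule less_oper_def)
  show "S \<le> S" by (simp add: less_eq_oper_def nonneg_oper_def)
  show "S \<le> T" if "S \<le> R" "R \<le> T"
  proof -
    have "nonneg_oper ((T - R) + (R - S))"
      using that unfolding less_eq_oper_def nonneg_oper_def app_simps cinner_add_left
      by (blast intro: nonneg_Reals_add_I)
    then show ?thesis by (simp add: less_eq_oper_def)
  qed
  show "S = T" if "S \<le> T" "T \<le> S"
    using norm_le_of_nonneg[of 0 "S - T"] that by (simp add: less_eq_oper_def)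
  show "R + S \<le> R + T" if "S \<le> T"
    using that by (simp add: less_eq_oper_def)
  show "a *\<^sub>R S \<le> a *\<^sub>R T" if "S \<le> T" "0 \<le> a"
  proof -
    have "nonneg_oper (a *\<^sub>R (T - S))"
      using that unfolding less_eq_oper_def nonneg_oper_iff by (simp add: cinner_scaleR_left del: app_simps(2) star_simps(2))
    then show ?thesis by (simp add: less_eq_oper_def scaleR_diff_right)
  qed
  show "a *\<^sub>R T \<le> b *\<^sub>R T" if "a \<le> b" "0 \<le> T"
    using that by (simp add: less_eq_oper_def nonneg_oper_iff cinner_simps left_diff_distrib[symmetric])
qed

end

lemma oper_le_iff:
  "S \<le> T \<longleftrightarrow> star (T - S) = T - S \<and> (\<forall>x. Re (cinner (app S x) x) \<le> Re (cinner (app T x) x))"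
  by (simp add: less_eq_oper_def nonneg_oper_iff cinner_simps)

lemma nonneg_star: "0 \<le> T \<Longrightarrow> star T = T" for T :: "'h :: chilbert_space oper"
  by (simp add: oper_le_iff)

lemma conj_nonneg: "0 \<le> T \<Longrightarrow> 0 \<le> star S * T * S" for T :: "'h :: chilbert_space oper"
  by (simp add: oper_le_iff mult.assoc cinner_app_left[of "star S"])

lemma conj_mono: "A \<le> B \<Longrightarrow> star S * A * S \<le> star S * B * S" for A :: "'h :: chilbert_space oper"
  using conj_nonneg[of "B - A" S] by (simp add: algebra_simps)

lemma conj_mono_sa: "A \<le> B \<Longrightarrow> star S = S \<Longrightarrow> S * A * S \<le> S * B * S" for A :: "'h :: chilbert_space oper"
  using conj_mono[of A B S] by simp

lemma star_mult_nonneg: "0 \<le> star S * S" for S :: "'h :: chilbert_space oper"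
  by (simp add: oper_le_iff cinner_app_left[of "star S"] cinner_self)

lemma star_mult_eq_0: "star S * S = 0 \<Longrightarrow> S = 0" for S :: "'h :: chilbert_space oper"
proof (rule oper_eqI)
  fix x assume "star S * S = 0"
  then have "cinner (app S x) (app S x) = 0"
    by (metis app_simps(5,6) cinner_app_right cinner_app_left cinner_zero_left)
  then show "app S x = app 0 x" by (simp add: cinner_eq_zero_iff)
qed

lemma one_nonneg: "0 \<le> (1 :: 'h :: chilbert_space oper)"
  using star_mult_nonneg[of "1 :: 'h oper"] by simp

lemma le_norm: "star T = T \<Longrightarrow> T \<le> norm T *\<^sub>R 1" for T :: "'h :: chilbert_space oper"
proof -
  assume sa: "star T = T"
  have "Re (cinner (app T x) x) \<le> norm T * (norm x)\<^sup>2" for x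
  proof -
    have "Re (cinner (app T x) x) \<le> norm (app T x) * norm x" by (rule Re_cinner_le)
    also have "\<dots> \<le> norm T * norm x * norm x" by (intro mult_right_mono norm_app_le) simp
    finally show ?thesis by (simp add: power2_eq_square)
  qed
  then show ?thesis by (simp add: oper_le_iff sa cinner_simps cinner_self)
qed

lemma neg_norm_le: "star T = T \<Longrightarrow> - (norm T *\<^sub>R 1) \<le> T" for T :: "'h :: chilbert_space oper"
  using le_norm[of "- T"] by (metis minus_le_iff norm_minus_cancel star_simps(3))

lemma norm_leI: "- (t *\<^sub>R 1) \<le> T \<Longrightarrow> T \<le> t *\<^sub>R 1 \<Longrightarrow> 0 \<le> t \<Longrightarrow> norm T \<le> t"
  for T :: "'h :: chilbert_space oper"
  by (rule norm_le_of_nonneg) (simp_all add: less_eq_oper_def add.commute)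

lemma norm_le_iff_pos: "0 \<le> T \<Longrightarrow> 0 \<le> t \<Longrightarrow> norm T \<le> t \<longleftrightarrow> T \<le> t *\<^sub>R 1"
  for T :: "'h :: chilbert_space oper"
proof
  assume "0 \<le> T" "0 \<le> t" "norm T \<le> t"
  then show "T \<le> t *\<^sub>R 1"
    using le_norm[OF nonneg_star, of T] scaleR_right_mono[OF _ one_nonneg, of "norm T" t] by (rule_tac order_trans)
next
  assume *: "0 \<le> T" "0 \<le> t" "T \<le> t *\<^sub>R 1"
  then have "- (t *\<^sub>R 1) \<le> T"
    by (meson order_trans neg_le_0_iff_le scaleR_nonneg_nonneg one_nonneg)
  then show "norm T \<le> t" using * by (intro norm_leI)
qed

section \<open>Square roots and inverses in closed subalgebras\<close>

locale cstar_subalgebra =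
  fixes M :: "'h :: chilbert_space oper set"
  assumes one_mem [simp, intro]: "1 \<in> M"
    and add_mem [simp, intro]: "S \<in> M \<Longrightarrow> T \<in> M \<Longrightarrow> S + T \<in> M"
    and scaleC_mem [simp, intro]: "T \<in> M \<Longrightarrow> scaleCo c T \<in> M"
    and mult_mem [simp, intro]: "S \<in> M \<Longrightarrow> T \<in> M \<Longrightarrow> S * T \<in> M"
    and star_mem [simp, intro]: "T \<in> M \<Longrightarrow> star T \<in> M"
    and closed_M: "closed M"

lemma scaleCo_of_real [simp]: "scaleCo (complex_of_real r) T = r *\<^sub>R T"
  by (rule oper_eqI) (simp add: scaleR_scaleC)

context cstar_subalgebra
begin

lemma scaleR_mem [simp, intro]: "T \<in> M \<Longrightarrow> r *\<^sub>R T \<in> M"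
  using scaleC_mem[of T "complex_of_real r"] by simp

lemma zero_mem [simp, intro]: "0 \<in> M"
  using scaleR_mem[OF one_mem, of 0] by simp

lemma uminus_mem [simp, intro]: "T \<in> M \<Longrightarrow> - T \<in> M"
  using scaleR_mem[of T "- 1"] by simp

lemma diff_mem [simp, intro]: "S \<in> M \<Longrightarrow> T \<in> M \<Longrightarrow> S - T \<in> M"
  using add_mem[of S "- T"] by simp

end

lemma cstar_UNIV: "cstar_subalgebra UNIV"
  by unfold_locales simp_all

lemma convergent_of_majorant:
  fixes X :: "nat \<Rightarrow> 'a :: banach" and y :: "nat \<Rightarrow> real"
  assumes step: "\<And>n. norm (X (Suc n) - X n) \<le> y (Suc n) - y n" and bound: "\<And>n. y n \<le> K"
  shows "convergent X"
proof -
  have "y n \<le> y (Suc n)" for n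
    using step[of n] norm_ge_zero[of "X (Suc n) - X n"] by linarith
  then have "incseq y" by (rule incseq_SucI)
  then obtain L where "y \<longlonglongrightarrow> L"
    using incseq_convergent[of y K] bound by blast
  then have y: "Cauchy y" using LIMSEQ_imp_Cauchy by blast
  have dist: "norm (X (m + k) - X m) \<le> y (m + k) - y m" for m k
  proof (induction k)
    case (Suc k)
    have "norm (X (m + Suc k) - X m) \<le> norm (X (Suc (m + k)) - X (m + k)) + norm (X (m + k) - X m)"
      using norm_triangle_ineq[of "X (Suc (m + k)) - X (m + k)" "X (m + k) - X m"] by simp
    then show ?case using Suc step[of "m + k"] by simp
  qed simp
  have "Cauchy X"
    unfolding Cauchy_altdef2
  proof (intro allI impI)
    fix e :: real assume "0 < e"
    then obtain N where "\<forall>n\<ge>N. dist (y n) (y N) < e"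
      using y unfolding Cauchy_altdef2 by blast
    then have N: "\<bar>y n - y N\<bar> < e" if "N \<le> n" for n using that by (simp add: dist_real_def)
    show "\<exists>N. \<forall>n\<ge>N. dist (X n) (X N) < e"
    proof (intro exI[of _ N] allI impI)
      fix n assume "N \<le> n"
      then show "dist (X n) (X N) < e"
        using dist[of N "n - N"] N[of n] by (simp add: dist_norm)
    qed
  qed
  then show ?thesis by (rule Cauchy_convergent)
qed

text \<open>
  Properties of the members of a convergent sequence pass to its limit as soon as they define closed sets.
\<close>

lemma closed_commutant: "closed {S :: 'h :: chilbert_space oper. X * S = S * X}"
  by (intro closed_Collect_eq continuous_intros)

lemma closed_selfadjoint: "closed {S :: 'h :: chilbert_space oper. star S = S}"
proof -
  have "continuous_on UNIV (star :: 'h oper \<Rightarrow> 'h oper)"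
    by (rule bounded_linear.continuous_on[of star UNIV "\<lambda>x. x"])
      (auto intro: bounded_linear_intro[where K = 1])
  then show ?thesis
    by (intro closed_Collect_eq) auto
qed

text \<open>
  For \<open>0 \<le> A \<le> 1\<close> the iteration \<open>Y \<mapsto> (1 - A + Y\<^sup>2) / 2\<close> converges in norm to \<open>1 - A\<^sup>1\<^sup>/\<^sup>2\<close>:
  its increments are dominated by those of the same iteration for the scalar \<open>A = 0\<close>.
\<close>

lemma sqrt_exists_contraction:
  fixes A :: "'h :: chilbert_space oper"
  assumes "0 \<le> A" "A \<le> 1"
  shows "\<exists>S. 0 \<le> S \<and> S * S = A \<and> (\<forall>X. X * A = A * X \<longrightarrow> X * S = S * X)
    \<and> (\<forall>M. cstar_subalgebra M \<longrightarrow> A \<in> M \<longrightarrow> S \<in> M)"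
proof -
  define B where "B = 1 - A"
  have saB: "star B = B" using nonneg_star[OF assms(1)] by (simp add: B_def)
  have "norm B \<le> 1"
    using assms by (intro norm_leI) (auto simp: B_def intro: order_trans[of _ 0])
  define Y where "Y = rec_nat 0 (\<lambda>_ Z. (1/2) *\<^sub>R (B + Z * Z))"
  have Y0: "Y 0 = 0" and YS: "Y (Suc n) = (1/2) *\<^sub>R (B + Y n * Y n)" for n
    by (simp_all add: Y_def)
  define y :: "nat \<Rightarrow> real" where "y = rec_nat 0 (\<lambda>_ z. (1/2) * (1 + z * z))"
  have y0: "y 0 = 0" and yS: "y (Suc n) = (1/2) * (1 + y n * y n)" for n
    by (simp_all add: y_def)
  have y01: "0 \<le> y n \<and> y n \<le> 1" for n
  proof (induction n)
    case (Suc n)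
    then have "y n * y n \<le> 1" by (simp add: mult_le_one)
    then show ?case using Suc by (simp add: yS)
  qed (simp add: y0)
  have Yy: "norm (Y n) \<le> y n" for n
  proof (induction n)
    case (Suc n)
    have "norm (Y n * Y n) \<le> y n * y n"
      using Suc y01[of n] by (intro order_trans[OF norm_mult_ineq] mult_mono) auto
    then have "norm (B + Y n * Y n) \<le> 1 + y n * y n"
      using \<open>norm B \<le> 1\<close> norm_triangle_ineq[of B "Y n * Y n"] by linarith
    then show ?case by (simp add: YS yS)
  qed (simp add: Y0 y0)
  have comm: "X * Y n = Y n * X" if "X * B = B * X" for X n
  proof (induction n)
    case (Suc n)
    have "X * (Y n * Y n) = (X * Y n) * Y n" by (simp only: mult.assoc)
    also have "\<dots> = Y n * (X * Y n)" by (simp only: Suc mult.assoc)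
    also have "\<dots> = Y n * Y n * X" by (simp only: Suc mult.assoc)
    finally show ?case by (simp add: YS that distrib_left distrib_right)
  qed (simp add: Y0)
  have YY: "Y m * Y n = Y n * Y m" for m n
    by (rule comm) (rule comm[symmetric], rule refl)
  have conv: "norm (Y (Suc n) - Y n) \<le> y (Suc n) - y n" for n
  proof (induction n)
    case 0
    then show ?case using \<open>norm B \<le> 1\<close> by (simp add: YS yS Y0 y0)
  next
    case (Suc n)
    have "Y (Suc (Suc n)) - Y (Suc n) = (1/2) *\<^sub>R ((Y (Suc n) - Y n) * (Y (Suc n) + Y n))"
      unfolding YS[of "Suc n"] YS[of n, THEN arg_cong, of "\<lambda>t. _ - t"]
      using YY[of "Suc n" n] by (simp add: algebra_simps flip: scaleR_diff_right)
    then have "norm (Y (Suc (Suc n)) - Y (Suc n)) \<le> (1/2) * (norm (Y (Suc n) - Y n) * norm (Y (Suc n) + Y n))"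
      using norm_mult_ineq[of "Y (Suc n) - Y n" "Y (Suc n) + Y n"] by simp
    also have "\<dots> \<le> (1/2) * ((y (Suc n) - y n) * (y (Suc n) + y n))"
      using Suc Yy[of n] Yy[of "Suc n"] norm_triangle_ineq[of "Y (Suc n)" "Y n"] order_trans[OF norm_ge_zero Suc]
      by (intro mult_left_mono mult_mono) auto
    also have "\<dots> = y (Suc (Suc n)) - y (Suc n)"
      by (simp add: yS[of "Suc n"] yS[of n, THEN arg_cong, of "\<lambda>t. _ - t"] algebra_simps)
    finally show ?case .
  qed
  obtain Z where Z: "Y \<longlonglongrightarrow> Z"
    using convergent_of_majorant[of Y y 1, OF conv] y01 by (auto simp: convergent_def)
  have lim: "Z \<in> C" if "closed C" "\<And>n. Y n \<in> C" for C
    using closed_sequentially[OF that(1) that(2) Z] .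
  have saY: "star (Y n) = Y n" for n
    by (induction n) (simp_all add: Y0 YS saB)
  have saZ: "star Z = Z"
    using lim[OF closed_selfadjoint] saY by simp
  have "norm (Y n) \<le> 1" for n using Yy y01 order_trans by blast
  then have "norm Z \<le> 1"
    using lim[of "{T. norm T \<le> 1}"] by (simp add: closed_Collect_le continuous_on_norm_id)
  have "(\<lambda>n. Y (Suc n)) \<longlonglongrightarrow> Z" using Z by (rule LIMSEQ_Suc)
  moreover have "(\<lambda>n. (1/2) *\<^sub>R (B + Y n * Y n)) \<longlonglongrightarrow> (1/2) *\<^sub>R (B + Z * Z)"
    by (intro tendsto_intros Z)
  ultimately have fixpt: "Z = (1/2) *\<^sub>R (B + Z * Z)"
    unfolding YS using LIMSEQ_unique by blast
  have "2 *\<^sub>R Z = B + Z * Z"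
    by (subst fixpt) simp
  then have sq: "(1 - Z) * (1 - Z) = A"
    by (simp add: algebra_simps B_def scaleR_2)
  have "Z \<le> 1"
    using order_trans[OF le_norm[OF saZ] scaleR_right_mono[OF \<open>norm Z \<le> 1\<close> one_nonneg]] by simp
  moreover have "\<forall>X. X * A = A * X \<longrightarrow> X * Z = Z * X"
  proof (intro allI impI)
    fix X assume that: "X * A = A * X"
    have "X * B = B * X" using that by (simp add: B_def algebra_simps)
    then show "X * Z = Z * X" using lim[OF closed_commutant[of X]] comm by simp
  qed
  moreover have "\<forall>M. cstar_subalgebra M \<longrightarrow> A \<in> M \<longrightarrow> Z \<in> M"
  proof (intro allI impI)
    fix M assume that: "cstar_subalgebra M" "A \<in> M"
    interpret cstar_subalgebra M by fact
    have "Y n \<in> M" for n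
      using that(2) by (induction n) (auto simp: Y0 YS B_def)
    then show "Z \<in> M" using lim[OF closed_M] by simp
  qed
  ultimately have Z: "0 \<le> 1 - Z" "\<And>X. X * A = A * X \<Longrightarrow> X * Z = Z * X"
    "\<And>M. cstar_subalgebra M \<Longrightarrow> A \<in> M \<Longrightarrow> Z \<in> M" by auto
  show ?thesis
  proof (intro exI[of _ "1 - Z"] conjI allI impI)
    show "X * (1 - Z) = (1 - Z) * X" if "X * A = A * X" for X
      unfolding left_diff_distrib right_diff_distrib Z(2)[OF that] by simp
    show "1 - Z \<in> M" if "cstar_subalgebra M" "A \<in> M" for M
      by (intro cstar_subalgebra.diff_mem cstar_subalgebra.one_mem Z(3) that)
  qed (fact sq Z(1))+
qed

lemma le_scalar: "star A = A \<Longrightarrow> norm A \<le> c \<Longrightarrow> A \<le> c *\<^sub>R 1" for A :: "'h :: chilbert_space oper"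
  using order_trans[OF le_norm scaleR_right_mono[OF _ one_nonneg]] .

lemma sqrt_exists:
  fixes A :: "'h :: chilbert_space oper"
  assumes "0 \<le> A"
  shows "\<exists>S. 0 \<le> S \<and> S * S = A \<and> (\<forall>X. X * A = A * X \<longrightarrow> X * S = S * X)
    \<and> (\<forall>M. cstar_subalgebra M \<longrightarrow> A \<in> M \<longrightarrow> S \<in> M)"
proof -
  define c where "c = norm A + 1"
  have "0 < c" by (simp add: c_def add_nonneg_pos)
  have "A \<le> c *\<^sub>R 1"
    using nonneg_star[OF assms] by (intro le_scalar) (simp_all add: c_def)
  then have "(1/c) *\<^sub>R A \<le> (1/c) *\<^sub>R c *\<^sub>R 1"
    using \<open>0 < c\<close> by (intro scaleR_left_mono) auto
  then have "(1/c) *\<^sub>R A \<le> 1" using \<open>0 < c\<close> by simp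
  moreover have "0 \<le> (1/c) *\<^sub>R A" using assms \<open>0 < c\<close> by (simp add: scaleR_nonneg_nonneg)
  ultimately obtain S where S: "0 \<le> S" "S * S = (1/c) *\<^sub>R A"
    "\<And>X. X * ((1/c) *\<^sub>R A) = ((1/c) *\<^sub>R A) * X \<Longrightarrow> X * S = S * X"
    "\<And>M. cstar_subalgebra M \<Longrightarrow> (1/c) *\<^sub>R A \<in> M \<Longrightarrow> S \<in> M"
    using sqrt_exists_contraction[of "(1/c) *\<^sub>R A"] by metis
  show ?thesis
  proof (intro exI[of _ "sqrt c *\<^sub>R S"] conjI allI impI)
    show "0 \<le> sqrt c *\<^sub>R S" using S(1) \<open>0 < c\<close> by (simp add: scaleR_nonneg_nonneg)
    show "sqrt c *\<^sub>R S * sqrt c *\<^sub>R S = A" using S(2) \<open>0 < c\<close> by simp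
    show "X * sqrt c *\<^sub>R S = sqrt c *\<^sub>R S * X" if "X * A = A * X" for X
      using S(3)[of X] that by simp
    show "sqrt c *\<^sub>R S \<in> M" if "cstar_subalgebra M" "A \<in> M" for M
      using S(4)[of M] that cstar_subalgebra.scaleR_mem by blast
  qed
qed

text \<open>
  The choice fixes a root that lies in every closed *-subalgebra containing \<open>A\<close> and commutes with everything
  that commutes with \<open>A\<close>.
\<close>

definition rt :: "'h oper \<Rightarrow> 'h :: chilbert_space oper" where
  "rt A = (SOME S. 0 \<le> S \<and> S * S = A \<and> (\<forall>X. X * A = A * X \<longrightarrow> X * S = S * X)
    \<and> (\<forall>M. cstar_subalgebra M \<longrightarrow> A \<in> M \<longrightarrow> S \<in> M))"

lemma
  assumes "0 \<le> A"
  shows rt_nonneg: "0 \<le> rt A" and rt_square: "rt A * rt A = A"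
    and rt_commute: "X * A = A * X \<Longrightarrow> X * rt A = rt A * X"
    and rt_mem: "cstar_subalgebra M \<Longrightarrow> A \<in> M \<Longrightarrow> rt A \<in> M"
  using someI_ex[OF sqrt_exists[OF assms]] unfolding rt_def by blast+

lemma rt_star [simp]: "0 \<le> A \<Longrightarrow> star (rt A) = rt A"
  using rt_nonneg nonneg_star by blast

lemma mult_nonneg_commute:
  fixes A B :: "'h :: chilbert_space oper"
  assumes "0 \<le> A" "0 \<le> B" "A * B = B * A"
  shows "0 \<le> A * B"
proof -
  have "A * B = rt A * B * rt A"
    using rt_commute[OF assms(1), of B] rt_square[OF assms(1)] assms(3) by (simp add: mult.assoc) (metis mult.assoc)
  then show ?thesis
    using conj_nonneg[OF assms(2), of "rt A"] assms(1) by simp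
qed

text \<open>
  In terms of the root \<open>R\<close> of \<open>X\<close> the hypothesis reads \<open>(R S)\<^sup>* (R S) = 0\<close>.
\<close>

lemma compress_eq_0:
  fixes X :: "'h :: chilbert_space oper"
  assumes "0 \<le> X" "star S * X * S = 0"
  shows "X * S = 0"
proof -
  have "star (rt X * S) * (rt X * S) = 0"
    using assms rt_square[OF assms(1)] by (simp add: mult.assoc) (metis mult.assoc)
  then have "rt X * S = 0" by (rule star_mult_eq_0)
  then show ?thesis
    using rt_square[OF assms(1)] by (metis mult.assoc mult_zero_right)
qed

text \<open>The positive invertible operators are those bounded below by a positive scalar.\<close>

definition pd :: "'h :: chilbert_space oper \<Rightarrow> bool"
  where "pd A \<longleftrightarrow> (\<exists>e>0. e *\<^sub>R 1 \<le> A)"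

lemma pdI: "0 < e \<Longrightarrow> e *\<^sub>R 1 \<le> A \<Longrightarrow> pd A"
  by (auto simp: pd_def)

lemma pd_nonneg: "pd A \<Longrightarrow> 0 \<le> A"
  unfolding pd_def by (meson one_nonneg order_trans scaleR_nonneg_nonneg less_imp_le)

lemma pd_star [simp]: "pd A \<Longrightarrow> star A = A"
  using pd_nonneg nonneg_star by blast

lemma pd_mono: "pd A \<Longrightarrow> A \<le> B \<Longrightarrow> pd B"
  unfolding pd_def by (meson order_trans)

lemma pd_add: "pd A \<Longrightarrow> 0 \<le> B \<Longrightarrow> pd (A + B)"
  by (erule pd_mono) simp

lemma pd_scale: "pd A \<Longrightarrow> 0 < r \<Longrightarrow> pd (r *\<^sub>R A)"
proof -
  assume "pd A" "0 < r"
  then obtain e where "0 < e" "e *\<^sub>R 1 \<le> A" by (auto simp: pd_def)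
  then show ?thesis
    using scaleR_left_mono[of "e *\<^sub>R 1" A r] \<open>0 < r\<close> by (intro pdI[of "r * e"]) auto
qed

lemma pd_scalar [simp]: "0 < r \<Longrightarrow> pd (r *\<^sub>R 1)"
  by (auto intro: pdI)

lemma pd_one [simp]: "pd 1"
  using pd_scalar[of 1] by simp

text \<open>
  The Neumann series of \<open>A / m\<close> with \<open>m > \<parallel>A\<parallel>\<close>, summed by the iteration \<open>Y \<mapsto> 1 + (1 - A / m) Y\<close>.
\<close>

lemma inverse_exists:
  fixes A :: "'h :: chilbert_space oper"
  assumes "pd A"
  shows "\<exists>B. A * B = 1 \<and> B * A = 1 \<and> (\<forall>M. cstar_subalgebra M \<longrightarrow> A \<in> M \<longrightarrow> B \<in> M)"
proof -
  obtain e where e: "0 < e" "e *\<^sub>R 1 \<le> A" using assms by (auto simp: pd_def)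
  define m where "m = norm A + e"
  have "0 < m" using e by (simp add: m_def add_nonneg_pos)
  define c where "c = 1 - (1/m) *\<^sub>R A"
  define q where "q = 1 - e / m"
  have q: "0 \<le> q" "q < 1" using e \<open>0 < m\<close> by (auto simp: q_def m_def field_simps)
  have "A \<le> m *\<^sub>R 1"
    using assms e(1) by (intro le_scalar) (simp_all add: m_def)
  then have "(1/m) *\<^sub>R A \<le> (1/m) *\<^sub>R m *\<^sub>R 1"
    using \<open>0 < m\<close> by (intro scaleR_left_mono) auto
  then have "0 \<le> c" using \<open>0 < m\<close> by (simp add: c_def)
  have "(1/m) *\<^sub>R e *\<^sub>R 1 \<le> (1/m) *\<^sub>R A"
    using \<open>0 < m\<close> e by (intro scaleR_left_mono) auto
  then have "c \<le> q *\<^sub>R 1"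
    by (simp add: c_def q_def algebra_simps)
  then have "norm c \<le> q"
    using \<open>0 \<le> c\<close> q norm_le_iff_pos by blast
  define Y where "Y = rec_nat 0 (\<lambda>_ Z. 1 + c * Z)"
  have Y0: "Y 0 = 0" and YS: "Y (Suc n) = 1 + c * Y n" for n
    by (simp_all add: Y_def)
  define K where "K = norm (1 :: 'h oper) / (1 - q)"
  have step: "norm (Y (Suc n) - Y n) \<le> (K - K * q ^ Suc n) - (K - K * q ^ n)" for n
  proof (induction n)
    case 0
    have "K * (1 - q) = norm (1 :: 'h oper)" using q by (simp add: K_def)
    then show ?case by (simp add: YS Y0 algebra_simps)
  next
    case (Suc n)
    have "Y (Suc (Suc n)) - Y (Suc n) = c * (Y (Suc n) - Y n)"
      by (simp add: YS[of "Suc n"] YS[of n, THEN arg_cong, of "\<lambda>t. _ - t"] algebra_simps)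
    then have "norm (Y (Suc (Suc n)) - Y (Suc n)) \<le> norm c * norm (Y (Suc n) - Y n)"
      by (simp add: norm_mult_ineq)
    also have "\<dots> \<le> q * ((K - K * q ^ Suc n) - (K - K * q ^ n))"
      using Suc \<open>norm c \<le> q\<close> q by (intro mult_mono) auto
    finally show ?case by (simp add: algebra_simps)
  qed
  have "0 \<le> K" using q by (simp add: K_def)
  then have "K - K * q ^ n \<le> K" for n using q by simp
  from convergent_of_majorant[of Y "\<lambda>n. K - K * q ^ n", OF step this] obtain Z where Z: "Y \<longlonglongrightarrow> Z"
    by (auto simp: convergent_def)
  have "(\<lambda>n. Y (Suc n)) \<longlonglongrightarrow> Z" using Z by (rule LIMSEQ_Suc)
  moreover have "(\<lambda>n. 1 + c * Y n) \<longlonglongrightarrow> 1 + c * Z"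
    by (intro tendsto_intros Z)
  ultimately have fixpt: "Z = 1 + c * Z"
    unfolding YS using LIMSEQ_unique by blast
  have "Y n * c = c * Y n" for n
    by (induction n) (simp_all add: Y0 YS distrib_left distrib_right mult.assoc)
  then have "c * Z = Z * c"
    using closed_sequentially[OF closed_commutant[of c] _ Z] by simp
  then have "Z - c * Z = 1" "Z - Z * c = 1"
    using fixpt by (metis add_diff_cancel_right')+
  then have inv: "(1/m) *\<^sub>R (A * Z) = 1" "(1/m) *\<^sub>R (Z * A) = 1"
    by (simp_all add: c_def algebra_simps)
  show ?thesis
  proof (intro exI[of _ "(1/m) *\<^sub>R Z"] conjI allI impI)
    show "(1/m) *\<^sub>R Z \<in> M" if "cstar_subalgebra M" "A \<in> M" for M
    proof -
      interpret cstar_subalgebra M by fact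
      have "Y n \<in> M" for n
        using that(2) by (induction n) (auto simp: Y0 YS c_def)
      then have "Z \<in> M" using closed_sequentially[OF closed_M _ Z] by simp
      then show ?thesis by simp
    qed
  qed (use inv in simp_all)
qed

definition iv :: "'h oper \<Rightarrow> 'h :: chilbert_space oper" where
  "iv A = (SOME B. A * B = 1 \<and> B * A = 1 \<and> (\<forall>M. cstar_subalgebra M \<longrightarrow> A \<in> M \<longrightarrow> B \<in> M))"

lemma
  assumes "pd A"
  shows iv_right [simp]: "A * iv A = 1" and iv_left [simp]: "iv A * A = 1"
    and iv_mem: "cstar_subalgebra M \<Longrightarrow> A \<in> M \<Longrightarrow> iv A \<in> M"
  using someI_ex[OF inverse_exists[OF assms]] unfolding iv_def by blast+

lemma
  assumes "pd A"
  shows iv_right_assoc [simp]: "A * (iv A * X) = X" and iv_left_assoc [simp]: "iv A * (A * X) = X"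
  using assms by (simp_all flip: mult.assoc)

lemma iv_unique:
  assumes "pd A" "A * B = 1"
  shows "iv A = B"
proof -
  have "iv A * (A * B) = B" using assms(1) by simp
  then show ?thesis using assms(2) by simp
qed

lemma iv_commute: "pd A \<Longrightarrow> X * A = A * X \<Longrightarrow> X * iv A = iv A * X"
proof -
  assume "pd A" "X * A = A * X"
  then have "iv A * (X * A) * iv A = iv A * (A * X) * iv A" by simp
  then show ?thesis using \<open>pd A\<close> by (simp add: mult.assoc)
qed

lemma iv_star [simp]: "pd A \<Longrightarrow> star (iv A) = iv A"
proof -
  assume "pd A"
  then have "star A * star (iv A) = 1" by (simp only: star_simps(5)[symmetric] iv_left star_simps(7))
  then have "A * star (iv A) = 1" using \<open>pd A\<close> by simp
  from iv_unique[OF \<open>pd A\<close> this] show ?thesis by simp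
qed

lemma iv_nonneg: "pd A \<Longrightarrow> 0 \<le> iv A"
  using conj_nonneg[of A "iv A"] by (simp add: pd_nonneg mult.assoc)

lemma
  assumes "pd A"
  shows rt_iv_conj: "rt (iv A) * A * rt (iv A) = 1" and rt_iv_square: "rt (iv A) * rt (iv A) = iv A"
    and rt_iv_star: "star (rt (iv A)) = rt (iv A)"
proof -
  show sq: "rt (iv A) * rt (iv A) = iv A" by (rule rt_square[OF iv_nonneg[OF assms]])
  have "A * rt (iv A) = rt (iv A) * A"
    using assms by (intro rt_commute iv_nonneg) simp_all
  then have "rt (iv A) * A * rt (iv A) = A * (rt (iv A) * rt (iv A))"
    by (simp flip: mult.assoc)
  then show "rt (iv A) * A * rt (iv A) = 1" using sq assms by simp
  show "star (rt (iv A)) = rt (iv A)" by (simp add: iv_nonneg assms)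
qed

lemma pd_iv [simp]: "pd A \<Longrightarrow> pd (iv A)"
proof -
  assume "pd A"
  define m where "m = norm A + 1"
  have "0 < m" by (simp add: m_def add_nonneg_pos)
  have "A \<le> m *\<^sub>R 1" using \<open>pd A\<close> by (intro le_scalar) (auto simp: m_def)
  then have "rt (iv A) * A * rt (iv A) \<le> rt (iv A) * (m *\<^sub>R 1) * rt (iv A)"
    by (rule conj_mono_sa) (rule rt_iv_star[OF \<open>pd A\<close>])
  then have "1 \<le> m *\<^sub>R iv A"
    using \<open>pd A\<close> by (simp add: rt_iv_conj rt_iv_square)
  then have "(1/m) *\<^sub>R 1 \<le> (1/m) *\<^sub>R m *\<^sub>R iv A"
    using \<open>0 < m\<close> by (intro scaleR_left_mono) auto
  then show ?thesis using \<open>0 < m\<close> by (intro pdI[of "1/m"]) auto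
qed

lemma iv_iv [simp]: "pd A \<Longrightarrow> iv (iv A) = A"
  by (intro iv_unique) simp_all

lemma pd_conj: "pd A \<Longrightarrow> pd S \<Longrightarrow> pd (S * A * S)"
proof -
  assume "pd A" "pd S"
  then obtain e d where e: "0 < e" "e *\<^sub>R 1 \<le> A" and d: "0 < d" "d *\<^sub>R 1 \<le> S" by (auto simp: pd_def)
  have S0: "0 \<le> S" using \<open>pd S\<close> by (rule pd_nonneg)
  have "rt S * (d *\<^sub>R 1) * rt S \<le> rt S * S * rt S"
    using S0 by (intro conj_mono_sa d) simp
  moreover have "rt S * S * rt S = S * S"
    using rt_commute[OF S0, of S] rt_square[OF S0] by (simp add: mult.assoc) (metis mult.assoc)
  ultimately have "d *\<^sub>R S \<le> S * S"
    using rt_square[OF S0] by simp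
  moreover have "d *\<^sub>R d *\<^sub>R 1 \<le> d *\<^sub>R S" using d by (intro scaleR_left_mono) auto
  ultimately have "e *\<^sub>R d *\<^sub>R d *\<^sub>R 1 \<le> e *\<^sub>R (S * S)"
    using e by (intro scaleR_left_mono) (auto intro: order_trans)
  also have "\<dots> \<le> S * A * S"
    using conj_mono_sa[OF e(2), of S] \<open>pd S\<close> by simp
  finally show ?thesis using e d by (intro pdI[of "e * d * d"]) (auto simp: mult.assoc)
qed

lemma pd_rt: "pd A \<Longrightarrow> pd (rt A)"
proof -
  assume "pd A"
  have A0: "0 \<le> A" by (rule pd_nonneg) fact
  define m where "m = norm (rt A) + 1"
  have "0 < m" by (simp add: m_def add_nonneg_pos)
  have rm: "rt A \<le> m *\<^sub>R 1" using A0 by (intro le_scalar) (auto simp: m_def)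
  have "0 \<le> rt A * (m *\<^sub>R 1 - rt A)"
    using rm rt_nonneg[OF A0] by (intro mult_nonneg_commute) (simp_all add: algebra_simps)
  then have "A \<le> m *\<^sub>R rt A"
    using rt_square[OF A0] by (simp add: algebra_simps)
  then have "pd (m *\<^sub>R rt A)" using \<open>pd A\<close> pd_mono by blast
  from pd_scale[OF this, of "1/m"] \<open>0 < m\<close> show ?thesis by simp
qed

text \<open>
  Conjugation with \<open>A\<^sup>-\<^sup>1\<^sup>/\<^sup>2\<close> reduces the claim to \<open>1 \<le> C\<close>, where it follows from conjugation with \<open>C\<^sup>-\<^sup>1\<^sup>/\<^sup>2\<close>.
\<close>

lemma iv_antimono:
  assumes "pd A" "A \<le> B"
  shows "iv B \<le> iv A"
proof -
  have "pd B" using assms pd_mono by blast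
  define R where "R = rt (iv A)"
  have sR: "star R = R" and RAR: "R * A * R = 1" and RR: "R * R = iv A"
    using assms(1) by (simp_all add: R_def rt_iv_conj rt_iv_square rt_iv_star iv_nonneg)
  have "pd R" unfolding R_def by (intro pd_rt pd_iv assms)
  define C where "C = R * B * R"
  have "1 \<le> C" using conj_mono_sa[OF assms(2) sR] RAR by (simp add: C_def)
  then have "pd C" by (rule pd_mono[OF pd_one])
  have "rt (iv C) * 1 * rt (iv C) \<le> rt (iv C) * C * rt (iv C)"
    by (rule conj_mono_sa[OF \<open>1 \<le> C\<close> rt_iv_star[OF \<open>pd C\<close>]])
  then have "iv C \<le> 1" using \<open>pd C\<close> by (simp add: rt_iv_conj rt_iv_square)
  then have "R * iv C * R \<le> R * 1 * R" using sR by (rule conj_mono_sa)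
  moreover have "iv B = R * iv C * R"
  proof (rule iv_unique[OF \<open>pd B\<close>])
    have "C * iv C = 1" using \<open>pd C\<close> by simp
    then have "iv R * (C * iv C) * R = 1" using \<open>pd R\<close> by simp
    then show "B * (R * iv C * R) = 1"
      using \<open>pd R\<close> by (simp add: C_def mult.assoc)
  qed
  ultimately show ?thesis using RR by simp
qed

lemma iv_le_iff: "pd A \<Longrightarrow> pd B \<Longrightarrow> iv B \<le> iv A \<longleftrightarrow> A \<le> B"
  using iv_antimono[of A B] iv_antimono[of "iv B" "iv A"] by auto

lemma nonneg_scaleD: "0 < r \<Longrightarrow> 0 \<le> r *\<^sub>R X \<Longrightarrow> 0 \<le> X" for X :: "'h :: chilbert_space oper"
  using scaleR_nonneg_nonneg[of "inverse r" "r *\<^sub>R X"] by (simp only: scaleR_scaleR) simp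

text \<open>Adding the two factors of a positive commuting product makes the sign of each visible.\<close>

lemma square_le_imp_le:
  fixes X Y :: "'h :: chilbert_space oper"
  assumes "star X = X" "pd Y" "X * Y = Y * X" "X * X \<le> Y * Y"
  shows "X \<le> Y"
proof -
  have "0 \<le> (Y - X) * (Y - X) + (Y * Y - X * X)"
    using assms star_mult_nonneg[of "Y - X"] by (intro add_nonneg_nonneg) simp_all
  also have "\<dots> = 2 *\<^sub>R ((Y - X) * Y)"
    using assms(3) by (simp add: algebra_simps scaleR_2)
  finally have "0 \<le> (Y - X) * Y"
    by (rule nonneg_scaleD[rotated]) simp
  then have "(Y - X) * Y * iv Y = iv Y * ((Y - X) * Y) \<Longrightarrow> 0 \<le> (Y - X) * Y * iv Y"
    using assms(2) by (rule_tac mult_nonneg_commute) (simp_all add: iv_nonneg)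
  moreover have "(Y - X) * Y * iv Y = iv Y * ((Y - X) * Y)"
    using assms(2,3) by (intro iv_commute) (simp_all add: algebra_simps)
  ultimately have "0 \<le> (Y - X) * Y * iv Y" by blast
  then show ?thesis using assms(2) by (simp add: mult.assoc)
qed

lemma nonpos_of_le_scalars:
  fixes X :: "'h :: chilbert_space oper"
  assumes "\<And>e. 0 < e \<Longrightarrow> X \<le> e *\<^sub>R 1"
  shows "X \<le> 0"
proof -
  have sa: "star X = X"
    using assms[of 1] by (simp add: oper_le_iff algebra_simps)
  have "Re (cinner (app X x) x) \<le> 0" for x
  proof (rule field_le_epsilon)
    fix e :: real assume "0 < e"
    define d where "d = e / ((norm x)\<^sup>2 + 1)"
    have "0 < d" using \<open>0 < e\<close> by (simp add: d_def add_nonneg_pos)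
    have "Re (cinner (app X x) x) \<le> d * (norm x)\<^sup>2"
      using assms[OF \<open>0 < d\<close>] by (simp add: oper_le_iff cinner_simps cinner_self)
    also have "\<dots> \<le> d * ((norm x)\<^sup>2 + 1)" using \<open>0 < d\<close> by simp
    also have "\<dots> = e" by (simp add: d_def add_nonneg_eq_0_iff)
    finally show "Re (cinner (app X x) x) \<le> 0 + e" by simp
  qed
  then show ?thesis by (simp add: oper_le_iff sa)
qed

section \<open>Projections\<close>

definition proj :: "'h :: chilbert_space oper \<Rightarrow> bool"
  where "proj P \<longleftrightarrow> star P = P \<and> P * P = P"

lemma proj_compl [simp]: "proj P \<Longrightarrow> proj (1 - P)"
  unfolding proj_def by (simp add: algebra_simps)

lemma proj_0 [simp]: "proj 0" and proj_1 [simp]: "proj 1"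
  by (simp_all add: proj_def)

lemma
  assumes "proj P"
  shows proj_star [simp]: "star P = P" and proj_idem [simp]: "P * P = P"
    and proj_idem_assoc [simp]: "P * (P * X) = P * X"
  using assms by (simp_all add: proj_def flip: mult.assoc)

lemma proj_nonneg: "proj P \<Longrightarrow> 0 \<le> P"
  using star_mult_nonneg[of P] by simp

lemma proj_le_1: "proj P \<Longrightarrow> P \<le> 1"
  using proj_nonneg[of "1 - P"] by simp

lemma proj_le_iff:
  assumes "proj P" "proj Q"
  shows "P \<le> Q \<longleftrightarrow> P * Q = P" "P \<le> Q \<longleftrightarrow> Q * P = P"
proof -
  have sym: "P * Q = P \<longleftrightarrow> Q * P = P"
    using assms by (metis proj_star star_simps(5))
  have "P * Q = P" if "P \<le> Q"
  proof -
    have "(1 - Q) * P * (1 - Q) \<le> (1 - Q) * Q * (1 - Q)"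
      using that assms by (intro conj_mono_sa) simp_all
    also have "\<dots> = 0" using assms by (simp add: algebra_simps)
    finally have "star (1 - Q) * P * (1 - Q) = 0"
      using conj_nonneg[OF proj_nonneg[OF assms(1)], of "1 - Q"] assms by simp
    then have "P * (1 - Q) = 0" by (rule compress_eq_0[OF proj_nonneg[OF assms(1)]])
    then show ?thesis by (simp add: algebra_simps)
  qed
  moreover have "P \<le> Q" if "P * Q = P"
  proof -
    have "(Q - P) * (Q - P) = Q - P" using that sym assms by (simp add: algebra_simps)
    then show ?thesis
      using star_mult_nonneg[of "Q - P"] assms by simp
  qed
  ultimately show "P \<le> Q \<longleftrightarrow> P * Q = P" "P \<le> Q \<longleftrightarrow> Q * P = P" using sym by blast+
qed

lemma proj_scale_le:
  assumes "proj P" "P \<noteq> 0" "a *\<^sub>R P \<le> b *\<^sub>R P"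
  shows "a \<le> b"
proof (rule ccontr)
  assume "\<not> a \<le> b"
  then have "0 < a - b" by simp
  moreover have "(a - b) *\<^sub>R P \<le> 0" using assms(3) by (simp add: algebra_simps)
  ultimately have "0 \<le> - P" using nonneg_scaleD[of "a - b" "- P"] by simp
  then show False using proj_nonneg[OF assms(1)] assms(2) by auto
qed

lemma proj_mult_commute: "proj P \<Longrightarrow> proj Q \<Longrightarrow> P * Q = Q * P \<Longrightarrow> proj (P * Q)"
  unfolding proj_def by (metis mult.assoc star_simps(5))

lemma compress_commute: "proj P \<Longrightarrow> X * P = P * X \<Longrightarrow> P * X * P = P * X"
  by (metis mult.assoc proj_idem)

lemma scalar_compress_le:
  assumes "proj P" "X \<le> c *\<^sub>R 1"
  shows "P * X * P \<le> c *\<^sub>R P"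
  using conj_mono_sa[OF assms(2), of P] assms(1) by simp

lemma scalar_compress_ge:
  assumes "proj P" "c *\<^sub>R 1 \<le> X"
  shows "c *\<^sub>R P \<le> P * X * P"
  using conj_mono_sa[OF assms(2), of P] assms(1) by simp

lemma compress_sub:
  assumes "proj P" "proj Q" "P \<le> Q"
  shows "P * (Q * X * Q) * P = P * X * P"
proof -
  have "P * Q = P" "Q * P = P" using assms proj_le_iff by blast+
  then show ?thesis by (metis mult.assoc)
qed

lemma compress_sub_le:
  assumes "proj P" "proj Q" "P \<le> Q" "Q * X * Q \<le> c *\<^sub>R Q"
  shows "P * X * P \<le> c *\<^sub>R P"
  using conj_mono_sa[OF assms(4), of P] assms(1) compress_sub[OF assms(1-3)] proj_le_iff(1)[OF assms(1,2)] assms(3)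
  by simp

lemma compress_sub_ge:
  assumes "proj P" "proj Q" "P \<le> Q" "c *\<^sub>R Q \<le> Q * X * Q"
  shows "c *\<^sub>R P \<le> P * X * P"
  using conj_mono_sa[OF assms(4), of P] assms(1) compress_sub[OF assms(1-3)] proj_le_iff(1)[OF assms(1,2)] assms(3)
  by simp

text \<open>
  Lower bounds for norms are always obtained by compressing to a nonzero projection.
\<close>

lemma le_norm_of_compress:
  assumes "proj P" "P \<noteq> 0" "star Y = Y" "c *\<^sub>R P \<le> P * Y * P"
  shows "c \<le> norm Y"
proof -
  have "P * Y * P \<le> norm Y *\<^sub>R P" by (intro scalar_compress_le assms le_norm)
  then show ?thesis using proj_scale_le[OF assms(1,2)] assms(4) order_trans by blast
qed

text \<open>
  Completing the square in the off-diagonal blocks: the difference of the two sides is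
  \<open>S D S\<close> with \<open>S = \<surd>\<theta> P - (1 - P) / \<surd>\<theta>\<close>.
\<close>

lemma block_bound:
  assumes "proj P" "0 \<le> D" "0 < \<theta>"
  shows "D \<le> (1 + \<theta>) *\<^sub>R (P * D * P) + (1 + 1 / \<theta>) *\<^sub>R ((1 - P) * D * (1 - P))"
proof -
  define Q where "Q = 1 - P"
  define s where "s = sqrt \<theta>"
  have s: "0 < s" "s * s = \<theta>" using assms(3) by (simp_all add: s_def)
  define S where "S = s *\<^sub>R P - (1 / s) *\<^sub>R Q"
  have "0 \<le> S * D * S"
    using conj_nonneg[OF assms(2), of S] assms(1) by (simp add: S_def Q_def)
  also have "S * D * S = \<theta> *\<^sub>R (P * D * P) + (1 / \<theta>) *\<^sub>R (Q * D * Q) - P * D * Q - Q * D * P"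
    using s by (simp add: S_def algebra_simps flip: s(2))
  also have "\<dots> = (1 + \<theta>) *\<^sub>R (P * D * P) + (1 + 1 / \<theta>) *\<^sub>R (Q * D * Q) - (P + Q) * D * (P + Q)"
    by (simp add: algebra_simps)
  also have "P + Q = 1" by (simp add: Q_def)
  finally show ?thesis by (simp add: Q_def)
qed

lemma block_bound_scalar:
  assumes "proj P" "0 \<le> D" "0 < \<theta>" "P * D * P \<le> c *\<^sub>R P"
  shows "D \<le> ((1 + \<theta>) * c) *\<^sub>R P + ((1 + 1 / \<theta>) * norm D) *\<^sub>R (1 - P)"
proof -
  have "(1 - P) * D * (1 - P) \<le> norm D *\<^sub>R (1 - P)"
    using assms by (intro scalar_compress_le le_norm nonneg_star) simp_all
  then have "(1 + \<theta>) *\<^sub>R (P * D * P) + (1 + 1 / \<theta>) *\<^sub>R ((1 - P) * D * (1 - P))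
      \<le> (1 + \<theta>) *\<^sub>R c *\<^sub>R P + (1 + 1 / \<theta>) *\<^sub>R norm D *\<^sub>R (1 - P)"
    using assms by (intro add_mono scaleR_left_mono) auto
  with block_bound[OF assms(1-3)] show ?thesis by simp
qed

section \<open>Spectral projections in AW*-algebras\<close>

text \<open>The absolute value dominates: compare \<open>D\<close> with the invertible \<open>|D| + e\<close>.\<close>

lemma le_abs:
  fixes D :: "'h :: chilbert_space oper"
  assumes "star D = D"
  shows "D \<le> rt (D * D)"
proof -
  have DD: "0 \<le> D * D" using star_mult_nonneg[of D] assms by simp
  have comm: "D * rt (D * D) = rt (D * D) * D" by (rule rt_commute[OF DD]) (simp add: mult.assoc)
  have "D - rt (D * D) \<le> 0"
  proof (rule nonpos_of_le_scalars)
    fix e :: real assume "0 < e"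
    have "D \<le> rt (D * D) + e *\<^sub>R 1"
    proof (rule square_le_imp_le[OF assms])
      show "pd (rt (D * D) + e *\<^sub>R 1)"
        using pd_add[OF pd_scalar[OF \<open>0 < e\<close>] rt_nonneg[OF DD]] by (simp add: add.commute)
      show "D * (rt (D * D) + e *\<^sub>R 1) = (rt (D * D) + e *\<^sub>R 1) * D"
        using comm by (simp add: algebra_simps)
      have "(rt (D * D) + e *\<^sub>R 1) * (rt (D * D) + e *\<^sub>R 1) = D * D + ((2 * e) *\<^sub>R rt (D * D) + (e * e) *\<^sub>R 1)"
        using rt_square[OF DD] by (simp add: algebra_simps scaleR_2 flip: scaleR_add_left)
      moreover have "0 \<le> (2 * e) *\<^sub>R rt (D * D) + (e * e) *\<^sub>R 1"
        using \<open>0 < e\<close> rt_nonneg[OF DD] one_nonneg by (intro add_nonneg_nonneg scaleR_nonneg_nonneg) auto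
      ultimately show "D * D \<le> (rt (D * D) + e *\<^sub>R 1) * (rt (D * D) + e *\<^sub>R 1)" by simp
    qed
    then show "D - rt (D * D) \<le> e *\<^sub>R 1" by (simp add: algebra_simps)
  qed
  then show ?thesis by simp
qed

text \<open>
  The condition on annihilators is the only source of projections: it supplies spectral projections and meets.
\<close>

locale aw_star = cstar_subalgebra +
  assumes annihilator: "S \<subseteq> M \<Longrightarrow> S \<noteq> {} \<Longrightarrow>
    \<exists>P\<in>M. proj P \<and> {X \<in> M. \<forall>s\<in>S. s * X = 0} = (\<lambda>X. P * X) ` M"
begin

lemma annihilator_proj:
  assumes "S \<subseteq> M" "S \<noteq> {}"
  obtains P where "P \<in> M" "proj P" "\<And>s. s \<in> S \<Longrightarrow> s * P = 0"
    "\<And>X. X \<in> M \<Longrightarrow> (\<And>s. s \<in> S \<Longrightarrow> s * X = 0) \<Longrightarrow> P * X = X"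
proof -
  obtain P where P: "P \<in> M" "proj P" "{X \<in> M. \<forall>s\<in>S. s * X = 0} = (\<lambda>X. P * X) ` M"
    using annihilator[OF assms] by blast
  have "P * 1 \<in> (\<lambda>X. P * X) ` M" by blast
  then have "P \<in> {X \<in> M. \<forall>s\<in>S. s * X = 0}" unfolding P(3) by simp
  then have "s * P = 0" if "s \<in> S" for s using that by blast
  moreover have "P * X = X" if "X \<in> M" "\<And>s. s \<in> S \<Longrightarrow> s * X = 0" for X
  proof -
    have "X \<in> (\<lambda>X. P * X) ` M" using that P(3) by blast
    then show ?thesis using P(2) by auto
  qed
  ultimately show ?thesis by (rule that[OF P(1,2)])
qed

lemma proj_meet:
  assumes "R \<in> M" "proj R" "Q \<in> M" "proj Q"
  obtains E where "E \<in> M" "proj E" "E \<le> R" "E \<le> Q"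
    "\<And>X. X \<in> M \<Longrightarrow> R * X = X \<Longrightarrow> Q * X = X \<Longrightarrow> E * X = X"
proof -
  obtain E where E: "E \<in> M" "proj E" "\<And>s. s \<in> {1 - R, 1 - Q} \<Longrightarrow> s * E = 0"
    "\<And>X. X \<in> M \<Longrightarrow> (\<And>s. s \<in> {1 - R, 1 - Q} \<Longrightarrow> s * X = 0) \<Longrightarrow> E * X = X"
    by (rule annihilator_proj[of "{1 - R, 1 - Q}"]) (use assms in auto)
  have "E \<le> R" "E \<le> Q"
    unfolding proj_le_iff(2)[OF E(2) assms(2)] proj_le_iff(2)[OF E(2) assms(4)]
    using E(3)[of "1 - R"] E(3)[of "1 - Q"] by (simp_all add: algebra_simps)
  moreover have "E * X = X" if "X \<in> M" "R * X = X" "Q * X = X" for X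
    using that by (intro E(4)) (auto simp: left_diff_distrib)
  ultimately show ?thesis using that E(1,2) by blast
qed

text \<open>
  The complement of \<open>P\<close> is the annihilator of the positive part of \<open>D\<close>.
\<close>

lemma spectral_split:
  assumes "D \<in> M" "star D = D"
  obtains P where "P \<in> M" "proj P" "\<And>X. X \<in> M \<Longrightarrow> X * D = D * X \<Longrightarrow> X * P = P * X"
    "0 \<le> P * D" "(1 - P) * D \<le> 0"
proof -
  define A where "A = rt (D * D)"
  have DD: "0 \<le> D * D" using star_mult_nonneg[of D] assms by simp
  have A: "A \<in> M" "star A = A" "A * A = D * D"
    using rt_mem[OF DD cstar_subalgebra_axioms] assms rt_square[OF DD] DD by (simp_all add: A_def)
  have comm: "X * A = A * X" if "X * D = D * X" for X
    unfolding A_def using that by (intro rt_commute[OF DD]) (metis mult.assoc)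
  have "D \<le> A" "- D \<le> A"
    using le_abs[of D] le_abs[of "- D"] assms(2) by (simp_all add: A_def)
  define U where "U = (1/2) *\<^sub>R (A + D)"
  define V where "V = (1/2) *\<^sub>R (A - D)"
  have "0 \<le> A + D" "0 \<le> A - D"
    using add_left_mono[OF \<open>- D \<le> A\<close>, of D] \<open>D \<le> A\<close> by (simp_all add: add.commute)
  then have U: "U \<in> M" "star U = U" "0 \<le> U" and V: "V \<in> M" "star V = V" "0 \<le> V"
    using A assms by (simp_all add: U_def V_def scaleR_nonneg_nonneg)
  have UV: "U * V = 0"
    using A(3) comm[OF refl] by (simp add: U_def V_def algebra_simps)
  have D: "D = U - V"
    by (simp add: U_def V_def flip: scaleR_diff_right)
  obtain Q where Q: "Q \<in> M" "proj Q" "\<And>s. s \<in> {U} \<Longrightarrow> s * Q = 0"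
    "\<And>X. X \<in> M \<Longrightarrow> (\<And>s. s \<in> {U} \<Longrightarrow> s * X = 0) \<Longrightarrow> Q * X = X"
    by (rule annihilator_proj[of "{U}"]) (use U in auto)
  have UQ: "U * Q = 0" using Q(3) by simp
  then have QU: "Q * U = 0" using U(2) Q(2) by (metis proj_star star_simps(5,6))
  have QV: "Q * V = V" using Q(4)[OF V(1)] UV by simp
  show ?thesis
  proof (rule that[of "1 - Q"])
    show "1 - Q \<in> M" "proj (1 - Q)" using Q by simp_all
    show "0 \<le> (1 - Q) * D" "(1 - (1 - Q)) * D \<le> 0"
      using QU QV U V by (simp_all add: D algebra_simps)
    fix X assume X: "X \<in> M" "X * D = D * X"
    have key: "Q * Y * Q = Y * Q" if "Y \<in> M" "Y * D = D * Y" for Y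
    proof -
      have "Y * U = U * Y" using comm[OF that(2)] that(2) by (simp add: U_def algebra_simps)
      then have "U * (Y * Q) = 0" using UQ by (metis mult.assoc mult_zero_right)
      then show ?thesis using Q(4)[of "Y * Q"] that(1) Q(1) by (simp add: mult.assoc)
    qed
    have "star X * D = D * star X"
      using X(2) assms(2) by (metis star_simps(5))
    then have "Q * star X * Q = star X * Q" using key X(1) by simp
    then have "star (Q * star X * Q) = star (star X * Q)" by simp
    then have "Q * X * Q = Q * X" using Q(2) by (simp add: mult.assoc)
    then have "X * Q = Q * X" using key[OF X] by simp
    then show "X * (1 - Q) = (1 - Q) * X" by (simp add: algebra_simps)
  qed
qed

lemma spectral_pos:
  assumes "D \<in> M" "star D = D" "\<not> D \<le> 0"
  obtains P d where "P \<in> M" "proj P" "P \<noteq> 0" "\<And>X. X \<in> M \<Longrightarrow> X * D = D * X \<Longrightarrow> X * P = P * X"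
    "0 < d" "d *\<^sub>R P \<le> P * D * P"
proof -
  obtain d where d: "0 < d" "\<not> D \<le> d *\<^sub>R 1"
    using assms(3) nonpos_of_le_scalars by blast
  obtain P where P: "P \<in> M" "proj P" "\<And>X. X \<in> M \<Longrightarrow> X * (D - d *\<^sub>R 1) = (D - d *\<^sub>R 1) * X \<Longrightarrow> X * P = P * X"
    "0 \<le> P * (D - d *\<^sub>R 1)" "(1 - P) * (D - d *\<^sub>R 1) \<le> 0"
    by (rule spectral_split[of "D - d *\<^sub>R 1"]) (use assms in auto)
  have comm: "X * P = P * X" if "X \<in> M" "X * D = D * X" for X
    using that by (intro P(3)) (simp_all add: algebra_simps)
  have "d *\<^sub>R P \<le> P * D * P"
    using P(4) comm[OF assms(1) refl] P(2) by (simp add: compress_commute algebra_simps)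
  moreover have "P \<noteq> 0" using P(5) d(2) by auto
  ultimately show ?thesis using that P(1,2) comm d(1) by blast
qed

text \<open>Some projection below \<open>P\<^sub>0\<close> compresses \<open>T\<close> to within \<open>e\<close> of a scalar.\<close>

lemma narrow_proj:
  assumes P0: "P0 \<in> M" "proj P0" "P0 \<noteq> 0" and T: "T \<in> M" "star T = T" and "0 < e"
  obtains P c where "P \<in> M" "proj P" "P \<noteq> 0" "P \<le> P0" "c *\<^sub>R P \<le> P * T * P" "P * T * P \<le> (c + e) *\<^sub>R P"
proof -
  define L where "L = {l. P0 * T * P0 \<le> l *\<^sub>R P0}"
  have "norm T \<in> L" unfolding L_def using P0 T by (auto intro: scalar_compress_le le_norm)
  have low: "- norm T \<le> l" if "l \<in> L" for l
  proof -
    have "(- norm T) *\<^sub>R P0 \<le> P0 * T * P0"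
      using P0 neg_norm_le[OF T(2)] by (intro scalar_compress_ge) simp_all
    then show ?thesis using that proj_scale_le[OF P0(2,3)] order_trans unfolding L_def by blast
  qed
  then have bdd: "bdd_below L" by (rule bdd_belowI)
  obtain l where l: "l \<in> L" "l < Inf L + e"
    using cInf_lessD[of L "Inf L + e"] \<open>norm T \<in> L\<close> \<open>0 < e\<close> by auto
  then have "l - e \<notin> L" using cInf_lower[OF _ bdd, of "l - e"] by linarith
  define D where "D = P0 * T * P0 - (l - e) *\<^sub>R P0"
  have "\<not> D \<le> 0" using \<open>l - e \<notin> L\<close> by (simp add: D_def L_def)
  moreover have D: "D \<in> M" "star D = D" using P0 T by (simp_all add: D_def mult.assoc)
  ultimately obtain Q d where Q: "Q \<in> M" "proj Q" "Q \<noteq> 0" "\<And>X. X \<in> M \<Longrightarrow> X * D = D * X \<Longrightarrow> X * Q = Q * X"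
    "0 < d" "d *\<^sub>R Q \<le> Q * D * Q"
    using spectral_pos by metis
  have "P0 * D = D" "D * P0 = D" using P0 by (simp_all add: D_def algebra_simps)
  then have comm: "P0 * Q = Q * P0" using Q(4) P0 by simp
  have "d *\<^sub>R ((1 - P0) * Q * (1 - P0)) \<le> (1 - P0) * (Q * D * Q) * (1 - P0)"
    using conj_mono_sa[OF Q(6), of "1 - P0"] P0 by simp
  also have "\<dots> = Q * ((1 - P0) * D) * (1 - P0) * Q"
    using comm by (simp add: algebra_simps) (metis mult.assoc comm)
  also have "(1 - P0) * D = 0" using \<open>P0 * D = D\<close> by (simp add: algebra_simps)
  finally have "0 \<le> d *\<^sub>R (- ((1 - P0) * Q * (1 - P0)))" by simp
  then have "(1 - P0) * Q * (1 - P0) \<le> 0" using nonneg_scaleD[OF Q(5)] by fastforce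
  moreover have "0 \<le> (1 - P0) * Q * (1 - P0)"
    using conj_nonneg[OF proj_nonneg[OF Q(2)], of "1 - P0"] P0 by simp
  ultimately have "(1 - P0) * Q * (1 - P0) = 0" by simp
  then have "Q * (1 - P0) = 0" using compress_eq_0[OF proj_nonneg[OF Q(2)], of "1 - P0"] P0 by simp
  then have "Q * P0 = Q" by (simp add: algebra_simps)
  then have "Q \<le> P0" using proj_le_iff Q P0 by blast
  have QT: "Q * (P0 * T * P0) * Q = Q * T * Q" by (rule compress_sub) (use Q P0 \<open>Q \<le> P0\<close> in auto)
  have "0 \<le> Q * D * Q" using Q proj_nonneg scaleR_nonneg_nonneg by (meson less_imp_le order_trans)
  also have "Q * D * Q = Q * (P0 * T * P0) * Q - (l - e) *\<^sub>R (Q * P0 * Q)"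
    by (simp add: D_def algebra_simps)
  finally have "(l - e) *\<^sub>R Q \<le> Q * T * Q" using QT \<open>Q * P0 = Q\<close> Q(2) by simp
  moreover have "Q * T * Q \<le> l *\<^sub>R Q"
    using l(1) compress_sub_le[OF Q(2) P0(2) \<open>Q \<le> P0\<close>] by (simp add: L_def)
  ultimately show ?thesis using that[of Q "l - e"] Q \<open>Q \<le> P0\<close> by simp
qed

text \<open>
  An induction principle in place of the spectral theorem: the interval \<open>[d, d r\<^sup>n]\<close> is cut at
  the points \<open>d r\<^sup>k\<close>.
\<close>

lemma spectral_induct:
  assumes D: "D \<in> M" "star D = D" and d: "0 < d" "d *\<^sub>R 1 \<le> D" and "1 < r"
    and narrow: "\<And>Q l. Q \<in> M \<Longrightarrow> proj Q \<Longrightarrow> Q * D = D * Q \<Longrightarrow> 0 < l \<Longrightarrow> l *\<^sub>R Q \<le> Q * D * Q \<Longrightarrow>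
      Q * D * Q \<le> (r * l) *\<^sub>R Q \<Longrightarrow> \<Phi> Q"
    and add: "\<And>P Q. P \<in> M \<Longrightarrow> Q \<in> M \<Longrightarrow> proj P \<Longrightarrow> proj Q \<Longrightarrow> P * D = D * P \<Longrightarrow> Q * D = D * Q \<Longrightarrow>
      P * Q = 0 \<Longrightarrow> Q * P = 0 \<Longrightarrow> \<Phi> P \<Longrightarrow> \<Phi> Q \<Longrightarrow> \<Phi> (P + Q)"
  shows "\<Phi> 1"
proof -
  have main: "\<Phi> Q" if "Q \<in> M" "proj Q" "Q * D = D * Q" "Q * D * Q \<le> (d * r ^ n) *\<^sub>R Q" for Q n
    using that
  proof (induction n arbitrary: Q)
    case 0
    have "Q * D * Q \<le> (r * d) *\<^sub>R Q"
      using 0 d \<open>1 < r\<close> proj_nonneg[OF 0(2)] by (intro order_trans[OF 0(4)] scaleR_right_mono) auto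
    then show ?case
      using 0 d by (intro narrow[of Q d] scalar_compress_ge) auto
  next
    case (Suc n)
    define c where "c = d * r ^ n"
    have "0 < c" using d \<open>1 < r\<close> by (simp add: c_def)
    obtain P where P: "P \<in> M" "proj P" "\<And>X. X \<in> M \<Longrightarrow> X * (D - c *\<^sub>R 1) = (D - c *\<^sub>R 1) * X \<Longrightarrow> X * P = P * X"
      "0 \<le> P * (D - c *\<^sub>R 1)" "(1 - P) * (D - c *\<^sub>R 1) \<le> 0"
      by (rule spectral_split[of "D - c *\<^sub>R 1"]) (use D in auto)
    have comm: "X * P = P * X" if "X \<in> M" "X * D = D * X" for X
      using that by (intro P(3)) (simp_all add: algebra_simps)
    note PD = comm[OF D(1) refl] and PQ = comm[OF Suc.prems(1,3)]
    define Q1 Q2 where "Q1 = (1 - P) * Q" and "Q2 = P * Q"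
    have comm1: "(1 - P) * Q = Q * (1 - P)" using PQ by (simp add: algebra_simps)
    have p: "Q1 \<in> M" "Q2 \<in> M" "proj Q1" "proj Q2"
      using P Suc.prems PQ comm1 by (simp_all add: Q1_def Q2_def proj_mult_commute)
    have le: "Q1 \<le> Q" "Q2 \<le> Q" "Q2 \<le> P" "Q1 \<le> 1 - P"
      using p P Suc.prems PQ comm1 by (simp_all add: proj_le_iff) (simp_all add: Q1_def Q2_def mult.assoc)
    have cD: "Q1 * D = D * Q1" "Q2 * D = D * Q2"
      using PD Suc.prems(3) by (simp_all add: Q1_def Q2_def algebra_simps) (metis mult.assoc)+
    have orth: "Q1 * Q2 = 0" "Q2 * Q1 = 0"
      using PQ P(2) by (simp_all add: Q1_def Q2_def algebra_simps) (metis mult.assoc proj_idem_assoc)+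
    have "c *\<^sub>R P \<le> P * D * P"
      using P(4) PD P(2) by (simp add: compress_commute algebra_simps)
    then have "c *\<^sub>R Q2 \<le> Q2 * D * Q2" by (intro compress_sub_ge[OF p(4) P(2) le(3)])
    moreover have "Q2 * D * Q2 \<le> (r * c) *\<^sub>R Q2"
      using Suc.prems by (intro compress_sub_le[OF p(4) _ le(2)]) (simp_all add: c_def mult.left_commute)
    ultimately have "\<Phi> Q2" using p cD \<open>0 < c\<close> by (intro narrow)
    have "(1 - P) * D * (1 - P) \<le> c *\<^sub>R (1 - P)"
    proof -
      have "(1 - P) * D * (1 - P) = (1 - P) * D"
        using PD P(2) by (intro compress_commute) (simp_all add: algebra_simps)
      then show ?thesis using P(5) by (simp add: algebra_simps)
    qed
    then have "Q1 * D * Q1 \<le> c *\<^sub>R Q1"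
      using P(2) by (intro compress_sub_le[OF p(3) _ le(4)]) simp_all
    then have "\<Phi> Q1" using p cD by (intro Suc.IH) (simp_all add: c_def)
    have "\<Phi> (Q1 + Q2)"
      using p cD orth \<open>\<Phi> Q1\<close> \<open>\<Phi> Q2\<close> by (intro add)
    then show ?case by (simp add: Q1_def Q2_def algebra_simps)
  qed
  obtain n where "norm D / d < r ^ n" using real_arch_pow[OF \<open>1 < r\<close>] by blast
  then have "norm D \<le> d * r ^ n" using d by (simp add: divide_less_eq mult.commute)
  then show ?thesis
    using le_scalar[OF D(2)] by (intro main[of 1 n]) simp_all
qed

end

section \<open>Kubo-Ando means\<close>

lemma norm_one_oper: "(1 :: 'h :: chilbert_space oper) \<noteq> 0 \<Longrightarrow> norm (1 :: 'h oper) = 1"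
proof -
  assume "(1 :: 'h oper) \<noteq> 0"
  moreover have "norm (1 :: 'h oper) \<le> 1" by (rule norm_oper_le) simp_all
  moreover have "norm (1 :: 'h oper) \<le> norm (1 :: 'h oper) * norm (1 :: 'h oper)"
    using norm_mult_ineq[of "1 :: 'h oper" 1] by simp
  ultimately show ?thesis
    using mult_le_cancel_left_pos[of "norm (1 :: 'h oper)" 1 "norm (1 :: 'h oper)"] by simp
qed

definition rank_one :: "'h \<Rightarrow> 'h :: chilbert_space oper"
  where "rank_one e = Abs_oper (Blinfun (\<lambda>x. cinner x e *\<^sub>C e))"

lemma app_rank_one [simp]: "app (rank_one e) x = cinner x e *\<^sub>C e"
proof -
  have "bounded_linear (\<lambda>x. cinner x e *\<^sub>C e)"
  proof (rule bounded_linear_intro[where K = "norm e * norm e"])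
    fix x
    show "norm (cinner x e *\<^sub>C e) \<le> norm x * (norm e * norm e)"
      using mult_right_mono[OF norm_cinner_le[of x e], of "norm e"] by (simp add: norm_scaleC mult.assoc)
  qed (simp_all add: cinner_simps scaleC_add_left scaleR_scaleC scaleC_scaleC)
  then have app: "blinfun_apply (Blinfun (\<lambda>x. cinner x e *\<^sub>C e)) = (\<lambda>x. cinner x e *\<^sub>C e)"
    by (rule bounded_linear_Blinfun_apply)
  have "Blinfun (\<lambda>x. cinner x e *\<^sub>C e) \<in> BH"
    by (rule BH_I) (simp add: app cinner_simps scaleC_scaleC)
  then show ?thesis by (simp add: app.rep_eq rank_one_def Abs_oper_inverse app)
qed

lemma proj_rank_one: "norm e = 1 \<Longrightarrow> proj (rank_one e)"
proof -
  assume e: "norm e = 1"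
  have "star (rank_one e) = rank_one e"
  proof (rule star_unique)
    fix x y
    show "cinner (app (rank_one e) x) y = cinner x (app (rank_one e) y)"
      by (simp add: cinner_simps cinner_commute[of e y])
  qed
  moreover have "rank_one e * rank_one e = rank_one e"
    using e by (intro oper_eqI) (simp add: cinner_simps cinner_self)
  ultimately show ?thesis unfolding proj_def by blast
qed

lemma rank_one_compress:
  assumes "star X = X"
  shows "rank_one e * X * rank_one e = Re (cinner (app X e) e) *\<^sub>R rank_one e"
proof (rule oper_eqI)
  fix x
  have "cinner (app X e) e = cnj (cinner (app X e) e)"
    using assms cinner_app_left[of X e e] cinner_commute[of e "app X e"] by simp
  then have "cinner (app X e) e = complex_of_real (Re (cinner (app X e) e))"
    by (simp add: complex_eq_iff)
  then show "app (rank_one e * X * rank_one e) x = app (Re (cinner (app X e) e) *\<^sub>R rank_one e) x"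
    by (simp add: cinner_simps scaleR_scaleC scaleC_scaleC mult.commute)
qed

lemma rank_one_nonzero: "norm e = 1 \<Longrightarrow> rank_one e \<noteq> 0"
proof
  assume e: "norm e = 1" and "rank_one e = 0"
  then have "app (rank_one e) e = 0" by simp
  then show False using e by (simp add: cinner_self)
qed

text \<open>Commuting with rank one projections makes every vector an eigenvector.\<close>

lemma scalar_of_commute_proj:
  fixes T :: "'h :: chilbert_space oper"
  assumes "0 \<le> T" and comm: "\<And>P. proj P \<Longrightarrow> T * P = P * T"
  shows "T = norm T *\<^sub>R 1"
proof -
  have sa: "star T = T" using assms(1) by (rule nonneg_star)
  have eig: "\<exists>k. app T x = k *\<^sub>R x" for x
  proof (cases "x = 0")
    case False
    define e where "e = (1 / norm x) *\<^sub>R x"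
    have e: "norm e = 1" and x: "x = norm x *\<^sub>R e" using False by (simp_all add: e_def)
    have "T * rank_one e = rank_one e * T * rank_one e"
      using comm[OF proj_rank_one[OF e]] proj_rank_one[OF e] by (metis mult.assoc proj_idem)
    also have "\<dots> = Re (cinner (app T e) e) *\<^sub>R rank_one e" by (rule rank_one_compress[OF sa])
    finally have "app (T * rank_one e) e = app (Re (cinner (app T e) e) *\<^sub>R rank_one e) e" by simp
    then have "app T e = Re (cinner (app T e) e) *\<^sub>R e" using e by (simp add: cinner_self)
    then obtain k where "app T e = k *\<^sub>R e" by blast
    then have "app T (norm x *\<^sub>R e) = k *\<^sub>R (norm x *\<^sub>R e)"
      by (simp add: mult.commute)
    then have "app T x = k *\<^sub>R x" by (simp only: x[symmetric])
    then show ?thesis by blast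
  qed simp
  have "\<exists>c. \<forall>x. app T x = c *\<^sub>R x"
  proof (cases "\<exists>e :: 'h. e \<noteq> 0")
    case True
    then obtain e :: 'h where e: "e \<noteq> 0" by blast
    obtain c where c: "app T e = c *\<^sub>R e" using eig by blast
    have nonorth: "app T x = c *\<^sub>R x" if "cinner x e \<noteq> 0" for x
    proof -
      obtain k where k: "app T x = k *\<^sub>R x" using eig by blast
      have "cinner (app T x) e = cinner x (app T e)" using cinner_app_left[of T x e] sa by simp
      then have "complex_of_real k * cinner x e = complex_of_real c * cinner x e"
        by (simp add: c k cinner_simps)
      then have "k = c" using that by simp
      then show ?thesis using k by simp
    qed
    have "app T x = c *\<^sub>R x" for x
    proof (cases "cinner x e = 0")
      case True
      have "cinner (x + e) e \<noteq> 0" using True e by (simp add: cinner_simps cinner_eq_zero_iff)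
      from nonorth[OF this] show ?thesis by (simp add: c scaleR_add_right)
    qed (rule nonorth)
    then show ?thesis by blast
  next
    case False
    then have "app T x = 0 *\<^sub>R x" for x by simp
    then show ?thesis by blast
  qed
  then obtain c where "\<And>x. app T x = c *\<^sub>R x" by blast
  then have T: "T = c *\<^sub>R 1" by (intro oper_eqI) simp
  show ?thesis
  proof (cases "(1 :: 'h oper) = 0")
    case True
    then show ?thesis using T by simp
  next
    case False
    have "0 \<le> c" using assms(1) proj_scale_le[OF proj_1 False, of 0 c] by (simp add: T)
    then show ?thesis using norm_one_oper[OF False] by (simp add: T)
  qed
qed

lemma pd_two_valued: "proj P \<Longrightarrow> 0 < a \<Longrightarrow> 0 < b \<Longrightarrow> pd (a *\<^sub>R P + b *\<^sub>R (1 - P))"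
proof -
  assume P: "proj P" and ab: "0 < a" "0 < b"
  define m where "m = min a b"
  have "m *\<^sub>R P \<le> a *\<^sub>R P" "m *\<^sub>R (1 - P) \<le> b *\<^sub>R (1 - P)"
    using P by (auto simp: m_def intro!: scaleR_right_mono proj_nonneg proj_compl)
  then have "m *\<^sub>R P + m *\<^sub>R (1 - P) \<le> a *\<^sub>R P + b *\<^sub>R (1 - P)" by (rule add_mono)
  then show ?thesis using ab by (intro pdI[of m]) (simp_all add: m_def algebra_simps)
qed

text \<open>
  The properties of a symmetric Kubo-Ando mean that the proof uses, on a nonzero space.
\<close>

locale symmetric_mean =
  fixes \<sigma> :: "'h oper \<Rightarrow> 'h oper \<Rightarrow> 'h :: chilbert_space oper"
  assumes nontrivial: "(1 :: 'h oper) \<noteq> 0"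
    and pd_mean: "pd A \<Longrightarrow> pd B \<Longrightarrow> pd (\<sigma> A B)"
    and mean_mono: "pd A \<Longrightarrow> pd B \<Longrightarrow> A \<le> C \<Longrightarrow> B \<le> D \<Longrightarrow> \<sigma> A B \<le> \<sigma> C D"
    and transformer: "pd A \<Longrightarrow> pd B \<Longrightarrow> pd C \<Longrightarrow> C * \<sigma> A B * C \<le> \<sigma> (C * A * C) (C * B * C)"
    and mean_one: "\<sigma> 1 1 = 1"
    and mean_commute: "pd A \<Longrightarrow> pd B \<Longrightarrow> \<sigma> A B = \<sigma> B A"
begin

lemma norm_one [simp]: "norm (1 :: 'h oper) = 1"
  using nontrivial by (rule norm_one_oper)

text \<open>
  Applying the transformer inequality to \<open>C\<^sup>-\<^sup>1\<close> reverses it.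
\<close>

lemma transformer_eq:
  assumes "pd A" "pd B" "pd C"
  shows "C * \<sigma> A B * C = \<sigma> (C * A * C) (C * B * C)"
proof (rule antisym)
  let ?T = "\<sigma> (C * A * C) (C * B * C)"
  have undo: "iv C * (C * X * C) * iv C = X" for X
    using assms(3) by (simp add: mult.assoc)
  have "iv C * ?T * iv C \<le> \<sigma> A B"
    using transformer[of "C * A * C" "C * B * C" "iv C"] assms by (simp add: pd_conj undo)
  then have "C * (iv C * ?T * iv C) * C \<le> C * \<sigma> A B * C"
    using assms(3) by (intro conj_mono_sa) simp_all
  then show "?T \<le> C * \<sigma> A B * C"
    using assms(3) by (simp add: mult.assoc)
qed (rule transformer[OF assms])

lemma mean_square: "pd S \<Longrightarrow> pd D \<Longrightarrow> \<sigma> (S * S) (S * D * S) = S * \<sigma> 1 D * S"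
  using transformer_eq[of 1 D S] by simp

lemma mean_eq_conj:
  assumes "pd A" "pd B"
  shows "\<sigma> A B = rt A * \<sigma> 1 (iv (rt A) * B * iv (rt A)) * rt A"
proof -
  let ?S = "rt A"
  have S: "pd ?S" using assms by (simp add: pd_rt)
  have "?S * (iv ?S * B * iv ?S) * ?S = B" using S by (simp add: mult.assoc)
  then show ?thesis
    using mean_square[OF S, of "iv ?S * B * iv ?S"] S assms rt_square[OF pd_nonneg[OF assms(1)]]
    by (simp add: pd_conj)
qed

text \<open>
  With \<open>C = P + (1 - P) / 2\<close>, which commutes with \<open>D\<close>, monotonicity gives \<open>C T C \<le> T\<close> for
  \<open>T = 1 \<sigma> D\<close>. The two sides agree on the range of \<open>P\<close>, so the off-diagonal block of \<open>T\<close> vanishes.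
\<close>

lemma mean_commutes_proj:
  assumes P: "proj P" and D: "pd D" "P * D = D * P"
  shows "P * \<sigma> 1 D = \<sigma> 1 D * P"
proof -
  define T where "T = \<sigma> 1 D"
  define Q where "Q = 1 - P"
  have Q: "proj Q" "P * Q = 0" "Q * P = 0" using P by (simp_all add: Q_def algebra_simps)
  define C where "C = 1 *\<^sub>R P + (1/2) *\<^sub>R Q"
  have C: "pd C" unfolding C_def Q_def by (rule pd_two_valued[OF P]) simp_all
  have CC: "C * C = P + (1/4) *\<^sub>R Q" using P Q by (simp add: C_def distrib_left distrib_right)
  have QD: "Q * D = D * Q" using D by (simp add: Q_def algebra_simps)
  have "C * D = D * C" using D(2) QD by (simp add: C_def distrib_left distrib_right)
  then have "C * D * C = C * C * D" by (metis mult.assoc)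
  also have "\<dots> = D - (3/4) *\<^sub>R (Q * D * Q)"
    using QD Q(1) compress_commute[OF Q(1) QD[symmetric]]
    by (simp add: CC Q_def algebra_simps flip: scaleR_add_left)
  finally have CDC: "C * D * C \<le> D"
    using conj_nonneg[OF pd_nonneg[OF D(1)], of Q] Q(1) by (simp add: scaleR_nonneg_nonneg)
  have "C * C = 1 - (3/4) *\<^sub>R Q" by (simp add: CC Q_def algebra_simps flip: scaleR_add_left)
  then have "C * C \<le> 1" using proj_nonneg[OF Q(1)] by (simp add: scaleR_nonneg_nonneg)
  then have "C * T * C \<le> T"
    using mean_square[OF C D(1)] mean_mono[of "C * C" "C * D * C" 1 D] CDC
      pd_conj[OF D(1) C] pd_conj[OF pd_one C] by (simp add: T_def)
  then have X: "0 \<le> T - C * T * C" by simp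
  have CP: "C * P = P" "P * C = P" "Q * C = (1/2) *\<^sub>R Q" using P Q by (simp_all add: C_def distrib_left distrib_right)
  have "star P * (T - C * T * C) * P = 0"
    using P CP by (simp add: algebra_simps) (metis CP(2) mult.assoc)
  from compress_eq_0[OF X this] have "T * P = C * T * (C * P)"
    by (simp add: algebra_simps)
  then have "Q * (T * P) = (Q * C) * (T * P)" unfolding CP(1) by (metis mult.assoc)
  then have "1 *\<^sub>R (Q * (T * P)) = (1/2) *\<^sub>R (Q * (T * P))" unfolding CP(3) by simp
  then have "Q * (T * P) = 0" unfolding scaleR_cancel_right by simp
  then have TP: "T * P = P * T * P" by (simp add: Q_def algebra_simps)
  have "star T = T" unfolding T_def using D by (simp add: pd_mean)
  then have "star (P * T * P) = P * T * P" using P by (simp add: mult.assoc)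
  then have "P * T = P * T * P" using TP P \<open>star T = T\<close> by (metis proj_star star_simps(5))
  then show ?thesis using TP by (simp add: T_def)
qed

text \<open>Locality of \<open>1 \<sigma> D\<close>: conjugation by \<open>P + e (1 - P)\<close> makes the rest of \<open>D\<close> negligible.\<close>

lemma mean_local_mono:
  assumes P: "proj P" and D: "pd D" "P * D = D * P" and E: "pd E" "P * E = E * P"
    and le: "P * D * P \<le> P * E * P"
  shows "P * \<sigma> 1 D * P \<le> P * \<sigma> 1 E * P"
proof -
  define Q where "Q = 1 - P"
  have Q: "proj Q" "P * Q = 0" "Q * P = 0" using P by (simp_all add: Q_def algebra_simps)
  obtain d where d: "0 < d" "d *\<^sub>R 1 \<le> E" using E(1) by (auto simp: pd_def)
\<comment> \<open>so small that \<open>e\<^sup>2 D \<le> E\<close> off \<open>P\<close>.\<close>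
  define e where "e = min 1 (sqrt (d / (norm D + 1)))"
  have nD: "0 < norm D + 1" by (simp add: add_nonneg_pos)
  have e: "0 < e" "e \<le> 1" using d nD by (auto simp: e_def)
  have "e\<^sup>2 \<le> (sqrt (d / (norm D + 1)))\<^sup>2" using e by (intro power_mono) (auto simp: e_def)
  then have "e * e * (norm D + 1) \<le> d" using d nD by (simp add: power2_eq_square field_simps)
  moreover have "e * e * norm D \<le> e * e * (norm D + 1)" using e by simp
  ultimately have eD: "e * e * norm D \<le> d" by linarith
  define C where "C = 1 *\<^sub>R P + e *\<^sub>R Q"
  have C: "pd C" unfolding C_def Q_def by (rule pd_two_valued[OF P]) (simp_all add: e)
  have CC: "C * C = P + (e * e) *\<^sub>R Q" using P Q by (simp add: C_def distrib_left distrib_right)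
  have QD: "D * Q = Q * D" and QE: "E * Q = Q * E" using D E by (simp_all add: Q_def algebra_simps)
  have "C * D = D * C" using D(2) QD by (simp add: C_def distrib_left distrib_right)
  then have "C * D * C = C * C * D" by (metis mult.assoc)
  also have "\<dots> = P * D * P + (e * e) *\<^sub>R (Q * D * Q)"
    using compress_commute[OF Q(1) QD] compress_commute[OF P D(2)[symmetric]]
    by (simp add: CC distrib_right)
  also have "\<dots> \<le> P * E * P + Q * E * Q"
  proof (rule add_mono[OF le])
    have "(e * e) *\<^sub>R (Q * D * Q) \<le> (e * e) *\<^sub>R norm D *\<^sub>R Q"
      using D(1) Q(1) by (intro scaleR_left_mono scalar_compress_le le_norm) simp_all
    also have "\<dots> \<le> d *\<^sub>R Q"
      using eD proj_nonneg[OF Q(1)] by (simp add: scaleR_right_mono)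
    also have "\<dots> \<le> Q * E * Q" by (rule scalar_compress_ge[OF Q(1) d(2)])
    finally show "(e * e) *\<^sub>R (Q * D * Q) \<le> Q * E * Q" .
  qed
  also have "\<dots> = E"
    using compress_commute[OF Q(1) QE] compress_commute[OF P E(2)[symmetric]] by (simp add: Q_def algebra_simps)
  finally have CDC: "C * D * C \<le> E" .
  have "C * C \<le> P + 1 *\<^sub>R Q"
    unfolding CC using e proj_nonneg[OF Q(1)] by (intro add_left_mono scaleR_right_mono) (simp_all add: mult_le_one)
  then have "C * C \<le> 1" by (simp add: Q_def)
  then have "C * \<sigma> 1 D * C \<le> \<sigma> 1 E"
    using mean_square[OF C D(1)] mean_mono[of "C * C" "C * D * C" 1 E] CDC
      pd_conj[OF D(1) C] pd_conj[OF pd_one C] by simp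
  then have "P * (C * \<sigma> 1 D * C) * P \<le> P * \<sigma> 1 E * P"
    using P by (intro conj_mono_sa) simp_all
  moreover have "C * P = P" "P * C = P" using P Q by (simp_all add: C_def distrib_left distrib_right)
  ultimately show ?thesis by (metis mult.assoc)
qed

text \<open>
  The representing function of the mean; \<open>mean_scalar\<close> justifies reading it off from a norm.
\<close>

definition f :: "real \<Rightarrow> real" where "f x = norm (\<sigma> 1 (x *\<^sub>R 1))"

lemma mean_scalar: "0 < x \<Longrightarrow> \<sigma> 1 (x *\<^sub>R 1) = f x *\<^sub>R 1"
  unfolding f_def by (rule scalar_of_commute_proj) (simp_all add: pd_mean pd_nonneg mean_commutes_proj)

lemma f_pos: "0 < x \<Longrightarrow> 0 < f x"
proof -
  assume "0 < x"
  then have "pd (f x *\<^sub>R (1 :: 'h oper))" using pd_mean[of 1 "x *\<^sub>R 1"] by (simp add: mean_scalar)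
  then obtain e where "0 < e" "e *\<^sub>R 1 \<le> f x *\<^sub>R (1 :: 'h oper)" by (auto simp: pd_def)
  then show ?thesis using proj_scale_le[OF proj_1 nontrivial] by fastforce
qed

lemma f_mono: "0 < x \<Longrightarrow> x \<le> y \<Longrightarrow> f x \<le> f y"
proof -
  assume "0 < x" "x \<le> y"
  then have "\<sigma> 1 (x *\<^sub>R 1) \<le> \<sigma> 1 (y *\<^sub>R 1)"
    by (intro mean_mono scaleR_right_mono one_nonneg) simp_all
  then show ?thesis
    using proj_scale_le[OF proj_1 nontrivial, of "f x" "f y"] \<open>0 < x\<close> \<open>x \<le> y\<close> by (simp add: mean_scalar)
qed

lemma f_sym: "0 < x \<Longrightarrow> f x = x * f (1 / x)"
proof -
  assume x: "0 < x"
  have "f x *\<^sub>R 1 = \<sigma> (x *\<^sub>R 1) 1" using x mean_commute[of 1 "x *\<^sub>R 1"] by (simp add: mean_scalar)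
  also have "\<dots> = \<sigma> (sqrt x *\<^sub>R 1 * sqrt x *\<^sub>R 1) (sqrt x *\<^sub>R 1 * ((1 / x) *\<^sub>R 1) * sqrt x *\<^sub>R 1)"
    using x by simp
  also have "\<dots> = (x * f (1 / x)) *\<^sub>R 1"
    using x by (subst mean_square) (simp_all add: mean_scalar)
  finally have "f x *\<^sub>R (1 :: 'h oper) = (x * f (1 / x)) *\<^sub>R 1" .
  then show ?thesis using nontrivial by (simp add: scaleR_right_imp_eq)
qed

lemma f_one: "f 1 = 1"
  by (simp add: f_def mean_one)

text \<open>
  By the symmetry \<open>f(x) = x f(1/x)\<close>, the function \<open>f(x) / x\<close> is decreasing because \<open>f\<close> is increasing.
\<close>

lemma f_scale_le: "0 < x \<Longrightarrow> 1 \<le> r \<Longrightarrow> f (r * x) \<le> r * f x"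
proof -
  assume x: "0 < x" "1 \<le> r"
  have "f (1 / (r * x)) \<le> f (1 / x)" using x by (intro f_mono) (auto simp: field_simps)
  then have "r * x * f (1 / (r * x)) \<le> r * x * f (1 / x)" using x by (intro mult_left_mono) auto
  then show ?thesis using f_sym[of "r * x"] f_sym[of x] x by simp
qed

lemma mean_local_le:
  assumes P: "proj P" and D: "pd D" "P * D = D * P" and "0 < m" "P * D * P \<le> m *\<^sub>R P"
  shows "P * \<sigma> 1 D * P \<le> f m *\<^sub>R P"
  using mean_local_mono[OF P D, of "m *\<^sub>R 1"] assms by (simp add: mean_scalar)

lemma mean_local_ge:
  assumes P: "proj P" and D: "pd D" "P * D = D * P" and "0 < m" "m *\<^sub>R P \<le> P * D * P"
  shows "f m *\<^sub>R P \<le> P * \<sigma> 1 D * P"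
  using mean_local_mono[OF P _ _ D, of "m *\<^sub>R 1"] assms by (simp add: mean_scalar)

lemma mean_two_valued:
  assumes P: "proj P" and "0 < a" "0 < b"
  shows "\<sigma> 1 (a *\<^sub>R P + b *\<^sub>R (1 - P)) = f a *\<^sub>R P + f b *\<^sub>R (1 - P)"
proof -
  define D where "D = a *\<^sub>R P + b *\<^sub>R (1 - P)"
  define Q where "Q = 1 - P"
  have Q: "proj Q" "P * Q = 0" "Q * P = 0" using P by (simp_all add: Q_def algebra_simps)
  have D: "pd D" unfolding D_def by (rule pd_two_valued[OF assms])
  have PD: "P * D = a *\<^sub>R P" "D * P = a *\<^sub>R P" and QD: "Q * D = b *\<^sub>R Q" "D * Q = b *\<^sub>R Q"
    using P Q by (simp_all add: D_def distrib_left distrib_right flip: Q_def)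
  have "P * \<sigma> 1 D * P = f a *\<^sub>R P"
    by (rule antisym) (simp_all add: mean_local_le mean_local_ge P D PD assms)
  moreover have "Q * \<sigma> 1 D * Q = f b *\<^sub>R Q"
    by (rule antisym) (simp_all add: mean_local_le mean_local_ge Q D QD assms)
  moreover have "\<sigma> 1 D = P * \<sigma> 1 D * P + Q * \<sigma> 1 D * Q"
    using compress_commute[OF P, of "\<sigma> 1 D"] compress_commute[OF Q(1), of "\<sigma> 1 D"]
      mean_commutes_proj[OF P D] mean_commutes_proj[OF Q(1) D] PD QD
    by (simp add: Q_def algebra_simps)
  ultimately show ?thesis by (simp add: D_def Q_def)
qed

text \<open>Jensen's inequality in a vector state, by bounding the off-diagonal part of \<open>D\<close>.\<close>

lemma mean_vector_le:
  assumes e: "norm e = 1" and D: "pd D"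
  shows "Re (cinner (app (\<sigma> 1 D) e) e) \<le> f (Re (cinner (app D e) e))"
proof -
  define P where "P = rank_one e"
  have P: "proj P" "P \<noteq> 0" using e by (simp_all add: P_def proj_rank_one rank_one_nonzero)
  define c where "c = Re (cinner (app D e) e)"
  have PDP: "P * D * P = c *\<^sub>R P" using D by (simp add: P_def c_def rank_one_compress)
  obtain d where d: "0 < d" "d *\<^sub>R 1 \<le> D" using D by (auto simp: pd_def)
  have "d *\<^sub>R P \<le> c *\<^sub>R P" using scalar_compress_ge[OF P(1) d(2)] PDP by simp
  then have "0 < c" using proj_scale_le[OF P] d(1) by fastforce
  have "norm D \<noteq> 0"
  proof
    assume "norm D = 0"
    then have "d *\<^sub>R (1 :: 'h oper) \<le> 0 *\<^sub>R 1" using d by simp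
    then show False using proj_scale_le[OF proj_1 nontrivial, of d 0] d(1) by simp
  qed
  then have nD: "0 < norm D" by simp
  have "Re (cinner (app (\<sigma> 1 D) e) e) \<le> (1 + \<theta>) * f c" if "0 < \<theta>" for \<theta>
  proof -
    define E where "E = ((1 + \<theta>) * c) *\<^sub>R P + ((1 + 1 / \<theta>) * norm D) *\<^sub>R (1 - P)"
    have "D \<le> E"
      unfolding E_def by (rule block_bound_scalar) (use P D PDP that in \<open>simp_all add: pd_nonneg\<close>)
    then have "\<sigma> 1 D \<le> \<sigma> 1 E" using D by (intro mean_mono) simp_all
    also have "\<sigma> 1 E = f ((1 + \<theta>) * c) *\<^sub>R P + f ((1 + 1 / \<theta>) * norm D) *\<^sub>R (1 - P)"
      unfolding E_def using that \<open>0 < c\<close> nD P by (intro mean_two_valued) (simp_all add: add_pos_pos)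
    finally have "P * \<sigma> 1 D * P \<le> P * (f ((1 + \<theta>) * c) *\<^sub>R P + f ((1 + 1 / \<theta>) * norm D) *\<^sub>R (1 - P)) * P"
      using P by (intro conj_mono_sa) simp_all
    also have "\<dots> = f ((1 + \<theta>) * c) *\<^sub>R P" using P by (simp add: algebra_simps)
    also have "P * \<sigma> 1 D * P = Re (cinner (app (\<sigma> 1 D) e) e) *\<^sub>R P"
      using D by (simp add: P_def rank_one_compress pd_mean)
    finally have "Re (cinner (app (\<sigma> 1 D) e) e) \<le> f ((1 + \<theta>) * c)"
      using proj_scale_le[OF P] by blast
    also have "\<dots> \<le> (1 + \<theta>) * f c" using that \<open>0 < c\<close> by (intro f_scale_le) simp_all
    finally show ?thesis .
  qed
  note all = this
  show ?thesis unfolding c_def[symmetric]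
  proof (rule field_le_epsilon)
    fix t :: real assume "0 < t"
    have "0 < f c" using \<open>0 < c\<close> by (rule f_pos)
    then show "Re (cinner (app (\<sigma> 1 D) e) e) \<le> f c + t"
      using all[of "t / f c"] \<open>0 < t\<close> by (simp add: distrib_right add.commute)
  qed
qed

text \<open>
  Jensen's inequality in every vector state turns a scalar affine bound into an operator inequality.
\<close>

lemma mean_le_affine:
  assumes D: "pd D" and fle: "\<And>x. 0 < x \<Longrightarrow> f x \<le> p + q * x"
  shows "\<sigma> 1 D \<le> p *\<^sub>R 1 + q *\<^sub>R D"
proof -
  have unit: "Re (cinner (app (\<sigma> 1 D) e) e) \<le> p + q * Re (cinner (app D e) e)" if "norm e = 1" for e
  proof -
    obtain d where d: "0 < d" "d *\<^sub>R 1 \<le> D" using D by (auto simp: pd_def)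
    have "d \<le> Re (cinner (app D e) e)"
      using d(2) that unfolding oper_le_iff by (auto simp: cinner_simps cinner_self dest!: spec[of _ e])
    then show ?thesis
      using mean_vector_le[OF that D] fle[of "Re (cinner (app D e) e)"] d(1) by linarith
  qed
  have "Re (cinner (app (\<sigma> 1 D) x) x) \<le> p * (norm x)\<^sup>2 + q * Re (cinner (app D x) x)" for x
  proof (cases "x = 0")
    case False
    define e where "e = (1 / norm x) *\<^sub>R x"
    have e: "norm e = 1" and x: "x = norm x *\<^sub>R e" using False by (simp_all add: e_def)
    have quad: "Re (cinner (app T x) x) = (norm x)\<^sup>2 * Re (cinner (app T e) e)" for T
      by (subst (1 2) x) (simp add: cinner_simps power2_eq_square)
    have "(norm x)\<^sup>2 * Re (cinner (app (\<sigma> 1 D) e) e) \<le> (norm x)\<^sup>2 * (p + q * Re (cinner (app D e) e))"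
      by (intro mult_left_mono unit e) simp
    then show ?thesis unfolding quad by (simp add: algebra_simps)
  qed simp
  then show ?thesis using D by (simp add: oper_le_iff pd_mean cinner_simps cinner_self)
qed

text \<open>
  Concavity is Jensen's inequality for a two-valued operator in a vector that is a combination of
  two orthonormal ones.
\<close>

lemma f_concave:
  assumes e: "norm e = 1" and g: "norm g = 1" and orth: "cinner e (g :: 'h) = 0"
    and "0 < x" "0 < y" "0 \<le> u" "u \<le> 1"
  shows "u * f x + (1 - u) * f y \<le> f (u * x + (1 - u) * y)"
proof -
  define v where "v = sqrt u *\<^sub>R e + sqrt (1 - u) *\<^sub>R g"
  have "(norm v)\<^sup>2 = 1"
    using assms by (simp add: v_def norm_sq_add cinner_simps power_mult_distrib)
  then have v: "norm v = 1" using power2_eq_imp_eq[of "norm v" 1] by simp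
  define P where "P = rank_one v"
  have P: "proj P" using v by (simp add: P_def proj_rank_one)
  have "cinner e v = sqrt u" using e orth by (simp add: v_def cinner_simps cinner_self)
  moreover have "cinner v e = cnj (cinner e v)" by (rule cinner_commute)
  ultimately have Pe: "Re (cinner (app P e) e) = u"
    using \<open>0 \<le> u\<close> by (simp add: P_def cinner_simps flip: of_real_mult)
  have val: "Re (cinner (app (a *\<^sub>R P + b *\<^sub>R (1 - P)) e) e) = u * a + (1 - u) * b" for a b
    using Pe e by (simp add: cinner_simps cinner_self algebra_simps)
  show ?thesis
    using mean_vector_le[OF e pd_two_valued[OF P assms(4,5)]]
    unfolding mean_two_valued[OF P assms(4,5)] val .
qed

end

section \<open>The order is determined by the norms of means\<close>

lemma two_valued_mult:
  assumes "proj P"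
  shows "(a *\<^sub>R P + b *\<^sub>R (1 - P)) * (c *\<^sub>R P + d *\<^sub>R (1 - P)) = (a * c) *\<^sub>R P + (b * d) *\<^sub>R (1 - P)"
proof -
  have "P * (1 - P) = 0" "(1 - P) * P = 0" "(1 - P) * (1 - P) = 1 - P"
    using assms by (simp_all add: algebra_simps)
  then show ?thesis using assms by (simp add: distrib_left distrib_right mult.commute)
qed

lemma two_valued_compress:
  assumes "proj P"
  shows "P * (a *\<^sub>R P + b *\<^sub>R (1 - P)) * P = a *\<^sub>R P"
  using assms by (simp add: algebra_simps)

lemma iv_two_valued:
  assumes "proj P" "0 < a" "0 < b"
  shows "iv (a *\<^sub>R P + b *\<^sub>R (1 - P)) = (1 / a) *\<^sub>R P + (1 / b) *\<^sub>R (1 - P)"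
  using assms by (intro iv_unique pd_two_valued) (simp_all add: two_valued_mult)

lemma iv_scalar: "0 < r \<Longrightarrow> iv (r *\<^sub>R 1) = (1 / r) *\<^sub>R 1"
  by (intro iv_unique) simp_all

context symmetric_mean
begin

lemma norm_pos_of_pd: "pd A \<Longrightarrow> 0 < norm A" for A :: "'h oper"
proof -
  assume "pd A"
  then obtain d where d: "0 < d" "d *\<^sub>R 1 \<le> A" by (auto simp: pd_def)
  have "d \<le> norm A"
    using le_norm_of_compress[OF proj_1 nontrivial, of A d] d \<open>pd A\<close> by simp
  then show ?thesis using d(1) by linarith
qed

lemma mean_two_valued_two_valued:
  assumes P: "proj P" and "0 < a" "0 < b" "0 < t" "0 < e"
  shows "\<sigma> (a *\<^sub>R P + b *\<^sub>R (1 - P)) (t *\<^sub>R P + e *\<^sub>R (1 - P)) = (a * f (t / a)) *\<^sub>R P + (b * f (e / b)) *\<^sub>R (1 - P)"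
proof -
  define S where "S = sqrt a *\<^sub>R P + sqrt b *\<^sub>R (1 - P)"
  define D where "D = (t / a) *\<^sub>R P + (e / b) *\<^sub>R (1 - P)"
  have sq: "sqrt c * x * sqrt c = c * x" if "0 < c" for c x :: real
  proof -
    have "sqrt c * x * sqrt c = (sqrt c * sqrt c) * x" by (simp only: mult_ac)
    then show ?thesis using that by simp
  qed
  have "S * S = a *\<^sub>R P + b *\<^sub>R (1 - P)"
    using assms by (simp add: S_def two_valued_mult)
  moreover have "S * D * S = t *\<^sub>R P + e *\<^sub>R (1 - P)"
    unfolding S_def D_def two_valued_mult[OF P] sq[OF assms(2)] sq[OF assms(3)] using assms by simp
  moreover have "\<sigma> (S * S) (S * D * S) = S * \<sigma> 1 D * S"
    unfolding S_def D_def using assms by (intro mean_square pd_two_valued) simp_all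
  moreover have "\<sigma> 1 D = f (t / a) *\<^sub>R P + f (e / b) *\<^sub>R (1 - P)"
    unfolding D_def using assms by (intro mean_two_valued) simp_all
  moreover have "S * (f (t / a) *\<^sub>R P + f (e / b) *\<^sub>R (1 - P)) * S = (a * f (t / a)) *\<^sub>R P + (b * f (e / b)) *\<^sub>R (1 - P)"
    unfolding S_def two_valued_mult[OF P] sq[OF assms(2)] sq[OF assms(3)] ..
  ultimately show ?thesis by simp
qed

text \<open>
  For \<open>e \<rightarrow> 0\<close> the mean of \<open>A\<close> with \<open>t P + e (1 - P)\<close> sees only the compression of \<open>A\<^sup>-\<^sup>1\<close> to \<open>P\<close>.
  The next two lemmas bound its norm from below and from above.
\<close>

lemma norm_mean_lower:
  assumes P: "proj P" "P \<noteq> 0" and A: "pd A" "P * iv A * P \<le> c *\<^sub>R P" and c: "0 < c" "c < c'" and te: "0 < t" "0 < e"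
  shows "t * f (1 / (c' * t)) \<le> norm (\<sigma> A (t *\<^sub>R P + e *\<^sub>R (1 - P)))"
proof -
  define X where "X = t *\<^sub>R P + e *\<^sub>R (1 - P)"
  have X: "pd X" unfolding X_def by (intro pd_two_valued P te)
  define \<theta> where "\<theta> = c' / c - 1"
  have \<theta>: "0 < \<theta>" "(1 + \<theta>) * c = c'" using c by (simp_all add: \<theta>_def)
  define k where "k = (1 + 1 / \<theta>) * norm (iv A)"
  have k: "0 < k" unfolding k_def using \<theta> A by (intro mult_pos_pos norm_pos_of_pd) (simp_all add: add_pos_pos)
  have "iv A \<le> c' *\<^sub>R P + k *\<^sub>R (1 - P)"
    using block_bound_scalar[OF P(1) iv_nonneg[OF A(1)] \<theta>(1) A(2)] \<theta>(2) by (simp add: k_def)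
  then have "iv (c' *\<^sub>R P + k *\<^sub>R (1 - P)) \<le> iv (iv A)"
    by (intro iv_antimono) (simp_all add: A)
  then have le: "(1 / c') *\<^sub>R P + (1 / k) *\<^sub>R (1 - P) \<le> A"
    using A P k c by (simp add: iv_two_valued)
  define Z where "Z = (1 / c') *\<^sub>R P + (1 / k) *\<^sub>R (1 - P)"
  have Z: "pd Z" unfolding Z_def using P k c by (intro pd_two_valued) simp_all
  have "\<sigma> Z X \<le> \<sigma> A X" using Z X le by (intro mean_mono) (simp_all add: Z_def)
  moreover have "\<sigma> Z X = ((1 / c') * f (t / (1 / c'))) *\<^sub>R P + ((1 / k) * f (e / (1 / k))) *\<^sub>R (1 - P)"
    unfolding Z_def X_def by (rule mean_two_valued_two_valued) (use P k c te in auto)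
  ultimately have "P * (((1 / c') * f (t / (1 / c'))) *\<^sub>R P + ((1 / k) * f (e / (1 / k))) *\<^sub>R (1 - P)) * P \<le> P * \<sigma> A X * P"
    using P by (intro conj_mono_sa) simp_all
  then have "((1 / c') * f (t / (1 / c'))) *\<^sub>R P \<le> P * \<sigma> A X * P"
    unfolding two_valued_compress[OF P(1)] .
  then have "(1 / c') * f (t / (1 / c')) \<le> norm (\<sigma> A X)"
    using A X by (intro le_norm_of_compress[OF P]) (simp_all add: pd_mean)
  moreover have "(1 / c') * f (t / (1 / c')) = t * f (1 / (c' * t))"
    using f_sym[of "c' * t"] c te by (simp add: mult.commute)
  ultimately show ?thesis by (simp add: X_def)
qed

text \<open>
  With \<open>S = B\<^sup>-\<^sup>1\<^sup>/\<^sup>2\<close> and \<open>J\<close> an inverse of \<open>P B\<^sup>-\<^sup>1 P\<close> on the range of \<open>P\<close>, the operator \<open>R = S P J P S\<close>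
  is the projection onto the range of \<open>S P\<close>, and \<open>S (t P) S \<le> t k' R\<close>.
\<close>

lemma norm_mean_upper:
  assumes P: "proj P" and B: "pd B" "k *\<^sub>R P \<le> P * iv B * P" "P * iv B * P \<le> k' *\<^sub>R P"
    and k: "0 < k" "k \<le> k'" and te: "0 < t" "0 < e"
  shows "norm (\<sigma> B (t *\<^sub>R P + e *\<^sub>R (1 - P))) \<le> f (t * k' + e * norm (iv B)) / k + f (e * norm (iv B)) * norm B"
proof -
  define X where "X = t *\<^sub>R P + e *\<^sub>R (1 - P)"
  have X: "pd X" unfolding X_def by (intro pd_two_valued P te)
  define K where "K = norm (iv B)"
  have K: "0 < K" unfolding K_def using B by (intro norm_pos_of_pd) simp
  define S where "S = rt (iv B)"
  have S: "pd S" "S * B * S = 1" "S * S = iv B"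
    using B(1) by (simp_all add: S_def pd_rt rt_iv_conj rt_iv_square)
\<comment> \<open>filling in \<open>k\<close> off \<open>P\<close> keeps \<open>G\<close> between \<open>k\<close> and \<open>k'\<close>.\<close>
  define G where "G = P * iv B * P + k *\<^sub>R (1 - P)"
  have Gk: "k *\<^sub>R 1 \<le> G" "G \<le> k' *\<^sub>R 1"
  proof -
    have "k *\<^sub>R P + k *\<^sub>R (1 - P) \<le> G" unfolding G_def by (intro add_right_mono B)
    then show "k *\<^sub>R 1 \<le> G" by (simp add: algebra_simps)
    have "G \<le> k' *\<^sub>R P + k' *\<^sub>R (1 - P)"
      unfolding G_def using k P by (intro add_mono B scaleR_right_mono proj_nonneg) simp_all
    then show "G \<le> k' *\<^sub>R 1" by (simp add: algebra_simps)
  qed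
  have G: "pd G" using k Gk by (intro pdI[of k])
  have PG: "P * G = P * iv B * P" "G * P = P * iv B * P"
    using P by (simp_all add: G_def algebra_simps)
  define J where "J = iv G"
  have J: "pd J" "J \<le> (1 / k) *\<^sub>R 1" "(1 / k') *\<^sub>R 1 \<le> J" "G * J = 1" "J * G = 1"
    using G k iv_antimono[OF pd_scalar[OF k(1)] Gk(1)] iv_antimono[OF G Gk(2)]
    by (simp_all add: J_def iv_scalar)
  have PJ: "P * J = J * P" unfolding J_def using G PG by (intro iv_commute) simp_all
  define R where "R = S * (P * J * P) * S"
  have core: "P * J * P * iv B * (P * J * P) = P * J * P"
  proof -
    have "P * J * P * iv B * (P * J * P) = P * J * (P * iv B * P) * J * P" by (simp only: mult.assoc)
    also have "\<dots> = P * J * (G * P) * J * P" by (simp only: PG)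
    also have "\<dots> = P * (J * G) * (P * J * P)" by (simp only: mult.assoc)
    also have "\<dots> = P * (P * J * P)" by (simp only: J(5) mult_1_right)
    also have "\<dots> = P * J * P" using P by (simp add: mult.assoc)
    finally show ?thesis .
  qed
  have R: "proj R"
    unfolding proj_def
  proof
    show "star R = R" using S J P by (simp add: R_def mult.assoc)
    have "R * R = S * (P * J * P * (S * S) * (P * J * P)) * S" by (simp add: R_def mult.assoc)
    also have "\<dots> = R" unfolding S(3) core R_def ..
    finally show "R * R = R" .
  qed
  have SPS: "S * P * S \<le> k' *\<^sub>R R"
  proof -
    have "(1 / k') *\<^sub>R P \<le> P * J * P" by (intro scalar_compress_ge P J)
    then have "k' *\<^sub>R (1 / k') *\<^sub>R P \<le> k' *\<^sub>R (P * J * P)" using k by (intro scaleR_left_mono) simp_all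
    then have "P \<le> k' *\<^sub>R (P * J * P)" using k by simp
    then have "S * P * S \<le> S * (k' *\<^sub>R (P * J * P)) * S" using S by (intro conj_mono_sa) simp_all
    then show ?thesis by (simp add: R_def)
  qed
  define Y where "Y = S * X * S"
  have Y: "pd Y" unfolding Y_def by (rule pd_conj[OF X S(1)])
  have "Y = t *\<^sub>R (S * P * S) + e *\<^sub>R (S * (1 - P) * S)"
    by (simp add: Y_def X_def distrib_left distrib_right)
  also have "\<dots> \<le> t *\<^sub>R k' *\<^sub>R R + e *\<^sub>R K *\<^sub>R 1"
  proof (intro add_mono scaleR_left_mono SPS)
    have "S * (1 - P) * S \<le> S * 1 * S" using S P by (intro conj_mono_sa) (simp_all add: proj_nonneg)
    also have "\<dots> \<le> K *\<^sub>R 1" using S B by (simp add: K_def le_norm)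
    finally show "S * (1 - P) * S \<le> K *\<^sub>R 1" .
  qed (use te in simp_all)
  also have "\<dots> = (t * k' + e * K) *\<^sub>R R + (e * K) *\<^sub>R (1 - R)" by (simp add: algebra_simps)
  finally have "\<sigma> 1 Y \<le> \<sigma> 1 ((t * k' + e * K) *\<^sub>R R + (e * K) *\<^sub>R (1 - R))"
    using Y by (intro mean_mono) simp_all
  also have "\<dots> = f (t * k' + e * K) *\<^sub>R R + f (e * K) *\<^sub>R (1 - R)"
    using te k K by (intro mean_two_valued R add_pos_pos mult_pos_pos) simp_all
  also have "\<dots> \<le> f (t * k' + e * K) *\<^sub>R R + f (e * K) *\<^sub>R 1"
    using te K R f_pos[of "e * K"] by (intro add_left_mono scaleR_left_mono) (simp_all add: proj_nonneg)
  finally have \<sigma>Y: "\<sigma> 1 Y \<le> f (t * k' + e * K) *\<^sub>R R + f (e * K) *\<^sub>R 1" .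
  have "S * \<sigma> B X * S = \<sigma> 1 Y"
    using transformer_eq[OF B(1) X S(1)] S by (simp add: Y_def)
  then have "iv S * (S * \<sigma> B X * S) * iv S = iv S * \<sigma> 1 Y * iv S" by simp
  then have "\<sigma> B X = iv S * \<sigma> 1 Y * iv S" using S by (simp add: mult.assoc)
  also have "\<dots> \<le> iv S * (f (t * k' + e * K) *\<^sub>R R + f (e * K) *\<^sub>R 1) * iv S"
    using S by (intro conj_mono_sa \<sigma>Y) simp_all
  also have "\<dots> = f (t * k' + e * K) *\<^sub>R (iv S * R * iv S) + f (e * K) *\<^sub>R (iv S * iv S)"
    by (simp add: distrib_left distrib_right)
  also have "iv S * R * iv S = P * J * P" using S by (simp add: R_def mult.assoc)
  also have "iv S * iv S = B"
  proof -
    have "iv S * (S * B * S) * iv S = iv S * iv S" using S by simp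
    then show ?thesis using S(1) by (simp add: mult.assoc)
  qed
  also have "f (t * k' + e * K) *\<^sub>R (P * J * P) + f (e * K) *\<^sub>R B
      \<le> f (t * k' + e * K) *\<^sub>R (1 / k) *\<^sub>R 1 + f (e * K) *\<^sub>R norm B *\<^sub>R 1"
  proof (intro add_mono scaleR_left_mono)
    have "P * J * P \<le> (1 / k) *\<^sub>R P" by (intro scalar_compress_le P J)
    also have "\<dots> \<le> (1 / k) *\<^sub>R 1" using k P by (intro scaleR_left_mono proj_le_1) simp_all
    finally show "P * J * P \<le> (1 / k) *\<^sub>R 1" .
    show "B \<le> norm B *\<^sub>R 1" using B by (intro le_norm) simp
    show "0 \<le> f (t * k' + e * K)" "0 \<le> f (e * K)"
      using te k K by (intro less_imp_le f_pos add_pos_pos mult_pos_pos; simp)+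
  qed
  also have "\<dots> = (f (t * k' + e * K) / k + f (e * K) * norm B) *\<^sub>R 1" by (simp add: algebra_simps)
  finally have "\<sigma> B X \<le> (f (t * k' + e * K) / k + f (e * K) * norm B) *\<^sub>R 1" .
  moreover have "0 \<le> f (t * k' + e * K) / k + f (e * K) * norm B"
    using te k K f_pos[of "t * k' + e * K"] f_pos[of "e * K"] by (simp add: add_pos_pos less_imp_le)
  moreover have "0 \<le> \<sigma> B X" using B X by (intro pd_nonneg pd_mean)
  ultimately show ?thesis unfolding X_def[symmetric] K_def[symmetric] using norm_le_iff_pos by blast
qed

text \<open>
  Passage to the limit \<open>e \<rightarrow> 0\<close> in the upper bound above, where \<open>\<alpha>\<close> is the limit of \<open>f\<close> at \<open>0\<close>.
\<close>

lemma limit_upper: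
  assumes bound: "\<And>e. 0 < e \<Longrightarrow> L \<le> f (x + e * K) / k + f (e * K) * N"
    and inf: "\<And>e. 0 < e \<Longrightarrow> \<exists>y>0. f y \<le> \<alpha> + e" and "0 < x" "0 < K" "0 < k" "0 \<le> N"
  shows "L \<le> f x / k + \<alpha> * N"
proof (rule field_le_epsilon)
  fix t :: real assume "0 < t"
  define h where "h = t / (2 * (N + 1))"
  have h: "0 < h" "h * N \<le> t / 2" using \<open>0 < t\<close> \<open>0 \<le> N\<close> by (auto simp: h_def field_simps)
  obtain y where y: "0 < y" "f y \<le> \<alpha> + h" using inf h by blast
  have fx: "0 < f x" using assms by (intro f_pos)
  define e where "e = min (y / K) (t * k * x / (2 * K * f x))"
  have e: "0 < e" "e * K \<le> y" "e * K / x * (f x / k) \<le> t / 2"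
  proof -
    show "0 < e" using assms y \<open>0 < t\<close> fx by (simp add: e_def)
    have "e \<le> y / K" by (simp add: e_def)
    then show "e * K \<le> y" using \<open>0 < K\<close> by (simp add: pos_le_divide_eq)
    have "e * (K / x * (f x / k)) \<le> t * k * x / (2 * K * f x) * (K / x * (f x / k))"
      using assms fx by (intro mult_right_mono) (simp_all add: e_def)
    also have "\<dots> = t / 2" using assms fx by (simp add: field_simps)
    finally show "e * K / x * (f x / k) \<le> t / 2" by simp
  qed
  have "f (x + e * K) = f ((1 + e * K / x) * x)" using assms by (simp add: distrib_right)
  also have "\<dots> \<le> (1 + e * K / x) * f x"
    using assms e by (intro f_scale_le) simp_all
  finally have "f (x + e * K) / k \<le> (1 + e * K / x) * f x / k" using assms by (intro divide_right_mono) simp_all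
  also have "\<dots> = f x / k + e * K / x * (f x / k)" by (simp add: distrib_right add_divide_distrib)
  finally have "f (x + e * K) / k \<le> f x / k + t / 2" using e(3) by linarith
  moreover have "f (e * K) * N \<le> (\<alpha> + h) * N"
    using f_mono[of "e * K" y] y e assms by (intro mult_right_mono) simp_all
  then have "f (e * K) * N \<le> \<alpha> * N + t / 2" using h(2) by (simp add: distrib_right)
  ultimately show "L \<le> f x / k + \<alpha> * N + t" using bound[OF e(1)] by linarith
qed

end

locale aw_mean = symmetric_mean \<sigma> + aw_star M
  for \<sigma> :: "'h oper \<Rightarrow> 'h oper \<Rightarrow> 'h :: chilbert_space oper" and M :: "'h oper set"
begin

text \<open>
  Here the slope of \<open>f\<close> near \<open>0\<close> outweighs its limit \<open>\<alpha>\<close> at \<open>0\<close>, and the test elements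
  \<open>t P + e (1 - P)\<close> with \<open>e \<rightarrow> 0\<close> compare the compressions of the inverses.
\<close>

lemma order_of_steep:
  assumes A: "A \<in> M" "pd A" and B: "B \<in> M" "pd B"
    and test: "\<And>X. X \<in> M \<Longrightarrow> pd X \<Longrightarrow> norm (\<sigma> A X) \<le> norm (\<sigma> B X)"
    and inf: "\<And>e. 0 < e \<Longrightarrow> \<exists>y>0. f y \<le> \<alpha> + e"
    and steep: "\<And>\<rho>. 0 < \<rho> \<Longrightarrow> \<exists>s y0. 0 < y0 \<and> \<alpha> * norm B < s * \<rho> \<and>
      (\<forall>x y. 0 < x \<and> x < y \<and> y \<le> y0 \<longrightarrow> s * (y - x) \<le> f y - f x)"
  shows "A \<le> B"
proof (rule ccontr)
  assume "\<not> A \<le> B"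
  then have "\<not> iv B - iv A \<le> 0" using iv_le_iff[OF A(2) B(2)] by simp
  moreover have inM: "iv A \<in> M" "iv B \<in> M" using A B iv_mem cstar_subalgebra_axioms by blast+
  ultimately obtain P0 \<delta> where P0: "P0 \<in> M" "proj P0" "P0 \<noteq> 0" and \<delta>: "0 < \<delta>" "\<delta> *\<^sub>R P0 \<le> P0 * (iv B - iv A) * P0"
    using spectral_pos[of "iv B - iv A"] A B by (metis diff_mem iv_star star_simps(2))
  obtain k0 where k0: "0 < k0" "k0 *\<^sub>R 1 \<le> iv B" using B(2) pd_iv[of B] by (auto simp: pd_def)
  obtain m where m: "0 < m" "m *\<^sub>R 1 \<le> iv A" using A(2) pd_iv[of A] by (auto simp: pd_def)
  define k1 where "k1 = norm (iv B) + 1"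
  have k1: "0 < k1" by (simp add: k1_def add_nonneg_pos)
\<comment> \<open>\<open>\<rho>\<close> bounds the gap between \<open>1 / c\<close> and \<open>1 / k'\<close> from below, uniformly in the projection chosen later.\<close>
  define \<rho> where "\<rho> = (\<delta> / 2) / k1\<^sup>2"
  have "0 < \<rho>" using \<delta> k1 by (simp add: \<rho>_def)
  from steep[OF this] obtain s y0 where sy: "0 < y0 \<and> \<alpha> * norm B < s * \<rho> \<and>
      (\<forall>x y. 0 < x \<and> x < y \<and> y \<le> y0 \<longrightarrow> s * (y - x) \<le> f y - f x)" by (elim exE)
  then have y0: "0 < y0" and s: "\<alpha> * norm B < s * \<rho>" by auto
  have slope: "s * (y - x) \<le> f y - f x" if "0 < x" "x < y" "y \<le> y0" for x y
    using sy that by simp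
  define u where "u = y0 / (1 / k0 + \<rho>)"
  have u: "0 < u" "u * (1 / k0 + \<rho>) = y0" using y0 k0 \<open>0 < \<rho>\<close> by (auto simp: u_def add_pos_pos less_imp_neq[symmetric])
\<comment> \<open>\<open>u\<close> is chosen so that all arguments of \<open>f\<close> below stay in \<open>(0, y0]\<close>, and \<open>\<eta>\<close> so that the width of the compression costs at most half of the gain \<open>g\<close>.\<close>
  define g where "g = s * \<rho> - \<alpha> * norm B"
  have "0 < g" using s by (simp add: g_def)
  have fu: "0 < f (u / k0)" using u k0 by (intro f_pos) simp
  define \<eta> where "\<eta> = min 1 (min (k0 / 2) (g * k0 * u / (4 * f (u / k0))))"
  have "\<eta> \<le> g * k0 * u / (4 * f (u / k0))" by (simp add: \<eta>_def)
  then have \<eta>: "0 < \<eta>" "\<eta> \<le> 1" "\<eta> \<le> k0 / 2" "2 * \<eta> / k0 * f (u / k0) \<le> g * u / 2"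
    using \<open>0 < g\<close> k0 u fu by (auto simp: \<eta>_def field_simps)
  obtain P k where P: "P \<in> M" "proj P" "P \<noteq> 0" "P \<le> P0" and k: "k *\<^sub>R P \<le> P * iv B * P" "P * iv B * P \<le> (k + \<eta>) *\<^sub>R P"
    using narrow_proj[OF P0 inM(2) _ \<eta>(1)] B(2) by (metis iv_star)
  define k' where "k' = k + \<eta>"
  have "k0 *\<^sub>R P \<le> k' *\<^sub>R P" using order_trans[OF scalar_compress_ge[OF P(2) k0(2)] k(2)] by (simp add: k'_def)
  then have "k0 \<le> k'" by (rule proj_scale_le[OF P(2,3)])
  then have k_pos: "0 < k" "k0 / 2 \<le> k" "k \<le> k'" using \<eta> k0 by (simp_all add: k'_def)
  have "k \<le> norm (iv B)" using B k by (intro le_norm_of_compress[OF P(2,3)]) simp_all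
  then have "k' \<le> k1" using \<eta> by (simp add: k'_def k1_def)
  have "\<delta> *\<^sub>R P \<le> P * (iv B - iv A) * P" by (rule compress_sub_ge[OF P(2) P0(2) P(4) \<delta>(2)])
  then have "P * iv A * P \<le> P * iv B * P - \<delta> *\<^sub>R P" by (simp add: algebra_simps)
  also have "\<dots> \<le> k' *\<^sub>R P - \<delta> *\<^sub>R P" using k(2) by (simp add: k'_def)
  finally have PA: "P * iv A * P \<le> (k' - \<delta>) *\<^sub>R P" by (simp add: algebra_simps)
  have "m *\<^sub>R P \<le> (k' - \<delta>) *\<^sub>R P" by (rule order_trans[OF scalar_compress_ge[OF P(2) m(2)] PA])
  then have "m \<le> k' - \<delta>" by (rule proj_scale_le[OF P(2,3)])
  then have c: "0 < k' - \<delta>" using m by simp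
  define c where "c = k' - \<delta> / 2"
  have c': "k' - \<delta> < c" "0 < c" "c < k'" using c \<delta> by (simp_all add: c_def)
  define t where "t = 1 / u"
  have t: "0 < t" using u by (simp add: t_def)
  have "t * f (1 / (c * t)) \<le> f (t * k' + e * norm (iv B)) / k + f (e * norm (iv B)) * norm B" if e: "0 < e" for e
  proof -
    have "t * f (1 / (c * t)) \<le> norm (\<sigma> A (t *\<^sub>R P + e *\<^sub>R (1 - P)))"
      by (rule norm_mean_lower[OF P(2,3) A(2) PA c c'(1) t e])
    also have "\<dots> \<le> norm (\<sigma> B (t *\<^sub>R P + e *\<^sub>R (1 - P)))"
      using P t e by (intro test pd_two_valued) simp_all
    also have "\<dots> \<le> f (t * k' + e * norm (iv B)) / k + f (e * norm (iv B)) * norm B"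
      by (rule norm_mean_upper[OF P(2) B(2) k(1) k(2)[folded k'_def] k_pos(1,3) t e])
    finally show ?thesis .
  qed
  then have "t * f (1 / (c * t)) \<le> f (t * k') / k + \<alpha> * norm B"
    by (rule limit_upper) (use inf t k_pos B norm_pos_of_pd[of "iv B"] in auto)
  moreover have "f (t * k') = t * k' * f (u / k')"
    using f_sym[of "t * k'"] t k_pos by (simp add: t_def)
  ultimately have "t * f (u / c) \<le> t * (k' / k) * f (u / k') + \<alpha> * norm B" using c' t by (simp add: t_def field_simps)
  then have "u * (t * f (u / c)) \<le> u * (t * (k' / k) * f (u / k') + \<alpha> * norm B)"
    using u by (intro mult_left_mono) simp_all
  then have main: "f (u / c) \<le> (k' / k) * f (u / k') + u * (\<alpha> * norm B)"
    using u by (simp add: t_def distrib_left)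
  define b where "b = 1 / k'"
  have b: "0 < b" "b \<le> 1 / k0" using k_pos \<open>k0 \<le> k'\<close> k0 by (auto simp: b_def field_simps)
  have "b + \<rho> \<le> 1 / c"
  proof -
    have "c * k' \<le> k1 * k1" using \<open>k' \<le> k1\<close> c' k_pos by (intro mult_mono) simp_all
    then have "(\<delta> / 2) / (k1 * k1) \<le> (\<delta> / 2) / (c * k')"
      using c' k_pos \<delta> k1 by (intro divide_left_mono mult_pos_pos) simp_all
    moreover have "(\<delta> / 2) / (c * k') = 1 / c - b"
      using c' k_pos by (simp add: b_def c_def field_simps)
    ultimately show ?thesis by (simp add: \<rho>_def power2_eq_square)
  qed
  then have "f (u * (b + \<rho>)) \<le> f (u / c)"
    using u b \<open>0 < \<rho>\<close> mult_left_mono[of "b + \<rho>" "1 / c" u] by (intro f_mono) simp_all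
  moreover have "s * (u * (b + \<rho>) - u * b) \<le> f (u * (b + \<rho>)) - f (u * b)"
  proof (rule slope)
    have "u * (b + \<rho>) \<le> u * (1 / k0 + \<rho>)" using u b by (intro mult_left_mono) simp_all
    then show "u * (b + \<rho>) \<le> y0" using u by simp
  qed (use u b \<open>0 < \<rho>\<close> in simp_all)
  ultimately have "s * u * \<rho> + f (u / k') \<le> (k' / k) * f (u / k') + u * (\<alpha> * norm B)"
    using main by (simp add: b_def algebra_simps)
  then have "u * g \<le> (k' / k - 1) * f (u / k')" by (simp add: g_def algebra_simps)
  also have "k' / k - 1 = \<eta> / k" using k_pos by (simp add: k'_def field_simps)
  also have "\<eta> / k * f (u / k') \<le> (2 * \<eta> / k0) * f (u / k0)"
  proof (intro mult_mono)
    show "\<eta> / k \<le> 2 * \<eta> / k0" using k_pos k0 \<eta> by (simp add: field_simps)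
    show "f (u / k') \<le> f (u / k0)"
      using u k_pos k0 \<open>k0 \<le> k'\<close> by (intro f_mono divide_left_mono) simp_all
  qed (use \<eta> k0 fu u k_pos f_pos[of "u / k'"] in \<open>simp_all add: less_imp_le\<close>)
  also have "\<dots> \<le> g * u / 2" by (rule \<eta>(4))
  finally have "u * g \<le> u * g / 2" by (simp add: mult.commute)
  then show False using u \<open>0 < g\<close> by (simp add: mult_le_0_iff)
qed


text \<open>
  Affine lower bounds do not follow from Jensen's inequality, since \<open>f\<close> is concave. They are obtained up to a factor
  \<open>r > 1\<close> on spectral projections on which \<open>D\<close> varies by at most this factor.
\<close>

lemma mean_ge_affine:
  assumes D: "D \<in> M" "pd D" "D \<le> y0 *\<^sub>R 1" and "0 \<le> p" "0 \<le> q"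
    and fge: "\<And>x. 0 < x \<Longrightarrow> x \<le> y0 \<Longrightarrow> p + q * x \<le> f x"
  shows "p *\<^sub>R 1 + q *\<^sub>R D \<le> \<sigma> 1 D"
proof -
  define X where "X = p *\<^sub>R 1 + q *\<^sub>R D"
  define T where "T = \<sigma> 1 D"
  have sT: "star T = T" unfolding T_def using D by (simp add: pd_mean)
  obtain d where d: "0 < d" "d *\<^sub>R 1 \<le> D" using D by (auto simp: pd_def)
  have r_bound: "X \<le> r *\<^sub>R T" if "1 < r" for r
  proof -
    have "1 * X * 1 \<le> r *\<^sub>R (1 * T * 1)"
    proof (rule spectral_induct[OF D(1) pd_star[OF D(2)] d that, where \<Phi> = "\<lambda>Q. Q * X * Q \<le> r *\<^sub>R (Q * T * Q)"])
      fix Q l assume Q: "Q \<in> M" "proj Q" "Q * D = D * Q" and l: "0 < l" "l *\<^sub>R Q \<le> Q * D * Q" "Q * D * Q \<le> (r * l) *\<^sub>R Q"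
      show "Q * X * Q \<le> r *\<^sub>R (Q * T * Q)"
      proof (cases "Q = 0")
        case False
        have "l *\<^sub>R Q \<le> y0 *\<^sub>R Q" by (rule order_trans[OF l(2) scalar_compress_le[OF Q(2) D(3)]])
        then have "l \<le> y0" by (rule proj_scale_le[OF Q(2) False])
        have "Q * X * Q = p *\<^sub>R Q + q *\<^sub>R (Q * D * Q)" using Q by (simp add: X_def algebra_simps)
        also have "\<dots> \<le> p *\<^sub>R Q + q *\<^sub>R (r * l) *\<^sub>R Q" by (intro add_left_mono scaleR_left_mono l assms)
        also have "\<dots> = (p + q * (r * l)) *\<^sub>R Q" by (simp add: algebra_simps)
        also have "\<dots> \<le> (r * (p + q * l)) *\<^sub>R Q"
          using that \<open>0 \<le> p\<close> mult_right_mono[of 1 r p] Q by (intro scaleR_right_mono proj_nonneg) (simp_all add: algebra_simps)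
        also have "\<dots> \<le> (r * f l) *\<^sub>R Q"
          using that fge[OF l(1) \<open>l \<le> y0\<close>] Q by (intro scaleR_right_mono proj_nonneg mult_left_mono) simp_all
        also have "\<dots> = r *\<^sub>R f l *\<^sub>R Q" by simp
        also have "\<dots> \<le> r *\<^sub>R (Q * T * Q)"
          unfolding T_def using that Q D l by (intro scaleR_left_mono mean_local_ge) simp_all
        finally show ?thesis .
      qed simp
    next
      fix P Q assume P: "proj P" "proj Q" "P * D = D * P" "Q * D = D * Q" and orth: "P * Q = 0" "Q * P = 0"
        and le: "P * X * P \<le> r *\<^sub>R (P * T * P)" "Q * X * Q \<le> r *\<^sub>R (Q * T * Q)"
      have split: "(P + Q) * Y * (P + Q) = P * Y * P + Q * Y * Q" if "P * Y = Y * P" "Q * Y = Y * Q" for Y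
      proof -
        have "P * Y * Q = 0" "Q * Y * P = 0" using that orth by (simp_all add: mult.assoc)
        then show ?thesis by (simp add: algebra_simps)
      qed
      have "P * X = X * P" "Q * X = X * Q" using P by (simp_all add: X_def algebra_simps)
      moreover have "P * T = T * P" "Q * T = T * Q" unfolding T_def using P D by (simp_all add: mean_commutes_proj)
      ultimately show "(P + Q) * X * (P + Q) \<le> r *\<^sub>R ((P + Q) * T * (P + Q))"
        using le by (simp only: split scaleR_add_right add_mono)
    qed
    then show ?thesis by simp
  qed
  have "X - T \<le> 0"
  proof (rule nonpos_of_le_scalars)
    fix e :: real assume "0 < e"
    define r where "r = 1 + e / (norm T + 1)"
    have nT: "0 < norm T + 1" by (simp add: add_nonneg_pos)
    have r: "1 < r" using \<open>0 < e\<close> nT by (simp add: r_def)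
    have "X - T \<le> (r - 1) *\<^sub>R T" using r_bound[OF r] by (simp add: algebra_simps)
    also have "\<dots> \<le> (r - 1) *\<^sub>R norm T *\<^sub>R 1" using r sT by (intro scaleR_left_mono le_norm) simp_all
    also have "\<dots> \<le> e *\<^sub>R 1"
    proof -
      have "(r - 1) * norm T \<le> (r - 1) * (norm T + 1)" using r by (intro mult_left_mono) simp_all
      also have "\<dots> = e" using nT by (simp add: r_def)
      finally show ?thesis by (simp add: scaleR_right_mono one_nonneg)
    qed
    finally show "X - T \<le> e *\<^sub>R 1" .
  qed
  then show ?thesis by (simp add: X_def T_def)
qed

text \<open>
  If \<open>f\<close> has a positive limit \<open>\<alpha>\<close> and a finite slope \<open>\<gamma>\<close> at \<open>0\<close>, then \<open>A \<sigma> X\<close> is close to \<open>\<alpha> X + \<gamma> A\<close> for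
  large \<open>X\<close>. For \<open>X = t P + (t/2) (1 - P)\<close> the norm then picks out the compression of \<open>A\<close> to \<open>P\<close>.
\<close>

lemma order_of_affine:
  assumes A: "A \<in> M" "pd A" and B: "B \<in> M" "pd B"
    and test: "\<And>X. X \<in> M \<Longrightarrow> pd X \<Longrightarrow> norm (\<sigma> A X) \<le> norm (\<sigma> B X)"
    and pos: "0 < \<alpha>" "0 < \<gamma>" and above: "\<And>x. 0 < x \<Longrightarrow> f x \<le> \<alpha> + \<gamma> * x"
    and below: "\<And>\<gamma>'. \<gamma>' < \<gamma> \<Longrightarrow> \<exists>y0>0. \<forall>y. 0 < y \<and> y \<le> y0 \<longrightarrow> \<alpha> + \<gamma>' * y \<le> f y"
  shows "A \<le> B"
proof (rule ccontr)
  assume "\<not> A \<le> B"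
  then have "\<not> A - B \<le> 0" by simp
  moreover have "A - B \<in> M" "star (A - B) = A - B" using A B by simp_all
  ultimately obtain P0 \<delta> where P0: "P0 \<in> M" "proj P0" "P0 \<noteq> 0" and \<delta>: "0 < \<delta>" "\<delta> *\<^sub>R P0 \<le> P0 * (A - B) * P0"
    using spectral_pos[of "A - B"] by metis
  obtain P k where P: "P \<in> M" "proj P" "P \<noteq> 0" "P \<le> P0" and k: "k *\<^sub>R P \<le> P * B * P" "P * B * P \<le> (k + \<delta> / 4) *\<^sub>R P"
    using narrow_proj[OF P0 B(1) pd_star[OF B(2)], of "\<delta> / 4"] \<delta>(1) by auto
  define b where "b = k + \<delta> / 4"
  have b: "P * B * P \<le> b *\<^sub>R P" using k(2) by (simp add: b_def)
  have "0 *\<^sub>R P \<le> b *\<^sub>R P"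
    using order_trans[OF conj_nonneg[OF pd_nonneg[OF B(2)], of P]] b P by simp
  then have "0 \<le> b" by (rule proj_scale_le[OF P(2,3)])
  have "k \<le> norm B" using B k by (intro le_norm_of_compress[OF P(2,3)]) simp_all
  have "\<delta> *\<^sub>R P \<le> P * (A - B) * P" by (rule compress_sub_ge[OF P(2) P0(2) P(4) \<delta>(2)])
  then have "\<delta> *\<^sub>R P + k *\<^sub>R P \<le> P * (A - B) * P + P * B * P" by (intro add_mono k)
  then have PA: "(b + 3 * \<delta> / 4) *\<^sub>R P \<le> P * A * P" by (simp add: b_def algebra_simps flip: scaleR_add_left)
\<comment> \<open>a relative loss of \<open>\<tau>\<close> in each of the two estimates is smaller than the gap \<open>\<delta>\<close>.\<close>
  define \<tau> where "\<tau> = \<delta> / (4 * (norm B + \<delta>))"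
  have nB: "0 < norm B + \<delta>" using \<delta>(1) by (simp add: add_nonneg_pos)
  have \<tau>: "0 < \<tau>" "\<tau> < 1" "\<tau> * (norm B + \<delta>) = \<delta> / 4"
    using \<delta>(1) nB norm_ge_zero[of B] unfolding \<tau>_def by (simp_all add: field_simps del: norm_ge_zero) linarith?
  have "(1 - \<tau>) * \<gamma> < \<gamma>" using \<tau> pos by simp
  from below[OF this] obtain y0 where y0: "0 < y0"
    and fge: "\<And>y. 0 < y \<Longrightarrow> y \<le> y0 \<Longrightarrow> \<alpha> + (1 - \<tau>) * \<gamma> * y \<le> f y" by blast
  define K where "K = (1 + 1 / \<tau>) * norm B"
  have "0 \<le> K" using \<tau> by (simp add: K_def)
\<comment> \<open>the first bound makes the scaled \<open>A\<close> small, the second lets the block on \<open>P\<close> dominate.\<close>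
  define t where "t = max (2 * norm A / y0) (2 * (\<gamma> * K + 1) / \<alpha>)"
  have t: "0 < t" "2 * norm A \<le> y0 * t" "\<gamma> * K \<le> \<alpha> * t / 2"
  proof -
    have "0 < 2 * (\<gamma> * K + 1) / \<alpha>" using pos \<open>0 \<le> K\<close> by (simp add: add_nonneg_pos)
    also have le: "\<dots> \<le> t" by (simp add: t_def)
    finally show "0 < t" .
    have "2 * norm A / y0 \<le> t" by (simp add: t_def)
    then show "2 * norm A \<le> y0 * t" using y0 by (simp add: divide_le_eq mult.commute)
    show "\<gamma> * K \<le> \<alpha> * t / 2" using le pos by (simp add: divide_le_eq mult.commute)
  qed
  define X where "X = t *\<^sub>R P + (t / 2) *\<^sub>R (1 - P)"
  have X: "X \<in> M" "pd X" unfolding X_def using P t by (auto intro: pd_two_valued)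
  define S where "S = sqrt t *\<^sub>R P + sqrt (t / 2) *\<^sub>R (1 - P)"
  have S: "S \<in> M" "pd S" "S * S = X"
    unfolding S_def X_def using P t by (auto simp: two_valued_mult intro: pd_two_valued)
  have ivS: "iv S * iv S = (1 / t) *\<^sub>R P + (2 / t) *\<^sub>R (1 - P)"
  proof -
    have "iv S = (1 / sqrt t) *\<^sub>R P + (1 / sqrt (t / 2)) *\<^sub>R (1 - P)"
      unfolding S_def using P t by (intro iv_two_valued) simp_all
    moreover have "1 / sqrt c * (1 / sqrt c) = 1 / c" if "0 < c" for c using that by simp
    ultimately show ?thesis
      unfolding two_valued_mult[OF P(2)] using t two_valued_mult[OF P(2)] by simp
  qed
  have mean_X: "\<sigma> C X = S * \<sigma> 1 (iv S * C * iv S) * S" if "pd C" for C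
  proof -
    have "pd (iv S * C * iv S)" using S that by (simp add: pd_conj)
    from mean_square[OF S(2) this] have "\<sigma> X C = S * \<sigma> 1 (iv S * C * iv S) * S"
      using S by (simp add: mult.assoc)
    then show ?thesis using mean_commute[OF that X(2)] by simp
  qed
  have affine: "S * (p *\<^sub>R 1 + q *\<^sub>R (iv S * C * iv S)) * S = p *\<^sub>R X + q *\<^sub>R C" for p q C
    using S by (simp add: distrib_left distrib_right mult.assoc)
  have lower: "\<alpha> *\<^sub>R X + ((1 - \<tau>) * \<gamma>) *\<^sub>R A \<le> \<sigma> A X"
  proof -
    have "iv S * A * iv S \<le> iv S * (norm A *\<^sub>R 1) * iv S"
      using S A by (intro conj_mono_sa le_norm) simp_all
    also have "\<dots> = norm A *\<^sub>R ((1 / t) *\<^sub>R P + (2 / t) *\<^sub>R (1 - P))" by (simp add: ivS)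
    also have "\<dots> \<le> norm A *\<^sub>R ((2 / t) *\<^sub>R P + (2 / t) *\<^sub>R (1 - P))"
      using t P by (intro scaleR_left_mono add_right_mono scaleR_right_mono) (simp_all add: proj_nonneg divide_right_mono)
    also have "\<dots> = (2 * norm A / t) *\<^sub>R 1" by (simp add: algebra_simps)
    also have "\<dots> \<le> y0 *\<^sub>R 1" using t by (intro scaleR_right_mono one_nonneg) (simp add: divide_le_eq)
    finally have "\<alpha> *\<^sub>R 1 + ((1 - \<tau>) * \<gamma>) *\<^sub>R (iv S * A * iv S) \<le> \<sigma> 1 (iv S * A * iv S)"
      using A S pos \<tau> iv_mem[OF S(2) cstar_subalgebra_axioms S(1)]
      by (intro mean_ge_affine[where ?y0.0 = y0] fge) (simp_all add: pd_conj)
    then have "S * (\<alpha> *\<^sub>R 1 + ((1 - \<tau>) * \<gamma>) *\<^sub>R (iv S * A * iv S)) * S \<le> S * \<sigma> 1 (iv S * A * iv S) * S"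
      using S by (intro conj_mono_sa) simp_all
    then show ?thesis using A by (simp only: affine mean_X)
  qed
  have PX: "P * X * P = t *\<^sub>R P" unfolding X_def by (rule two_valued_compress[OF P(2)])
  have "\<alpha> *\<^sub>R t *\<^sub>R P + ((1 - \<tau>) * \<gamma>) *\<^sub>R (b + 3 * \<delta> / 4) *\<^sub>R P \<le> \<alpha> *\<^sub>R t *\<^sub>R P + ((1 - \<tau>) * \<gamma>) *\<^sub>R (P * A * P)"
    using pos \<tau> by (intro add_left_mono scaleR_left_mono PA) simp_all
  also have "\<dots> = P * (\<alpha> *\<^sub>R X + ((1 - \<tau>) * \<gamma>) *\<^sub>R A) * P"
    by (simp only: PX[symmetric] distrib_left distrib_right mult_scaleR_left mult_scaleR_right)
  also have "\<dots> \<le> P * \<sigma> A X * P"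
    using P lower by (intro conj_mono_sa) simp_all
  finally have "\<alpha> *\<^sub>R t *\<^sub>R P + ((1 - \<tau>) * \<gamma>) *\<^sub>R (b + 3 * \<delta> / 4) *\<^sub>R P \<le> P * \<sigma> A X * P" .
  then have "(\<alpha> * t + (1 - \<tau>) * \<gamma> * (b + 3 * \<delta> / 4)) *\<^sub>R P \<le> P * \<sigma> A X * P"
    by (simp only: scaleR_scaleR scaleR_add_left[symmetric])
  then have "\<alpha> * t + (1 - \<tau>) * \<gamma> * (b + 3 * \<delta> / 4) \<le> norm (\<sigma> A X)"
    using A X by (intro le_norm_of_compress[OF P(2,3)]) (simp_all add: pd_mean)
  also have "\<dots> \<le> norm (\<sigma> B X)" using X by (intro test)
  also have "\<dots> \<le> \<alpha> * t + \<gamma> * ((1 + \<tau>) * b)"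
  proof -
    have pos': "0 \<le> \<gamma> * ((1 + \<tau>) * b)" using pos \<tau> \<open>0 \<le> b\<close> by simp
    have "\<sigma> 1 (iv S * B * iv S) \<le> \<alpha> *\<^sub>R 1 + \<gamma> *\<^sub>R (iv S * B * iv S)"
      using B S above by (intro mean_le_affine) (simp_all add: pd_conj)
    then have "S * \<sigma> 1 (iv S * B * iv S) * S \<le> S * (\<alpha> *\<^sub>R 1 + \<gamma> *\<^sub>R (iv S * B * iv S)) * S"
      using S by (intro conj_mono_sa) simp_all
    then have "\<sigma> B X \<le> \<alpha> *\<^sub>R X + \<gamma> *\<^sub>R B" using B by (simp only: affine mean_X)
    also have "\<dots> \<le> \<alpha> *\<^sub>R X + \<gamma> *\<^sub>R (((1 + \<tau>) * b) *\<^sub>R P + K *\<^sub>R (1 - P))"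
      unfolding K_def using pos B b P \<tau> by (intro add_left_mono scaleR_left_mono block_bound_scalar) (simp_all add: pd_nonneg)
    also have "\<dots> = (\<alpha> * t + \<gamma> * ((1 + \<tau>) * b)) *\<^sub>R P + (\<alpha> * t / 2 + \<gamma> * K) *\<^sub>R (1 - P)"
      by (simp only: X_def scaleR_add_right scaleR_add_left scaleR_scaleR times_divide_eq_right) (simp only: add_ac)
    also have "\<dots> \<le> (\<alpha> * t + \<gamma> * ((1 + \<tau>) * b)) *\<^sub>R P + (\<alpha> * t + \<gamma> * ((1 + \<tau>) * b)) *\<^sub>R (1 - P)"
      using t(3) pos' P by (intro add_left_mono scaleR_right_mono) (simp_all add: proj_nonneg proj_le_1)
    also have "\<dots> = (\<alpha> * t + \<gamma> * ((1 + \<tau>) * b)) *\<^sub>R 1"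
      by (simp only: scaleR_add_right[symmetric]) simp
    finally have "\<sigma> B X \<le> (\<alpha> * t + \<gamma> * ((1 + \<tau>) * b)) *\<^sub>R 1" .
    moreover have "0 \<le> \<sigma> B X" using B X by (intro pd_nonneg pd_mean)
    moreover have "0 \<le> \<alpha> * t + \<gamma> * ((1 + \<tau>) * b)" using pos' pos t by simp
    ultimately show ?thesis using norm_le_iff_pos by blast
  qed
  finally have "\<gamma> * ((1 - \<tau>) * (b + 3 * \<delta> / 4)) \<le> \<gamma> * ((1 + \<tau>) * b)" by (simp add: mult_ac)
  then have "(1 - \<tau>) * (b + 3 * \<delta> / 4) \<le> (1 + \<tau>) * b" using pos by simp
  then have "3 * \<delta> / 4 \<le> \<tau> * (2 * b + 3 * \<delta> / 4)" by (simp add: algebra_simps)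
  also have "\<dots> \<le> \<tau> * (11 / 4 * (norm B + \<delta>))"
  proof (intro mult_left_mono)
    show "2 * b + 3 * \<delta> / 4 \<le> 11 / 4 * (norm B + \<delta>)"
      unfolding b_def using \<open>k \<le> norm B\<close> \<delta>(1) norm_ge_zero[of B] by argo
  qed (use \<tau> in simp)
  also have "\<dots> = 11 / 4 * (\<tau> * (norm B + \<delta>))" by (simp only: mult_ac)
  also have "\<dots> = 11 / 16 * \<delta>" by (simp only: \<tau>)
  finally show False using \<delta>(1) by simp
qed

end

text \<open>
  On a one-dimensional space the axioms of a mean say only that \<open>f(x)\<close> increases and \<open>f(x) / x\<close> decreases. Two
  orthonormal vectors make \<open>f\<close> concave, which is what controls its slopes at \<open>0\<close>.
\<close>

locale aw_mean_2 = aw_mean +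
  assumes dim_ge_2: "\<exists>e g :: 'a. norm e = 1 \<and> norm g = 1 \<and> cinner e g = 0"
begin

lemma f_chord:
  assumes "0 < x" "x < y" "y < z"
  shows "(z - y) * f x + (y - x) * f z \<le> (z - x) * f y"
proof -
  obtain e g :: 'a where eg: "norm e = 1" "norm g = 1" "cinner e g = 0" using dim_ge_2 by blast
  define u where "u = (z - y) / (z - x)"
  have zx: "0 < z - x" using assms by simp
  have u: "u * (z - x) = z - y" "0 \<le> u" "u \<le> 1" using assms by (auto simp: u_def divide_le_eq)
  have "u * x + (1 - u) * z = z - u * (z - x)" by (simp add: algebra_simps)
  then have "u * x + (1 - u) * z = y" using u by simp
  then have "u * f x + (1 - u) * f z \<le> f y"
    using f_concave[OF eg _ _ u(2,3), of x z] assms by simp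
  then have "(z - x) * (u * f x + (1 - u) * f z) \<le> (z - x) * f y" using zx by (intro mult_left_mono) simp_all
  moreover have "(z - x) * (u * f x + (1 - u) * f z) = (u * (z - x)) * f x + ((z - x) - u * (z - x)) * f z"
    by (simp add: algebra_simps)
  ultimately show ?thesis unfolding u(1) by simp
qed

lemma f_slope_antimono:
  assumes "0 < x" "x < y" "y < z"
  shows "(f z - f y) / (z - y) \<le> (f y - f x) / (y - x)"
proof -
  have "(f z - f y) * (y - x) \<le> (f y - f x) * (z - y)"
    using f_chord[OF assms] by (simp add: algebra_simps)
  then show ?thesis using assms by (simp add: pos_divide_le_eq pos_le_divide_eq divide_divide_eq_left mult.commute)
      (simp add: field_simps)?
qed

lemma f_slope_before:
  assumes "0 < x" "x < y" "y \<le> a" "a < b" "s * (b - a) \<le> f b - f a"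
  shows "s * (y - x) \<le> f y - f x"
proof -
  have "s \<le> (f b - f a) / (b - a)" using assms by (simp add: pos_le_divide_eq)
  also have "\<dots> \<le> (f y - f x) / (y - x)"
  proof (cases "y = a")
    case True
    then show ?thesis using f_slope_antimono[of x y b] assms by simp
  next
    case False
    have "(f b - f a) / (b - a) \<le> (f a - f y) / (a - y)" using f_slope_antimono[of y a b] assms False by simp
    also have "\<dots> \<le> (f y - f x) / (y - x)" using f_slope_antimono[of x y a] assms False by simp
    finally show ?thesis .
  qed
  finally show ?thesis using assms by (simp add: pos_le_divide_eq)
qed

text \<open>
  If chords with slope below \<open>s\<close> occur arbitrarily close to \<open>0\<close>, then by concavity all later slopes are below
  \<open>s\<close>. The difference quotients of \<open>f\<close> at \<open>0\<close> are therefore bounded, and their supremum \<open>\<gamma>\<close> is the slope at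
  \<open>0\<close>.
\<close>

lemma f_affine_at_0:
  assumes inf: "\<And>x. 0 < x \<Longrightarrow> \<alpha> \<le> f x" "\<And>e. 0 < e \<Longrightarrow> \<exists>y>0. f y \<le> \<alpha> + e" and "0 < \<alpha>"
    and not_steep: "\<And>y0. 0 < y0 \<Longrightarrow> \<exists>x y. 0 < x \<and> x < y \<and> y \<le> y0 \<and> f y - f x < s * (y - x)"
  obtains \<gamma> where "0 < \<gamma>" "\<And>x. 0 < x \<Longrightarrow> f x \<le> \<alpha> + \<gamma> * x"
    "\<And>\<gamma>'. \<gamma>' < \<gamma> \<Longrightarrow> \<exists>y0>0. \<forall>y. 0 < y \<and> y \<le> y0 \<longrightarrow> \<alpha> + \<gamma>' * y \<le> f y"
proof -
  have "0 \<le> s"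
  proof -
    obtain x y where "0 < x" "x < y" "f y - f x < s * (y - x)" using not_steep[of 1] by auto
    moreover have "f x \<le> f y" using \<open>0 < x\<close> \<open>x < y\<close> by (intro f_mono) simp_all
    ultimately have "0 < s * (y - x)" by linarith
    then show ?thesis using \<open>x < y\<close> by (simp add: zero_less_mult_iff)
  qed
  have bound: "f z \<le> \<alpha> + s * z" if "0 < z" for z
  proof (rule field_le_epsilon)
    fix e :: real assume "0 < e"
    then obtain y1 where y1: "0 < y1" "f y1 \<le> \<alpha> + e" using inf by blast
    define y0 where "y0 = min y1 (z / 2)"
    have "0 < y0" using y1 that by (simp add: y0_def)
    then obtain x y where xy: "0 < x" "x < y" "y \<le> y0" "f y - f x < s * (y - x)" using not_steep by blast
    have "y < z" "y \<le> y1" using xy that by (auto simp: y0_def)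
    have "f z - f y \<le> s * (z - y)"
    proof (rule ccontr)
      assume "\<not> f z - f y \<le> s * (z - y)"
      then have "s * (z - y) \<le> f z - f y" by simp
      then have "s * (y - x) \<le> f y - f x" using f_slope_before[of x y y z s] xy \<open>y < z\<close> by simp
      then show False using xy by simp
    qed
    moreover have "s * (z - y) \<le> s * z" using \<open>0 \<le> s\<close> xy by (intro mult_left_mono) simp_all
    moreover have "f y \<le> f y1" using xy \<open>y \<le> y1\<close> by (intro f_mono) simp_all
    ultimately show "f z \<le> \<alpha> + s * z + e" using y1 by linarith
  qed
  define q where "q z = (f z - \<alpha>) / z" for z
  have q: "q z \<le> s" if "0 < z" for z
    using bound[OF that] that by (simp add: q_def pos_divide_le_eq mult.commute algebra_simps)
  define \<gamma> where "\<gamma> = Sup (q ` {0<..})"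
  have bdd: "bdd_above (q ` {0<..})" using q by (auto intro!: bdd_aboveI)
  have q_le: "q z \<le> \<gamma>" if "0 < z" for z
    unfolding \<gamma>_def using that bdd by (intro cSup_upper) simp_all
  have "f 2 = 2 * f (1 / 2)" by (rule f_sym) simp
  then have "\<alpha> < f 2" using inf(1)[of "1 / 2"] \<open>0 < \<alpha>\<close> by simp
  then have "0 < \<gamma>" using q_le[of 2] by (simp add: q_def)
  moreover have "f x \<le> \<alpha> + \<gamma> * x" if "0 < x" for x
    using q_le[OF that] that by (simp add: q_def pos_divide_le_eq algebra_simps)
  moreover have "\<exists>y0>0. \<forall>y. 0 < y \<and> y \<le> y0 \<longrightarrow> \<alpha> + \<gamma>' * y \<le> f y" if less: "\<gamma>' < \<gamma>" for \<gamma>'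
  proof -
    obtain y0 where y0: "0 < y0" "\<gamma>' < q y0"
      using less_cSupD[of "q ` {0<..}" \<gamma>'] less unfolding \<gamma>_def by auto
    have "\<alpha> + \<gamma>' * y \<le> f y" if y: "0 < y" "y \<le> y0" for y
    proof -
      have "(y0 - y) * \<alpha> + y * f y0 \<le> y0 * f y"
      proof (cases "y = y0")
        case False
        then have "y < y0" using y by simp
        show ?thesis
        proof (rule ccontr)
          define w where "w = (y0 - y) * \<alpha> + y * f y0 - y0 * f y"
          assume "\<not> ?thesis"
          then have "0 < w" by (simp add: w_def)
          have w: "w \<le> x * (f y0 - f y)" if "0 < x" "x < y" for x
          proof -
            have "(y0 - y) * \<alpha> \<le> (y0 - y) * f x" using inf(1)[OF that(1)] \<open>y < y0\<close> by (intro mult_left_mono) simp_all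
            then show ?thesis using f_chord[OF that \<open>y < y0\<close>] by (simp add: w_def algebra_simps)
          qed
          define h where "h = f y0 - f y + 1"
          have "0 < h" using f_mono[OF y] by (simp add: h_def)
          define x where "x = min (y / 2) (w / (2 * h))"
          have x: "0 < x" "x < y" "x * h \<le> w / 2"
          proof -
            have "x \<le> w / (2 * h)" by (simp add: x_def)
            then show "x * h \<le> w / 2" using \<open>0 < h\<close> by (simp add: pos_le_divide_eq mult_ac)
          qed (use \<open>0 < w\<close> \<open>0 < h\<close> y in \<open>auto simp: x_def\<close>)
          have "w \<le> x * (f y0 - f y)" using x by (intro w)
          also have "\<dots> \<le> x * h" using x by (intro mult_left_mono) (simp_all add: h_def)
          finally show False using x(3) \<open>0 < w\<close> by simp
        qed
      qed simp
      moreover have "\<gamma>' * y0 \<le> f y0 - \<alpha>" using y0 by (simp add: q_def pos_less_divide_eq)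
      then have "y * (\<gamma>' * y0) \<le> y * (f y0 - \<alpha>)" using y by (intro mult_left_mono) simp_all
      ultimately have "y0 * (\<alpha> + \<gamma>' * y) \<le> y0 * f y" by (simp add: algebra_simps)
      then show ?thesis using y0 by simp
    qed
    then show ?thesis using y0(1) by blast
  qed
  ultimately show ?thesis by (rule that)
qed

text \<open>
  Either the limit \<open>\<alpha>\<close> of \<open>f\<close> at \<open>0\<close> vanishes, or the slopes near \<open>0\<close> are unbounded, or \<open>f\<close> is affine to
  first order at \<open>0\<close> with a positive constant term; the two kinds of test elements cover these cases.
\<close>

theorem order_iff_norm_mean:
  assumes A: "A \<in> M" "pd A" and B: "B \<in> M" "pd B"
  shows "A \<le> B \<longleftrightarrow> (\<forall>X\<in>M. pd X \<longrightarrow> norm (\<sigma> A X) \<le> norm (\<sigma> B X))"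
proof
  assume "A \<le> B"
  show "\<forall>X\<in>M. pd X \<longrightarrow> norm (\<sigma> A X) \<le> norm (\<sigma> B X)"
  proof (intro ballI impI)
    fix X assume "X \<in> M" "pd X"
    have "\<sigma> A X \<le> \<sigma> B X" using \<open>A \<le> B\<close> \<open>pd X\<close> A by (intro mean_mono) simp_all
    also have "\<dots> \<le> norm (\<sigma> B X) *\<^sub>R 1" using B \<open>pd X\<close> by (intro le_norm) (simp add: pd_mean)
    finally show "norm (\<sigma> A X) \<le> norm (\<sigma> B X)"
      using norm_le_iff_pos[of "\<sigma> A X" "norm (\<sigma> B X)"] A \<open>pd X\<close> by (simp add: pd_nonneg pd_mean)
  qed
next
  assume "\<forall>X\<in>M. pd X \<longrightarrow> norm (\<sigma> A X) \<le> norm (\<sigma> B X)"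
  then have test: "norm (\<sigma> A X) \<le> norm (\<sigma> B X)" if "X \<in> M" "pd X" for X using that by blast
  define \<alpha> where "\<alpha> = Inf (f ` {0<..})"
  have bdd: "bdd_below (f ` {0<..})" by (rule bdd_belowI[of _ 0]) (auto intro: less_imp_le f_pos)
  have low: "\<alpha> \<le> f x" if "0 < x" for x
    unfolding \<alpha>_def using that bdd by (intro cInf_lower) simp_all
  have inf: "\<exists>y>0. f y \<le> \<alpha> + e" if "0 < e" for e
    using cInf_lessD[of "f ` {0<..}" "\<alpha> + e"] that unfolding \<alpha>_def[symmetric] by fastforce
  have "0 \<le> \<alpha>" unfolding \<alpha>_def by (rule cInf_greatest) (auto intro: less_imp_le f_pos)
  define steep where "steep s y0 \<longleftrightarrow> (\<forall>x y. 0 < x \<and> x < y \<and> y \<le> y0 \<longrightarrow> s * (y - x) \<le> f y - f x)" for s y0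
  consider (zero) "\<alpha> = 0" | (steep) "\<And>s. \<exists>y0>0. steep s y0" | (affine) s where "0 < \<alpha>" "\<And>y0. 0 < y0 \<Longrightarrow> \<not> steep s y0"
    using \<open>0 \<le> \<alpha>\<close> by fastforce
  then show "A \<le> B"
  proof cases
    case zero
    obtain y1 where y1: "0 < y1" "f y1 \<le> 1 / 2" using inf[of "1 / 2"] zero by auto
    have "y1 < 1"
    proof (rule ccontr)
      assume "\<not> y1 < 1"
      then have "f 1 \<le> f y1" by (intro f_mono) simp_all
      then show False using y1 f_one by simp
    qed
    define s where "s = (f 1 - f y1) / (1 - y1)"
    have s: "0 < s" "s * (1 - y1) = f 1 - f y1" using y1 \<open>y1 < 1\<close> f_one by (simp_all add: s_def)
    have "steep s y1" unfolding steep_def using f_slope_before[of _ _ y1 1 s] s \<open>y1 < 1\<close> by auto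
    show ?thesis
    proof (rule order_of_steep[OF A B test inf])
      fix \<rho> :: real assume "0 < \<rho>"
      then show "\<exists>s y0. 0 < y0 \<and> \<alpha> * norm B < s * \<rho> \<and>
          (\<forall>x y. 0 < x \<and> x < y \<and> y \<le> y0 \<longrightarrow> s * (y - x) \<le> f y - f x)"
        using \<open>steep s y1\<close> y1 s zero unfolding steep_def by (rule_tac exI[of _ s], rule_tac exI[of _ y1]) simp
    qed
  next
    case steep
    show ?thesis
    proof (rule order_of_steep[OF A B test inf])
      fix \<rho> :: real assume "0 < \<rho>"
      define s where "s = (\<alpha> * norm B + 1) / \<rho>"
      have "s * \<rho> = \<alpha> * norm B + 1" using \<open>0 < \<rho>\<close> by (simp add: s_def)
      moreover obtain y0 where "0 < y0" "steep s y0" using steep[of s] by blast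
      ultimately show "\<exists>s y0. 0 < y0 \<and> \<alpha> * norm B < s * \<rho> \<and>
          (\<forall>x y. 0 < x \<and> x < y \<and> y \<le> y0 \<longrightarrow> s * (y - x) \<le> f y - f x)"
        unfolding steep_def by (rule_tac exI[of _ s], rule_tac exI[of _ y0]) simp
    qed
  next
    case affine
    have "\<exists>x y. 0 < x \<and> x < y \<and> y \<le> y0 \<and> f y - f x < s * (y - x)" if "0 < y0" for y0
      using affine(2)[OF that] unfolding steep_def by (auto simp: not_le)
    then obtain \<gamma> where "0 < \<gamma>" "\<And>x. 0 < x \<Longrightarrow> f x \<le> \<alpha> + \<gamma> * x"
      "\<And>\<gamma>'. \<gamma>' < \<gamma> \<Longrightarrow> \<exists>y0>0. \<forall>y. 0 < y \<and> y \<le> y0 \<longrightarrow> \<alpha> + \<gamma>' * y \<le> f y"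
      using f_affine_at_0[OF low inf affine(1), of s] by metis
    then show ?thesis by (intro order_of_affine[OF A B test affine(1)])
  qed
qed

end

lemma (in symmetric_mean) mean_self: "pd A \<Longrightarrow> \<sigma> A A = A"
proof -
  assume A: "pd A"
  have "\<sigma> A A = rt A * \<sigma> 1 (iv (rt A) * A * iv (rt A)) * rt A" by (rule mean_eq_conj[OF A A])
  also have "iv (rt A) * A * iv (rt A) = iv (rt A) * (rt A * rt A) * iv (rt A)"
    using A by (simp add: rt_square pd_nonneg)
  also have "\<dots> = 1" using A by (simp add: mult.assoc pd_rt)
  finally show ?thesis using A by (simp add: mean_one rt_square pd_nonneg)
qed

section \<open>Order isomorphisms of positive definite cones\<close>

context aw_star
begin

definition interval :: "real \<Rightarrow> real \<Rightarrow> 'a oper set"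
  where "interval s t = {X \<in> M. s *\<^sub>R 1 \<le> X \<and> X \<le> t *\<^sub>R 1}"

definition disj :: "real \<Rightarrow> real \<Rightarrow> 'a oper \<Rightarrow> 'a oper \<Rightarrow> bool"
  where "disj s t G X \<longleftrightarrow> (\<forall>L\<in>interval s t. L \<le> G \<longrightarrow> L \<le> X \<longrightarrow> L = s *\<^sub>R 1)"

text \<open>
  An order theoretic substitute for two-valuedness: \<open>X\<close> is the largest element of the interval
  that is disjoint from everything that is disjoint from \<open>X\<close>.
\<close>

definition sharp :: "real \<Rightarrow> real \<Rightarrow> 'a oper \<Rightarrow> bool"
  where "sharp s t X \<longleftrightarrow> X \<in> interval s t \<and>
    (\<forall>F\<in>interval s t. (\<forall>G\<in>interval s t. disj s t G X \<longrightarrow> disj s t G F) \<longrightarrow> F \<le> X)"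

text \<open>
  If \<open>E = X - s\<close> had spectrum strictly inside \<open>(0, t - s)\<close>, one could enlarge \<open>X\<close> to some
  \<open>F \<le> s + 2 E\<close> on a spectral projection of \<open>E (t - s - E)\<close>; such an \<open>F\<close> is disjoint from the same elements.
\<close>

lemma sharp_imp_two_valued:
  assumes "s < t" and X: "sharp s t X"
  obtains P where "P \<in> M" "proj P" "X = s *\<^sub>R P + t *\<^sub>R (1 - P)"
proof -
  define d where "d = t - s"
  have d: "0 < d" using assms(1) by (simp add: d_def)
  define E where "E = X - s *\<^sub>R 1"
  have XI: "X \<in> M" "s *\<^sub>R 1 \<le> X" "X \<le> t *\<^sub>R 1" using X by (simp_all add: sharp_def interval_def)
  have E: "E \<in> M" "0 \<le> E" "0 \<le> d *\<^sub>R 1 - E" using XI by (simp_all add: E_def d_def algebra_simps)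
  have sE: "star E = E" using E(2) by (rule nonneg_star)
  define D where "D = E * (d *\<^sub>R 1 - E)"
  have "0 \<le> D" unfolding D_def by (rule mult_nonneg_commute[OF E(2,3)]) (simp add: algebra_simps)
  have D: "D \<in> M" "star D = D" using E(1) nonneg_star[OF \<open>0 \<le> D\<close>] by (simp_all add: D_def)
  have "D \<le> 0"
  proof (rule ccontr)
    assume "\<not> D \<le> 0"
    then obtain Q e where Q: "Q \<in> M" "proj Q" "Q \<noteq> 0" "\<And>Z. Z \<in> M \<Longrightarrow> Z * D = D * Z \<Longrightarrow> Z * Q = Q * Z"
      "0 < e" "e *\<^sub>R Q \<le> Q * D * Q"
      using spectral_pos[OF D] by metis
    have EQ: "E * Q = Q * E" using E(1) by (intro Q(4)) (simp_all add: D_def algebra_simps)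
    define k where "k = e / d"
    have k: "0 < k" using Q(5) d by (simp add: k_def)
    have half: "k *\<^sub>R Q \<le> Z" if Z: "0 \<le> Z" "Z * Q = Q * Z" "D \<le> d *\<^sub>R Z" for Z
    proof -
      have "Q * D * Q \<le> Q * (d *\<^sub>R Z) * Q" by (rule conj_mono_sa[OF Z(3)]) (simp add: Q)
      with Q(6) have "e *\<^sub>R Q \<le> d *\<^sub>R (Q * Z * Q)" by simp
      then have "(1 / d) *\<^sub>R e *\<^sub>R Q \<le> (1 / d) *\<^sub>R d *\<^sub>R (Q * Z * Q)" using d by (intro scaleR_left_mono) simp_all
      then have "k *\<^sub>R Q \<le> Q * Z * Q" using d by (simp add: k_def)
      also have "Q * Z * Q = Q * Z" using Q(2) Z(2) by (intro compress_commute)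
      also have "Q * Z \<le> Z"
      proof -
        have "0 \<le> (1 - Q) * Z"
          using Q Z by (intro mult_nonneg_commute) (simp_all add: proj_le_1 algebra_simps)
        then show ?thesis by (simp add: algebra_simps)
      qed
      finally show ?thesis .
    qed
    have "0 \<le> E * E" "0 \<le> (d *\<^sub>R 1 - E) * (d *\<^sub>R 1 - E)"
      using star_mult_nonneg[of E] star_mult_nonneg[of "d *\<^sub>R 1 - E"] sE by simp_all
    then have DE: "D \<le> d *\<^sub>R E" "D \<le> d *\<^sub>R (d *\<^sub>R 1 - E)"
      by (simp_all add: D_def algebra_simps)
    have "(d *\<^sub>R 1 - E) * Q = Q * (d *\<^sub>R 1 - E)" using EQ by (simp add: algebra_simps)
    then have kE: "k *\<^sub>R Q \<le> E" "k *\<^sub>R Q \<le> d *\<^sub>R 1 - E"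
      using half[OF E(2) EQ DE(1)] half[OF E(3) _ DE(2)] by blast+
    define F where "F = X + k *\<^sub>R Q"
    have kQ: "0 \<le> k *\<^sub>R Q" using k Q by (simp add: proj_nonneg scaleR_nonneg_nonneg)
    have FI: "F \<in> interval s t"
      using XI Q kQ kE(2) by (auto simp: interval_def F_def E_def d_def algebra_simps intro: order_trans add_increasing2)
    have "disj s t G F" if G: "G \<in> interval s t" "disj s t G X" for G
      unfolding disj_def
    proof (intro ballI impI)
      fix L assume L: "L \<in> interval s t" "L \<le> G" "L \<le> F"
      define L' where "L' = (1/2) *\<^sub>R (L + s *\<^sub>R 1)"
      have LI: "L \<in> M" "s *\<^sub>R 1 \<le> L" "L \<le> t *\<^sub>R 1" using L(1) by (simp_all add: interval_def)
      have half_le: "(1/2) *\<^sub>R (U + V) \<le> W" if "U + V \<le> W + W" for U V W :: "'a oper"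
      proof -
        have "(1/2) *\<^sub>R (U + V) \<le> (1/2) *\<^sub>R (W + W)" using that by (intro scaleR_left_mono) simp_all
        then show ?thesis by (simp add: scaleR_2[symmetric])
      qed
      have le_half: "W \<le> (1/2) *\<^sub>R (U + V)" if "W + W \<le> U + V" for U V W :: "'a oper"
      proof -
        have "(1/2) *\<^sub>R (W + W) \<le> (1/2) *\<^sub>R (U + V)" using that by (intro scaleR_left_mono) simp_all
        then show ?thesis by (simp add: scaleR_2[symmetric])
      qed
      have "L' \<le> L" unfolding L'_def by (rule half_le) (use LI in simp)
      moreover have "L' \<le> X"
      proof -
        have "F + s *\<^sub>R 1 \<le> X + X" using kE(1) by (simp add: F_def E_def algebra_simps)
        then show ?thesis unfolding L'_def using L(3) by (intro half_le) (meson add_right_mono order_trans)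
      qed
      moreover have "L' \<in> interval s t"
        using LI \<open>L' \<le> L\<close> unfolding interval_def L'_def by (auto intro!: le_half intro: order_trans)
      ultimately have "L' = s *\<^sub>R 1" using G(2) L(2) unfolding disj_def by (meson order_trans)
      moreover have "2 *\<^sub>R L' = L + s *\<^sub>R 1" by (simp add: L'_def)
      ultimately have "L + s *\<^sub>R 1 = s *\<^sub>R 1 + s *\<^sub>R 1" by (simp only: scaleR_2)
      then show "L = s *\<^sub>R 1" by simp
    qed
    then have "F \<le> X" using X FI by (simp add: sharp_def)
    then have "k *\<^sub>R Q = 0" using kQ by (simp add: F_def)
    then show False using k Q(3) by simp
  qed
  then have "D = 0" using \<open>0 \<le> D\<close> by simp
  then have EE: "E * E = d *\<^sub>R E" by (simp add: D_def algebra_simps)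
  show ?thesis
  proof (rule that[of "1 - (1 / d) *\<^sub>R E"])
    have "proj ((1 / d) *\<^sub>R E)" unfolding proj_def using sE EE d by simp
    then show "proj (1 - (1 / d) *\<^sub>R E)" by simp
    show "1 - (1 / d) *\<^sub>R E \<in> M" using E by simp
    have "s *\<^sub>R (1 - (1 / d) *\<^sub>R E) + t *\<^sub>R (1 - (1 - (1 / d) *\<^sub>R E)) = s *\<^sub>R 1 + ((t - s) / d) *\<^sub>R E"
      by (simp add: algebra_simps diff_divide_distrib)
    then show "X = s *\<^sub>R (1 - (1 / d) *\<^sub>R E) + t *\<^sub>R (1 - (1 - (1 / d) *\<^sub>R E))"
      using d by (simp add: d_def E_def)
  qed
qed

lemma two_valued_interval:
  assumes "s \<le> t" "P \<in> M" "proj P"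
  shows "s *\<^sub>R P + t *\<^sub>R (1 - P) \<in> interval s t"
proof -
  have "s *\<^sub>R P + s *\<^sub>R (1 - P) \<le> s *\<^sub>R P + t *\<^sub>R (1 - P)" "s *\<^sub>R P + t *\<^sub>R (1 - P) \<le> t *\<^sub>R P + t *\<^sub>R (1 - P)"
    using assms by (intro add_left_mono add_right_mono scaleR_right_mono proj_nonneg proj_compl; simp)+
  moreover have "c *\<^sub>R P + c *\<^sub>R (1 - P) = c *\<^sub>R 1" for c by (simp add: algebra_simps)
  ultimately show ?thesis using assms by (simp add: interval_def)
qed

text \<open>
  Conversely, let \<open>Q\<close> be a projection, \<open>X = s + (t - s) Q\<close> and \<open>F \<not>\<le> X\<close>. A spectral projection \<open>R\<close> of
  \<open>F - s\<close> is not below \<open>Q\<close>, and \<open>R\<close> minus its meet with \<open>Q\<close> gives an element disjoint from \<open>X\<close> but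
  not from \<open>F\<close>.
\<close>

lemma two_valued_imp_sharp:
  assumes "s < t" and P: "P \<in> M" "proj P"
  shows "sharp s t (s *\<^sub>R P + t *\<^sub>R (1 - P))"
  unfolding sharp_def
proof (intro conjI ballI impI)
  define Q where "Q = 1 - P"
  define d where "d = t - s"
  define X where "X = s *\<^sub>R P + t *\<^sub>R (1 - P)"
  have d: "0 < d" using assms(1) by (simp add: d_def)
  have Q: "Q \<in> M" "proj Q" using P by (simp_all add: Q_def)
  have X: "X = s *\<^sub>R 1 + d *\<^sub>R Q" by (simp add: X_def Q_def d_def algebra_simps)
  show "s *\<^sub>R P + t *\<^sub>R (1 - P) \<in> interval s t" using assms by (intro two_valued_interval) simp_all
  fix F assume F: "F \<in> interval s t"
    and disj: "\<forall>G\<in>interval s t. disj s t G (s *\<^sub>R P + t *\<^sub>R (1 - P)) \<longrightarrow> disj s t G F"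
  define E where "E = F - s *\<^sub>R 1"
  have E: "E \<in> M" "0 \<le> E" "E \<le> d *\<^sub>R 1" using F by (simp_all add: interval_def E_def d_def algebra_simps)
  have sE: "star E = E" using E(2) by (rule nonneg_star)
  have "(1 - Q) * E * (1 - Q) \<le> 0"
  proof (rule nonpos_of_le_scalars)
    fix e :: real assume "0 < e"
    obtain R where R: "R \<in> M" "proj R" "\<And>Z. Z \<in> M \<Longrightarrow> Z * (E - e *\<^sub>R 1) = (E - e *\<^sub>R 1) * Z \<Longrightarrow> Z * R = R * Z"
      "0 \<le> R * (E - e *\<^sub>R 1)" "(1 - R) * (E - e *\<^sub>R 1) \<le> 0"
      by (rule spectral_split[of "E - e *\<^sub>R 1"]) (use E sE in auto)
    have ER: "E * R = R * E" using E(1) by (intro R(3)) (simp_all add: algebra_simps)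
    have "R \<le> Q"
    proof (rule ccontr)
      assume "\<not> R \<le> Q"
      obtain W where W: "W \<in> M" "proj W" "W \<le> R" "W \<le> Q"
        "\<And>Z. Z \<in> M \<Longrightarrow> R * Z = Z \<Longrightarrow> Q * Z = Z \<Longrightarrow> W * Z = Z"
        using proj_meet[OF R(1,2) Q] by blast
      define R' where "R' = R - W"
      have WR: "W * R = W" "R * W = W" using proj_le_iff[OF W(2) R(2)] W(3) by simp_all
      have "proj R'" unfolding proj_def R'_def using W(2) R(2) WR by (simp add: algebra_simps)
      moreover have "R' \<noteq> 0" using \<open>\<not> R \<le> Q\<close> W(4) by (auto simp: R'_def)
      moreover have "R' * W = 0" "R * R' = R'" using W(2) R(2) WR by (simp_all add: R'_def algebra_simps)
      ultimately have R': "R' \<in> M" "proj R'" "R' * W = 0" "R * R' = R'" "R' \<noteq> 0"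
        using W(1) R(1) by (simp_all add: R'_def)
      define m where "m = min e d"
      have m: "0 < m" "m \<le> e" "m \<le> d" using \<open>0 < e\<close> d by (simp_all add: m_def)
      define G where "G = s *\<^sub>R 1 + m *\<^sub>R R'"
      have mR': "0 \<le> m *\<^sub>R R'" "m *\<^sub>R R' \<le> d *\<^sub>R 1" "m *\<^sub>R R' \<le> e *\<^sub>R R"
      proof -
        show "0 \<le> m *\<^sub>R R'" using m R' by (simp add: proj_nonneg scaleR_nonneg_nonneg)
        have "m *\<^sub>R R' \<le> d *\<^sub>R R'" using m R' by (intro scaleR_right_mono proj_nonneg) simp_all
        also have "\<dots> \<le> d *\<^sub>R 1" using d R' by (intro scaleR_left_mono proj_le_1) simp_all
        finally show "m *\<^sub>R R' \<le> d *\<^sub>R 1" .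
        have "m *\<^sub>R R' \<le> e *\<^sub>R R'" using m R' by (intro scaleR_right_mono proj_nonneg) simp_all
        also have "\<dots> \<le> e *\<^sub>R R"
          using \<open>0 < e\<close> proj_le_iff(2)[OF R'(2) R(2)] R'(4) by (intro scaleR_left_mono) simp_all
        finally show "m *\<^sub>R R' \<le> e *\<^sub>R R" .
      qed
      have GI: "G \<in> interval s t" using R' mR' by (simp add: interval_def G_def d_def algebra_simps)
      have "disj s t G X"
        unfolding disj_def
      proof (intro ballI impI)
        fix L assume L: "L \<in> interval s t" "L \<le> G" "L \<le> X"
        define K where "K = L - s *\<^sub>R 1"
        have K: "K \<in> M" "0 \<le> K" "K \<le> m *\<^sub>R R'" "K \<le> d *\<^sub>R Q"
          using L by (simp_all add: interval_def K_def G_def X algebra_simps)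
        have below: "B * K = K" if B: "proj B" and KB: "K \<le> c *\<^sub>R B" for B c
        proof -
          have "(1 - B) * K * (1 - B) \<le> (1 - B) * (c *\<^sub>R B) * (1 - B)"
            using B KB by (intro conj_mono_sa) simp_all
          also have "\<dots> = 0" using B by (simp add: algebra_simps)
          finally have "star (1 - B) * K * (1 - B) = 0"
            using conj_nonneg[OF K(2), of "1 - B"] B by simp
          from compress_eq_0[OF K(2) this] have "K = K * B" by (simp add: algebra_simps)
          then have "star K = star (K * B)" by simp
          then show ?thesis using B nonneg_star[OF K(2)] by simp
        qed
        have "R' * K = K" "Q * K = K" using below R' Q K by blast+
        moreover have "R * K = K" using \<open>R' * K = K\<close> R'(4) by (metis mult.assoc)
        ultimately have "W * K = K" using W(5) K(1) by blast
        then have "K = R' * (W * K)" using \<open>R' * K = K\<close> by simp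
        then have "K = 0" using R'(3) by (simp flip: mult.assoc)
        then show "L = s *\<^sub>R 1" by (simp add: K_def)
      qed
      then have "disj s t G F" using disj GI by (simp add: X_def)
      moreover have "G \<le> F"
      proof -
        have "e *\<^sub>R R \<le> R * E" using R(4) by (simp add: algebra_simps)
        also have "R * E \<le> E"
        proof -
          have "0 \<le> (1 - R) * E"
            using R E ER by (intro mult_nonneg_commute) (simp_all add: proj_le_1 algebra_simps)
          then show ?thesis by (simp add: algebra_simps)
        qed
        finally have "m *\<^sub>R R' \<le> E" using mR'(3) by (rule_tac order_trans)
        then show ?thesis by (simp add: G_def E_def algebra_simps)
      qed
      ultimately have "G = s *\<^sub>R 1" using GI by (simp add: disj_def)
      then show False using m R' by (simp add: G_def)
    qed
    then have QR: "(1 - Q) * R = 0" "R * (1 - Q) = 0"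
      using proj_le_iff[OF R(2) Q(2)] by (simp_all add: algebra_simps)
    have "(1 - R) * E * (1 - R) \<le> e *\<^sub>R (1 - R)"
    proof -
      have "(1 - R) * E * (1 - R) = (1 - R) * E" using R ER by (intro compress_commute) (simp_all add: algebra_simps)
      then show ?thesis using R(5) by (simp add: algebra_simps)
    qed
    also have "\<dots> \<le> e *\<^sub>R 1" using \<open>0 < e\<close> R by (intro scaleR_left_mono proj_le_1) simp_all
    finally have "(1 - Q) * ((1 - R) * E * (1 - R)) * (1 - Q) \<le> e *\<^sub>R (1 - Q)"
      using Q by (intro scalar_compress_le) simp_all
    also have "(1 - Q) * ((1 - R) * E * (1 - R)) * (1 - Q) = ((1 - Q) * (1 - R)) * E * ((1 - R) * (1 - Q))"
      by (simp only: mult.assoc)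
    also have "(1 - Q) * (1 - R) = 1 - Q" using QR(1) by (simp add: right_diff_distrib)
    also have "(1 - R) * (1 - Q) = 1 - Q" using QR(2) by (simp add: left_diff_distrib)
    finally show "(1 - Q) * E * (1 - Q) \<le> e *\<^sub>R 1"
      using scaleR_left_mono[OF proj_le_1[of "1 - Q"], of e] Q \<open>0 < e\<close> by (meson less_imp_le order_trans proj_compl)
  qed
  then have "star (1 - Q) * E * (1 - Q) = 0"
    using conj_nonneg[OF E(2), of "1 - Q"] Q by simp
  from compress_eq_0[OF E(2) this] have EQ: "E = E * Q" by (simp add: algebra_simps)
  then have "star E = star (E * Q)" by simp
  then have "E = Q * E" using sE Q by simp
  then have "E = Q * E * Q" using EQ by simp
  also have "\<dots> \<le> d *\<^sub>R Q" by (rule scalar_compress_le[OF Q(2) E(3)])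
  finally have "F \<le> X" by (simp add: E_def X algebra_simps)
  then show "F \<le> s *\<^sub>R P + t *\<^sub>R (1 - P)" by (simp add: X_def)
qed

end

text \<open>
  The compression of \<open>X\<close> to \<open>P\<close> is visible in the order relations between \<open>X\<close> and two-valued elements.
\<close>

lemma compress_le_iff:
  assumes P: "proj P" and X: "0 \<le> X" and c: "0 < c"
  shows "P * X * P \<le> c *\<^sub>R P \<longleftrightarrow> (\<forall>c'>c. \<exists>t>c'. X \<le> c' *\<^sub>R P + t *\<^sub>R (1 - P))"
proof
  assume le: "P * X * P \<le> c *\<^sub>R P"
  show "\<forall>c'>c. \<exists>t>c'. X \<le> c' *\<^sub>R P + t *\<^sub>R (1 - P)"
  proof (intro allI impI)
    fix c' assume "c < c'"
    define \<theta> where "\<theta> = c' / c - 1"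
    have \<theta>: "0 < \<theta>" "(1 + \<theta>) * c = c'" using c \<open>c < c'\<close> by (simp_all add: \<theta>_def)
    define K where "K = (1 + 1 / \<theta>) * norm X"
    have "X \<le> c' *\<^sub>R P + K *\<^sub>R (1 - P)"
      using block_bound_scalar[OF P X \<theta>(1) le] \<theta>(2) by (simp add: K_def)
    also have "\<dots> \<le> c' *\<^sub>R P + max K (c' + 1) *\<^sub>R (1 - P)"
      using P by (intro add_left_mono scaleR_right_mono proj_nonneg) simp_all
    finally show "\<exists>t>c'. X \<le> c' *\<^sub>R P + t *\<^sub>R (1 - P)" by (intro exI[of _ "max K (c' + 1)"]) simp
  qed
next
  assume all: "\<forall>c'>c. \<exists>t>c'. X \<le> c' *\<^sub>R P + t *\<^sub>R (1 - P)"
  have "P * X * P - c *\<^sub>R P \<le> 0"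
  proof (rule nonpos_of_le_scalars)
    fix e :: real assume "0 < e"
    then obtain t where "X \<le> (c + e) *\<^sub>R P + t *\<^sub>R (1 - P)" using all[rule_format, of "c + e"] by auto
    then have "P * X * P \<le> P * ((c + e) *\<^sub>R P + t *\<^sub>R (1 - P)) * P" using P by (intro conj_mono_sa) simp_all
    also have "\<dots> = (c + e) *\<^sub>R P" by (rule two_valued_compress[OF P])
    finally have "P * X * P - c *\<^sub>R P \<le> e *\<^sub>R P" by (simp add: algebra_simps)
    also have "\<dots> \<le> e *\<^sub>R 1" using \<open>0 < e\<close> P by (intro scaleR_left_mono proj_le_1) simp_all
    finally show "P * X * P - c *\<^sub>R P \<le> e *\<^sub>R 1" .
  qed
  then show "P * X * P \<le> c *\<^sub>R P" by simp
qed

text \<open>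
  Two-valued elements with a common lower value, or a common upper value, are ordered like their projections.
\<close>

lemma two_valued_low_le:
  assumes P: "proj P" and Q: "proj Q" and le: "s *\<^sub>R P + t *\<^sub>R (1 - P) \<le> s *\<^sub>R Q + t' *\<^sub>R (1 - Q)" and "s < t"
  shows "Q \<le> P"
proof -
  have "Q * (s *\<^sub>R P + t *\<^sub>R (1 - P)) * Q \<le> Q * (s *\<^sub>R Q + t' *\<^sub>R (1 - Q)) * Q"
    using Q le by (intro conj_mono_sa) simp_all
  then have "s *\<^sub>R Q + (t - s) *\<^sub>R (Q * (1 - P) * Q) \<le> s *\<^sub>R Q"
    unfolding two_valued_compress[OF Q] using Q by (simp add: algebra_simps)
  then have "(t - s) *\<^sub>R (Q * (1 - P) * Q) \<le> 0" by simp
  then have "0 \<le> (t - s) *\<^sub>R (- (Q * (1 - P) * Q))" by simp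
  then have "Q * (1 - P) * Q \<le> 0" using nonneg_scaleD[of "t - s"] \<open>s < t\<close> by fastforce
  then have "star Q * (1 - P) * Q = 0"
    using conj_nonneg[OF proj_nonneg[OF proj_compl[OF P]], of Q] Q by simp
  from compress_eq_0[OF proj_nonneg[OF proj_compl[OF P]] this] have "P * Q = Q" by (simp add: algebra_simps)
  then show ?thesis using proj_le_iff(2)[OF Q P] by simp
qed

lemma two_valued_high_le:
  assumes P: "proj P" and Q: "proj Q" and le: "s *\<^sub>R P + t *\<^sub>R (1 - P) \<le> s' *\<^sub>R Q + t *\<^sub>R (1 - Q)" and "s' < t"
  shows "Q \<le> P"
proof -
  have "(- t) *\<^sub>R (1 - Q) + (- s') *\<^sub>R (1 - (1 - Q)) \<le> (- t) *\<^sub>R (1 - P) + (- s) *\<^sub>R (1 - (1 - P))"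
    using le_imp_neg_le[OF le] by (simp add: algebra_simps)
  from two_valued_low_le[OF proj_compl[OF Q] proj_compl[OF P] this] have "1 - P \<le> 1 - Q" using \<open>s' < t\<close> by simp
  then show ?thesis by simp
qed

lemma two_valued_mono:
  assumes P: "proj P" and Q: "proj Q" and "Q \<le> P" "s \<le> s'" "t \<le> t'" "s \<le> t"
  shows "s *\<^sub>R P + t *\<^sub>R (1 - P) \<le> s' *\<^sub>R Q + t' *\<^sub>R (1 - Q)"
proof -
  have "s *\<^sub>R P + t *\<^sub>R (1 - P) = t *\<^sub>R 1 - (t - s) *\<^sub>R P" by (simp add: algebra_simps)
  also have "\<dots> \<le> t *\<^sub>R 1 - (t - s) *\<^sub>R Q" using assms by (intro diff_left_mono scaleR_left_mono) simp_all
  also have "\<dots> = s *\<^sub>R Q + t *\<^sub>R (1 - Q)" by (simp add: algebra_simps)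
  also have "\<dots> \<le> s' *\<^sub>R Q + t' *\<^sub>R (1 - Q)" using assms by (intro add_mono scaleR_right_mono proj_nonneg) simp_all
  finally show ?thesis .
qed

section \<open>Order isomorphisms that fix the scalars are additive\<close>

lemma scaleCo_mult [simp]: "scaleCo c S * T = scaleCo c (S * T)" "S * scaleCo c T = scaleCo c (S * T)"
  by (auto intro: oper_eqI)

lemma scaleCo_distrib: "scaleCo c (S + T) = scaleCo c S + scaleCo c T" "scaleCo c (S - T) = scaleCo c S - scaleCo c T"
  "scaleCo (c + d) T = scaleCo c T + scaleCo d T" "scaleCo c (scaleCo d T) = scaleCo (c * d) T"
  "scaleCo c (r *\<^sub>R T) = r *\<^sub>R scaleCo c T" "scaleCo c (- T) = - scaleCo c T"
  by (auto intro!: oper_eqI simp: scaleC_add_right scaleC_add_left scaleC_scaleC scaleC_diff scaleC_scaleR scaleC_minus)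

lemma two_valued_low_le_iff:
  assumes "proj P" "proj Q" "s < t" "t \<le> t'"
  shows "s *\<^sub>R P + t *\<^sub>R (1 - P) \<le> s *\<^sub>R Q + t' *\<^sub>R (1 - Q) \<longleftrightarrow> Q \<le> P"
  using two_valued_low_le[OF assms(1,2) _ assms(3)] two_valued_mono[OF assms(1,2) _ _ assms(4), of s s] assms(3) by auto

lemma two_valued_high_le_iff:
  assumes "proj P" "proj Q" "s \<le> s'" "s' < t"
  shows "s *\<^sub>R P + t *\<^sub>R (1 - P) \<le> s' *\<^sub>R Q + t *\<^sub>R (1 - Q) \<longleftrightarrow> Q \<le> P"
  using two_valued_high_le[OF assms(1,2) _ assms(4)] two_valued_mono[OF assms(1,2) _ assms(3), of t t] assms(3,4) by auto

text \<open>
  The hypotheses on \<open>\<phi>\<close> mention the order only. They are symmetric in \<open>M\<close> and \<open>N\<close>, so that a one-sided estimate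
  for \<open>\<phi>\<close> also holds for its inverse.
\<close>

locale cone_order_iso = A: aw_star M + B: aw_star N
  for M N :: "'h :: chilbert_space oper set" +
  fixes \<phi> :: "'h oper \<Rightarrow> 'h oper"
  assumes \<phi>_mem: "X \<in> M \<Longrightarrow> pd X \<Longrightarrow> \<phi> X \<in> N" and \<phi>_pd: "X \<in> M \<Longrightarrow> pd X \<Longrightarrow> pd (\<phi> X)"
    and \<phi>_surj: "Y \<in> N \<Longrightarrow> pd Y \<Longrightarrow> \<exists>X\<in>M. pd X \<and> \<phi> X = Y"
    and \<phi>_le: "X \<in> M \<Longrightarrow> pd X \<Longrightarrow> Y \<in> M \<Longrightarrow> pd Y \<Longrightarrow> \<phi> X \<le> \<phi> Y \<longleftrightarrow> X \<le> Y"
    and \<phi>_scalar: "0 < t \<Longrightarrow> \<phi> (t *\<^sub>R 1) = t *\<^sub>R 1"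
begin

lemma \<phi>_inj: "X \<in> M \<Longrightarrow> pd X \<Longrightarrow> Y \<in> M \<Longrightarrow> pd Y \<Longrightarrow> \<phi> X = \<phi> Y \<Longrightarrow> X = Y"
  by (rule antisym) (simp_all add: \<phi>_le[symmetric])

lemma interval_pd: "0 < s \<Longrightarrow> X \<in> A.interval s t \<Longrightarrow> X \<in> M \<and> pd X"
  "0 < s \<Longrightarrow> X \<in> B.interval s t \<Longrightarrow> X \<in> N \<and> pd X"
  by (auto simp: A.interval_def B.interval_def intro: pdI)

lemma \<phi>_interval:
  assumes "0 < s" "s < t" "X \<in> M" "pd X"
  shows "\<phi> X \<in> B.interval s t \<longleftrightarrow> X \<in> A.interval s t"
  using assms \<phi>_le[of "s *\<^sub>R 1" X] \<phi>_le[of X "t *\<^sub>R 1"]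
  by (simp add: A.interval_def B.interval_def \<phi>_mem \<phi>_scalar)

lemma \<phi>_interval_onto:
  assumes "0 < s" "s < t" "Y \<in> B.interval s t"
  obtains X where "X \<in> A.interval s t" "\<phi> X = Y"
proof -
  obtain X where "X \<in> M" "pd X" "\<phi> X = Y"
    using \<phi>_surj interval_pd(2)[OF assms(1,3)] by blast
  then show ?thesis using that assms \<phi>_interval by blast
qed

text \<open>
  Disjointness and sharpness are defined by the order of the interval alone, so they are invariant.
\<close>

lemma \<phi>_disj:
  assumes "0 < s" "s < t" "G \<in> A.interval s t" "X \<in> A.interval s t"
  shows "B.disj s t (\<phi> G) (\<phi> X) \<longleftrightarrow> A.disj s t G X"
proof -
  note pd = interval_pd(1)[OF assms(1)]
  have eq: "\<phi> L = s *\<^sub>R 1 \<longleftrightarrow> L = s *\<^sub>R 1" if "L \<in> A.interval s t" for L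
    using \<phi>_inj[of L "s *\<^sub>R 1"] \<phi>_scalar[OF assms(1)] pd[OF that] assms(1) by auto
  show ?thesis
  proof
    assume l: "B.disj s t (\<phi> G) (\<phi> X)"
    show "A.disj s t G X" unfolding A.disj_def
    proof (intro ballI impI)
      fix L assume L: "L \<in> A.interval s t" "L \<le> G" "L \<le> X"
      then have "\<phi> L \<in> B.interval s t" "\<phi> L \<le> \<phi> G" "\<phi> L \<le> \<phi> X"
        using pd[OF L(1)] pd[OF assms(3)] pd[OF assms(4)] assms by (simp_all add: \<phi>_interval \<phi>_le)
      then show "L = s *\<^sub>R 1" using l eq[OF L(1)] unfolding B.disj_def by blast
    qed
  next
    assume r: "A.disj s t G X"
    show "B.disj s t (\<phi> G) (\<phi> X)" unfolding B.disj_def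
    proof (intro ballI impI)
      fix K assume K: "K \<in> B.interval s t" "K \<le> \<phi> G" "K \<le> \<phi> X"
      obtain L where L: "L \<in> A.interval s t" "\<phi> L = K" using \<phi>_interval_onto[OF assms(1,2) K(1)] .
      then have "L \<le> G" "L \<le> X"
        using K(2,3) pd[OF L(1)] pd[OF assms(3)] pd[OF assms(4)] by (simp_all add: \<phi>_le[symmetric])
      then show "K = s *\<^sub>R 1" using r eq[OF L(1)] L unfolding A.disj_def by blast
    qed
  qed
qed

lemma \<phi>_sharp:
  assumes "0 < s" "s < t" "X \<in> A.interval s t"
  shows "B.sharp s t (\<phi> X) \<longleftrightarrow> A.sharp s t X"
proof -
  note pd = interval_pd(1)[OF assms(1)]
  note st = assms(1,2)
  have le: "\<phi> F \<le> \<phi> X \<longleftrightarrow> F \<le> X" if "F \<in> A.interval s t" for F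
    using pd[OF that] pd[OF assms(3)] by (simp add: \<phi>_le)
  have all: "(\<forall>G\<in>B.interval s t. Q G) \<longleftrightarrow> (\<forall>G\<in>A.interval s t. Q (\<phi> G))" for Q
  proof
    assume "\<forall>G\<in>B.interval s t. Q G"
    then show "\<forall>G\<in>A.interval s t. Q (\<phi> G)" using \<phi>_interval[OF st] pd by blast
  next
    assume r: "\<forall>G\<in>A.interval s t. Q (\<phi> G)"
    show "\<forall>G\<in>B.interval s t. Q G"
    proof
      fix G assume "G \<in> B.interval s t"
      then obtain G' where "G' \<in> A.interval s t" "\<phi> G' = G" using \<phi>_interval_onto[OF st] by blast
      then show "Q G" using r by blast
    qed
  qed
  have "\<phi> X \<in> B.interval s t" using \<phi>_interval[OF st] pd[OF assms(3)] assms(3) by blast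
  then show ?thesis
    unfolding A.sharp_def B.sharp_def all using assms(3) by (simp add: \<phi>_disj[OF st] le cong: ball_cong)
qed

text \<open>
  The projection on which the image of \<open>s P + t (1 - P)\<close> takes its lower value.
\<close>

definition \<tau>' :: "real \<Rightarrow> real \<Rightarrow> 'h oper \<Rightarrow> 'h oper"
  where "\<tau>' s t P = (SOME Q. Q \<in> N \<and> proj Q \<and> \<phi> (s *\<^sub>R P + t *\<^sub>R (1 - P)) = s *\<^sub>R Q + t *\<^sub>R (1 - Q))"

lemma \<tau>':
  assumes "0 < s" "s < t" "P \<in> M" "proj P"
  shows "\<tau>' s t P \<in> N" "proj (\<tau>' s t P)" "\<phi> (s *\<^sub>R P + t *\<^sub>R (1 - P)) = s *\<^sub>R \<tau>' s t P + t *\<^sub>R (1 - \<tau>' s t P)"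
proof -
  have "s *\<^sub>R P + t *\<^sub>R (1 - P) \<in> A.interval s t" using assms by (intro A.two_valued_interval) simp_all
  then have "B.sharp s t (\<phi> (s *\<^sub>R P + t *\<^sub>R (1 - P)))"
    using assms by (simp only: \<phi>_sharp A.two_valued_imp_sharp)
  then obtain Q where "Q \<in> N" "proj Q" "\<phi> (s *\<^sub>R P + t *\<^sub>R (1 - P)) = s *\<^sub>R Q + t *\<^sub>R (1 - Q)"
    by (rule B.sharp_imp_two_valued[OF assms(2)])
  then have "\<exists>Q. Q \<in> N \<and> proj Q \<and> \<phi> (s *\<^sub>R P + t *\<^sub>R (1 - P)) = s *\<^sub>R Q + t *\<^sub>R (1 - Q)" by blast
  from someI_ex[OF this]
  show "\<tau>' s t P \<in> N" "proj (\<tau>' s t P)" "\<phi> (s *\<^sub>R P + t *\<^sub>R (1 - P)) = s *\<^sub>R \<tau>' s t P + t *\<^sub>R (1 - \<tau>' s t P)"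
    unfolding \<tau>'_def by blast+
qed

lemma \<tau>'_surj:
  assumes "0 < s" "s < t" "Q \<in> N" "proj Q"
  obtains P where "P \<in> M" "proj P" "\<tau>' s t P = Q"
proof -
  have "s *\<^sub>R Q + t *\<^sub>R (1 - Q) \<in> B.interval s t" using assms by (intro B.two_valued_interval) simp_all
  then obtain X where X: "X \<in> A.interval s t" "\<phi> X = s *\<^sub>R Q + t *\<^sub>R (1 - Q)"
    using \<phi>_interval_onto[OF assms(1,2)] by blast
  then have "A.sharp s t X" using \<phi>_sharp[OF assms(1,2) X(1)] B.two_valued_imp_sharp[OF assms(2-4)] by simp
  then obtain P where P: "P \<in> M" "proj P" "X = s *\<^sub>R P + t *\<^sub>R (1 - P)"
    by (rule A.sharp_imp_two_valued[OF assms(2)])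
  have "s *\<^sub>R \<tau>' s t P + t *\<^sub>R (1 - \<tau>' s t P) = s *\<^sub>R Q + t *\<^sub>R (1 - Q)"
    using \<tau>'(3)[OF assms(1,2) P(1,2)] X P by simp
  then have "(t - s) *\<^sub>R \<tau>' s t P = (t - s) *\<^sub>R Q" by (simp add: algebra_simps)
  then have "\<tau>' s t P = Q" using assms(2) by simp
  then show ?thesis using that P by blast
qed

lemma \<tau>'_le_low:
  assumes "0 < s" "s < t" "s < t'" "P \<in> M" "proj P" "Q \<in> M" "proj Q" "t \<le> t'"
  shows "\<tau>' s t' Q \<le> \<tau>' s t P \<longleftrightarrow> Q \<le> P"
proof -
  have "pd (s *\<^sub>R P + t *\<^sub>R (1 - P))" "pd (s *\<^sub>R Q + t' *\<^sub>R (1 - Q))"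
    using assms by (intro pd_two_valued; simp)+
  then have "s *\<^sub>R \<tau>' s t P + t *\<^sub>R (1 - \<tau>' s t P) \<le> s *\<^sub>R \<tau>' s t' Q + t' *\<^sub>R (1 - \<tau>' s t' Q)
      \<longleftrightarrow> s *\<^sub>R P + t *\<^sub>R (1 - P) \<le> s *\<^sub>R Q + t' *\<^sub>R (1 - Q)"
    using assms \<phi>_le[of "s *\<^sub>R P + t *\<^sub>R (1 - P)" "s *\<^sub>R Q + t' *\<^sub>R (1 - Q)"] by (simp add: \<tau>'(3) del: scaleR_right_diff_distrib)
  then show ?thesis
    unfolding two_valued_low_le_iff[OF assms(5,7,2,8)]
      two_valued_low_le_iff[OF \<tau>'(2)[OF assms(1,2,4,5)] \<tau>'(2)[OF assms(1,3,6,7)] assms(2,8)] .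
qed

lemma \<tau>'_le_high:
  assumes "0 < s" "s < t" "s' < t" "P \<in> M" "proj P" "Q \<in> M" "proj Q" "s \<le> s'"
  shows "\<tau>' s' t Q \<le> \<tau>' s t P \<longleftrightarrow> Q \<le> P"
proof -
  have s': "0 < s'" using assms by simp
  have "pd (s *\<^sub>R P + t *\<^sub>R (1 - P))" "pd (s' *\<^sub>R Q + t *\<^sub>R (1 - Q))"
    using assms by (intro pd_two_valued; simp)+
  then have "s *\<^sub>R \<tau>' s t P + t *\<^sub>R (1 - \<tau>' s t P) \<le> s' *\<^sub>R \<tau>' s' t Q + t *\<^sub>R (1 - \<tau>' s' t Q)
      \<longleftrightarrow> s *\<^sub>R P + t *\<^sub>R (1 - P) \<le> s' *\<^sub>R Q + t *\<^sub>R (1 - Q)"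
    using assms s' \<phi>_le[of "s *\<^sub>R P + t *\<^sub>R (1 - P)" "s' *\<^sub>R Q + t *\<^sub>R (1 - Q)"] by (simp add: \<tau>'(3) del: scaleR_right_diff_distrib)
  then show ?thesis
    unfolding two_valued_high_le_iff[OF assms(5,7,8,3)]
      two_valued_high_le_iff[OF \<tau>'(2)[OF assms(1,2,4,5)] \<tau>'(2)[OF s' assms(3,6,7)] assms(8,3)] .
qed

text \<open>
  An order embedding of the projections that compares correctly with a second one must coincide with it.
\<close>

lemma eq_of_le_iff:
  assumes "0 < s" "s < t" "0 < s'" "s' < t'"
    and iff: "\<And>P Q. P \<in> M \<Longrightarrow> proj P \<Longrightarrow> Q \<in> M \<Longrightarrow> proj Q \<Longrightarrow> \<tau>' s t Q \<le> \<tau>' s' t' P \<longleftrightarrow> Q \<le> P"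
    and refl: "\<And>P Q. P \<in> M \<Longrightarrow> proj P \<Longrightarrow> Q \<in> M \<Longrightarrow> proj Q \<Longrightarrow> \<tau>' s t Q \<le> \<tau>' s t P \<longleftrightarrow> Q \<le> P"
    and P: "P \<in> M" "proj P"
  shows "\<tau>' s t P = \<tau>' s' t' P"
proof (rule antisym)
  show "\<tau>' s t P \<le> \<tau>' s' t' P" using iff[OF P P] by simp
  obtain Q where Q: "Q \<in> M" "proj Q" "\<tau>' s t Q = \<tau>' s' t' P"
    using \<tau>'_surj[OF assms(1,2) \<tau>'(1,2)[OF assms(3,4) P]] by blast
  then have "Q \<le> P" using iff[OF P Q(1,2)] by simp
  then show "\<tau>' s' t' P \<le> \<tau>' s t P" using refl[OF P Q(1,2)] Q(3) by simp
qed

text \<open>The projection part of the image does not depend on the two values.\<close>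

lemma \<tau>'_low: "0 < s \<Longrightarrow> s < t \<Longrightarrow> t \<le> t' \<Longrightarrow> P \<in> M \<Longrightarrow> proj P \<Longrightarrow> \<tau>' s t' P = \<tau>' s t P"
  by (rule eq_of_le_iff) (simp_all add: \<tau>'_le_low)

lemma \<tau>'_high: "0 < s \<Longrightarrow> s \<le> s' \<Longrightarrow> s' < t \<Longrightarrow> P \<in> M \<Longrightarrow> proj P \<Longrightarrow> \<tau>' s' t P = \<tau>' s t P"
  by (rule eq_of_le_iff) (simp_all add: \<tau>'_le_high)

definition \<tau> :: "'h oper \<Rightarrow> 'h oper" where "\<tau> P = \<tau>' 1 2 P"

lemma \<tau>'_eq:
  assumes "0 < s" "s < t" "P \<in> M" "proj P"
  shows "\<tau>' s t P = \<tau> P"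
proof -
  define T where "T = max t 2"
  define S where "S = min s 1"
  have "\<tau>' s t P = \<tau>' s T P" using assms by (intro \<tau>'_low[symmetric]) (simp_all add: T_def)
  also have "\<dots> = \<tau>' S T P" using assms by (intro \<tau>'_high) (simp_all add: T_def S_def)
  also have "\<dots> = \<tau>' 1 T P" using assms by (intro \<tau>'_high[symmetric]) (simp_all add: T_def S_def)
  also have "\<dots> = \<tau>' 1 2 P" using assms by (intro \<tau>'_low) (simp_all add: T_def)
  finally show ?thesis by (simp add: \<tau>_def)
qed

lemma
  assumes "P \<in> M" "proj P"
  shows \<tau>_mem: "\<tau> P \<in> N" and \<tau>_proj: "proj (\<tau> P)"
    and \<phi>_two_valued: "0 < s \<Longrightarrow> s < t \<Longrightarrow> \<phi> (s *\<^sub>R P + t *\<^sub>R (1 - P)) = s *\<^sub>R \<tau> P + t *\<^sub>R (1 - \<tau> P)"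
  using \<tau>'[of 1 2 P] \<tau>'(3)[of s t P] \<tau>'_eq[of s t P] assms by (simp_all add: \<tau>_def)

lemma \<tau>_surj: "Q \<in> N \<Longrightarrow> proj Q \<Longrightarrow> \<exists>P\<in>M. proj P \<and> \<tau> P = Q"
  using \<tau>'_surj[of 1 2 Q] unfolding \<tau>_def by (metis one_less_numeral_iff semiring_norm(76) zero_less_one)

text \<open>
  Upper bounds for compressions are order relations with two-valued elements, and \<open>\<phi>\<close> acts on these through
  \<open>\<tau>\<close>.
\<close>

lemma \<tau>_compress_iff:
  assumes P: "P \<in> M" "proj P" and X: "X \<in> M" "pd X" and c: "0 < c"
  shows "\<tau> P * \<phi> X * \<tau> P \<le> c *\<^sub>R \<tau> P \<longleftrightarrow> P * X * P \<le> c *\<^sub>R P"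
proof -
  have "\<phi> X \<le> s *\<^sub>R \<tau> P + t *\<^sub>R (1 - \<tau> P) \<longleftrightarrow> X \<le> s *\<^sub>R P + t *\<^sub>R (1 - P)" if "c < s" "s < t" for s t
  proof -
    have "\<phi> (s *\<^sub>R P + t *\<^sub>R (1 - P)) = s *\<^sub>R \<tau> P + t *\<^sub>R (1 - \<tau> P)"
      using that c P by (intro \<phi>_two_valued) simp_all
    moreover have "\<phi> X \<le> \<phi> (s *\<^sub>R P + t *\<^sub>R (1 - P)) \<longleftrightarrow> X \<le> s *\<^sub>R P + t *\<^sub>R (1 - P)"
      using that c P X by (intro \<phi>_le pd_two_valued) simp_all
    ultimately show ?thesis by simp
  qed
  then show ?thesis
    unfolding compress_le_iff[OF \<tau>_proj[OF P] pd_nonneg[OF \<phi>_pd[OF X]] c] compress_le_iff[OF P(2) pd_nonneg[OF X(2)] c]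
    by meson
qed

lemma narrow_pd:
  assumes P0: "P0 \<in> N" "proj P0" "P0 \<noteq> 0" and T: "T \<in> N" "pd T" and "0 < e"
  obtains P c where "P \<in> N" "proj P" "P \<noteq> 0" "P \<le> P0" "0 < c" "(c - e) *\<^sub>R P \<le> P * T * P" "P * T * P \<le> c *\<^sub>R P"
proof -
  obtain P k where P: "P \<in> N" "proj P" "P \<noteq> 0" "P \<le> P0" "k *\<^sub>R P \<le> P * T * P" "P * T * P \<le> (k + e) *\<^sub>R P"
    using B.narrow_proj[OF P0 T(1) pd_star[OF T(2)] assms(6)] by blast
  obtain m where m: "0 < m" "m *\<^sub>R 1 \<le> T" using T by (auto simp: pd_def)
  have "m *\<^sub>R P \<le> (k + e) *\<^sub>R P" by (rule order_trans[OF scalar_compress_ge[OF P(2) m(2)] P(6)])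
  then have "m \<le> k + e" by (rule proj_scale_le[OF P(2,3)])
  then show ?thesis using that[of P "k + e"] P m by simp
qed

text \<open>
  Where the compressions of \<open>\<phi> X\<close> and \<open>\<phi> Y\<close> to a projection are almost scalar, an upper bound for
  the compression of \<open>X + Y\<close> transfers to \<open>\<phi> (X + Y)\<close>.
\<close>

lemma \<phi>_subadditive:
  assumes X: "X \<in> M" "pd X" and Y: "Y \<in> M" "pd Y"
  shows "\<phi> (X + Y) \<le> \<phi> X + \<phi> Y"
proof (rule ccontr)
  have XY: "X + Y \<in> M" "pd (X + Y)" using X Y by (simp_all add: pd_add pd_nonneg)
  note im = \<phi>_mem[OF X] \<phi>_pd[OF X] \<phi>_mem[OF Y] \<phi>_pd[OF Y] \<phi>_mem[OF XY] \<phi>_pd[OF XY]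
  define D where "D = \<phi> (X + Y) - (\<phi> X + \<phi> Y)"
  assume "\<not> \<phi> (X + Y) \<le> \<phi> X + \<phi> Y"
  then have "\<not> D \<le> 0" by (simp add: D_def)
  moreover have "D \<in> N" "star D = D" using im by (simp_all add: D_def)
  ultimately obtain Q0 \<delta> where Q0: "Q0 \<in> N" "proj Q0" "Q0 \<noteq> 0" and \<delta>: "0 < \<delta>" "\<delta> *\<^sub>R Q0 \<le> Q0 * D * Q0"
    using B.spectral_pos[of D] by metis
  have \<eta>: "0 < \<delta> / 3" using \<delta> by simp
  obtain Q1 a where Q1: "Q1 \<in> N" "proj Q1" "Q1 \<noteq> 0" "Q1 \<le> Q0" and a: "0 < a" "(a - \<delta> / 3) *\<^sub>R Q1 \<le> Q1 * \<phi> X * Q1"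
    "Q1 * \<phi> X * Q1 \<le> a *\<^sub>R Q1" using narrow_pd[OF Q0 im(1,2) \<eta>] .
  obtain Q b where Q: "Q \<in> N" "proj Q" "Q \<noteq> 0" "Q \<le> Q1" and b: "0 < b" "(b - \<delta> / 3) *\<^sub>R Q \<le> Q * \<phi> Y * Q"
    "Q * \<phi> Y * Q \<le> b *\<^sub>R Q" using narrow_pd[OF Q1(1-3) im(3,4) \<eta>] .
  have "Q \<le> Q0" using Q(4) Q1(4) by (rule order_trans)
  obtain P where P: "P \<in> M" "proj P" "\<tau> P = Q" using \<tau>_surj[OF Q(1,2)] by blast
  have "P * X * P \<le> a *\<^sub>R P" "P * Y * P \<le> b *\<^sub>R P"
    using \<tau>_compress_iff[OF P(1,2) X a(1)] \<tau>_compress_iff[OF P(1,2) Y b(1)] P(3) b(3)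
      compress_sub_le[OF Q(2) Q1(2) Q(4) a(3)] by simp_all
  then have "P * X * P + P * Y * P \<le> a *\<^sub>R P + b *\<^sub>R P" by (rule add_mono)
  then have "P * (X + Y) * P \<le> (a + b) *\<^sub>R P" by (simp add: distrib_left distrib_right scaleR_add_left)
  then have upper: "Q * \<phi> (X + Y) * Q \<le> (a + b) *\<^sub>R Q"
    using \<tau>_compress_iff[OF P(1,2) XY, of "a + b"] a b P(3) by simp
  have "\<delta> *\<^sub>R Q + ((a - \<delta> / 3) *\<^sub>R Q + (b - \<delta> / 3) *\<^sub>R Q) \<le> Q * D * Q + (Q * \<phi> X * Q + Q * \<phi> Y * Q)"
    by (intro add_mono compress_sub_ge[OF Q(2) Q0(2) \<open>Q \<le> Q0\<close> \<delta>(2)] compress_sub_ge[OF Q(2) Q1(2) Q(4) a(2)] b(2))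
  also have "\<dots> = Q * \<phi> (X + Y) * Q" by (simp add: D_def algebra_simps)
  finally have "\<delta> *\<^sub>R Q + ((a - \<delta> / 3) *\<^sub>R Q + (b - \<delta> / 3) *\<^sub>R Q) \<le> (a + b) *\<^sub>R Q" using upper by (rule order_trans)
  then have "(\<delta> + ((a - \<delta> / 3) + (b - \<delta> / 3))) *\<^sub>R Q \<le> (a + b) *\<^sub>R Q" by (simp only: scaleR_add_left)
  then have "\<delta> + ((a - \<delta> / 3) + (b - \<delta> / 3)) \<le> a + b" by (rule proj_scale_le[OF Q(2,3)])
  then show False using \<delta>(1) by simp
qed

text \<open>
  The same argument as for sums, with one almost scalar compression.
\<close>

lemma \<phi>_scale_le:
  assumes X: "X \<in> M" "pd X" and "0 < r"
  shows "\<phi> (r *\<^sub>R X) \<le> r *\<^sub>R \<phi> X"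
proof (rule ccontr)
  have rX: "r *\<^sub>R X \<in> M" "pd (r *\<^sub>R X)" using X \<open>0 < r\<close> by (simp_all add: pd_scale)
  note im = \<phi>_mem[OF X] \<phi>_pd[OF X] \<phi>_mem[OF rX] \<phi>_pd[OF rX]
  define D where "D = \<phi> (r *\<^sub>R X) - r *\<^sub>R \<phi> X"
  assume "\<not> \<phi> (r *\<^sub>R X) \<le> r *\<^sub>R \<phi> X"
  then have "\<not> D \<le> 0" by (simp add: D_def)
  moreover have "D \<in> N" "star D = D" using im by (simp_all add: D_def)
  ultimately obtain Q0 \<delta> where Q0: "Q0 \<in> N" "proj Q0" "Q0 \<noteq> 0" and \<delta>: "0 < \<delta>" "\<delta> *\<^sub>R Q0 \<le> Q0 * D * Q0"
    using B.spectral_pos[of D] by metis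
  have \<eta>: "0 < \<delta> / (2 * r)" using \<delta> \<open>0 < r\<close> by simp
  obtain Q a where Q: "Q \<in> N" "proj Q" "Q \<noteq> 0" "Q \<le> Q0" and a: "0 < a" "(a - \<delta> / (2 * r)) *\<^sub>R Q \<le> Q * \<phi> X * Q"
    "Q * \<phi> X * Q \<le> a *\<^sub>R Q" using narrow_pd[OF Q0 im(1,2) \<eta>] .
  obtain P where P: "P \<in> M" "proj P" "\<tau> P = Q" using \<tau>_surj[OF Q(1,2)] by blast
  have "P * X * P \<le> a *\<^sub>R P" using \<tau>_compress_iff[OF P(1,2) X a(1)] P(3) a(3) by simp
  then have "r *\<^sub>R (P * X * P) \<le> r *\<^sub>R a *\<^sub>R P" using \<open>0 < r\<close> by (intro scaleR_left_mono) simp_all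
  then have "P * (r *\<^sub>R X) * P \<le> (r * a) *\<^sub>R P" by simp
  then have upper: "Q * \<phi> (r *\<^sub>R X) * Q \<le> (r * a) *\<^sub>R Q"
    using \<tau>_compress_iff[OF P(1,2) rX, of "r * a"] a \<open>0 < r\<close> P(3) by simp
  have "\<delta> *\<^sub>R Q + r *\<^sub>R (a - \<delta> / (2 * r)) *\<^sub>R Q \<le> Q * D * Q + r *\<^sub>R (Q * \<phi> X * Q)"
    using \<open>0 < r\<close> by (intro add_mono compress_sub_ge[OF Q(2) Q0(2) Q(4) \<delta>(2)] scaleR_left_mono a(2)) simp
  also have "\<dots> = Q * \<phi> (r *\<^sub>R X) * Q" by (simp add: D_def algebra_simps)
  finally have "\<delta> *\<^sub>R Q + r *\<^sub>R (a - \<delta> / (2 * r)) *\<^sub>R Q \<le> (r * a) *\<^sub>R Q" using upper by (rule order_trans)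
  then have "(\<delta> + r * (a - \<delta> / (2 * r))) *\<^sub>R Q \<le> (r * a) *\<^sub>R Q" by (simp only: scaleR_add_left scaleR_scaleR)
  then have "\<delta> + r * (a - \<delta> / (2 * r)) \<le> r * a" by (rule proj_scale_le[OF Q(2,3)])
  moreover have "r * (a - \<delta> / (2 * r)) = r * a - \<delta> / 2" using \<open>0 < r\<close> by (simp add: right_diff_distrib)
  ultimately show False using \<delta>(1) by simp
qed

lemma \<phi>_scale:
  assumes X: "X \<in> M" "pd X" and "0 < r"
  shows "\<phi> (r *\<^sub>R X) = r *\<^sub>R \<phi> X"
proof (rule antisym)
  have "\<phi> ((1 / r) *\<^sub>R r *\<^sub>R X) \<le> (1 / r) *\<^sub>R \<phi> (r *\<^sub>R X)"
    using assms by (intro \<phi>_scale_le) (simp_all add: pd_scale)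
  then have "\<phi> X \<le> (1 / r) *\<^sub>R \<phi> (r *\<^sub>R X)" using \<open>0 < r\<close> by simp
  then have "r *\<^sub>R \<phi> X \<le> r *\<^sub>R (1 / r) *\<^sub>R \<phi> (r *\<^sub>R X)" using \<open>0 < r\<close> by (intro scaleR_left_mono) simp_all
  then show "r *\<^sub>R \<phi> X \<le> \<phi> (r *\<^sub>R X)" using \<open>0 < r\<close> by simp
qed (rule \<phi>_scale_le[OF assms])

lemma inverse_cone_order_iso: "cone_order_iso N M (\<lambda>Y. SOME X. X \<in> M \<and> pd X \<and> \<phi> X = Y)"
proof -
  define \<psi> where "\<psi> Y = (SOME X. X \<in> M \<and> pd X \<and> \<phi> X = Y)" for Y
  have \<psi>: "\<psi> Y \<in> M \<and> pd (\<psi> Y) \<and> \<phi> (\<psi> Y) = Y" if "Y \<in> N" "pd Y" for Y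
  proof -
    have "\<exists>X. X \<in> M \<and> pd X \<and> \<phi> X = Y" using \<phi>_surj[OF that] by blast
    from someI_ex[OF this] show ?thesis by (simp add: \<psi>_def)
  qed
  have \<psi>\<phi>: "\<psi> (\<phi> X) = X" if "X \<in> M" "pd X" for X
    using \<psi>[OF \<phi>_mem[OF that] \<phi>_pd[OF that]] \<phi>_inj that by blast
  have "cone_order_iso N M \<psi>"
  proof
    show "\<exists>X\<in>N. pd X \<and> \<psi> X = Y" if "Y \<in> M" "pd Y" for Y
      using that \<phi>_mem \<phi>_pd \<psi>\<phi> by blast
    show "\<psi> X \<le> \<psi> Y \<longleftrightarrow> X \<le> Y" if "X \<in> N" "pd X" "Y \<in> N" "pd Y" for X Y
      using \<psi>[OF that(1,2)] \<psi>[OF that(3,4)] \<phi>_le[of "\<psi> X" "\<psi> Y"] by simp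
    show "\<psi> (t *\<^sub>R 1) = t *\<^sub>R 1" if "0 < t" for t
      using \<psi>\<phi>[of "t *\<^sub>R 1"] that by (simp add: \<phi>_scalar)
  qed (use \<psi> in auto)
  then show ?thesis by (simp add: \<psi>_def[abs_def])
qed

text \<open>
  The reverse inequality is subadditivity of the inverse map.
\<close>

lemma \<phi>_add:
  assumes X: "X \<in> M" "pd X" and Y: "Y \<in> M" "pd Y"
  shows "\<phi> (X + Y) = \<phi> X + \<phi> Y"
proof (rule antisym)
  obtain \<psi> where "cone_order_iso N M \<psi>" and inv: "\<And>Z. Z \<in> N \<Longrightarrow> pd Z \<Longrightarrow> \<psi> Z \<in> M \<and> pd (\<psi> Z) \<and> \<phi> (\<psi> Z) = Z"
  proof -
    have "(SOME X. X \<in> M \<and> pd X \<and> \<phi> X = Z) \<in> M \<and> pd (SOME X. X \<in> M \<and> pd X \<and> \<phi> X = Z)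
        \<and> \<phi> (SOME X. X \<in> M \<and> pd X \<and> \<phi> X = Z) = Z" if "Z \<in> N" "pd Z" for Z
    proof -
      have "\<exists>X. X \<in> M \<and> pd X \<and> \<phi> X = Z" using \<phi>_surj[OF that] by blast
      from someI_ex[OF this] show ?thesis by simp
    qed
    then show thesis using that inverse_cone_order_iso by blast
  qed
  interpret inv: cone_order_iso N M \<psi> by fact
  note im = \<phi>_mem[OF X] \<phi>_pd[OF X] \<phi>_mem[OF Y] \<phi>_pd[OF Y]
  have sum: "\<phi> X + \<phi> Y \<in> N" "pd (\<phi> X + \<phi> Y)" using im by (simp_all add: pd_add pd_nonneg)
  have "\<psi> (\<phi> X) = X" "\<psi> (\<phi> Y) = Y" using inv im X Y \<phi>_inj by blast+
  then have "\<psi> (\<phi> X + \<phi> Y) \<le> X + Y" using inv.\<phi>_subadditive[OF im] by simp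
  then have "\<phi> (\<psi> (\<phi> X + \<phi> Y)) \<le> \<phi> (X + Y)"
    using inv[OF sum] X Y by (subst \<phi>_le) (simp_all add: pd_add pd_nonneg)
  then show "\<phi> X + \<phi> Y \<le> \<phi> (X + Y)" using inv[OF sum] by simp
qed (rule \<phi>_subadditive[OF assms])

end

section \<open>Extension to a Jordan isomorphism\<close>

lemma pd_shift:
  fixes T :: "'h :: chilbert_space oper"
  assumes "star T = T" "norm T < c"
  shows "pd (T + c *\<^sub>R 1)"
proof (rule pdI)
  show "0 < c - norm T" using assms by simp
  show "(c - norm T) *\<^sub>R 1 \<le> T + c *\<^sub>R 1"
    using neg_norm_le[OF assms(1)] by (simp add: algebra_simps) (metis add.commute add_left_mono add.right_inverse minus_le_iff neg_le_iff_le le_minus_iff add_increasing diff_ge_0_iff_ge)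
qed

text \<open>
  Multiplying \<open>P Q = - Q P\<close> by \<open>P\<close> from either side shows that \<open>P\<close> and \<open>Q\<close> also commute.
\<close>

lemma orthogonal_of_anticommute:
  assumes "proj P" "proj Q" "P * Q + Q * P = 0"
  shows "P * Q = 0"
proof -
  have PQ: "P * Q = - (Q * P)" using assms(3) by (simp add: eq_neg_iff_add_eq_0)
  have 1: "P * Q = - (P * Q * P)"
    using arg_cong[OF PQ, of "\<lambda>X. P * X"]
    unfolding mult_minus_right mult.assoc[symmetric] proj_idem[OF assms(1)] .
  have 2: "P * Q * P = - (Q * P)"
    using arg_cong[OF PQ, of "\<lambda>X. X * P"]
    unfolding mult_minus_left mult.assoc proj_idem[OF assms(1)] .
  have "P * Q = Q * P" using 1 unfolding 2 by simp
  then have "P * Q + P * Q = 0" using assms(3) by simp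
  then have "2 *\<^sub>R (P * Q) = 0" by (simp only: scaleR_2)
  then show ?thesis by simp
qed

definition re_part :: "'h oper \<Rightarrow> 'h :: chilbert_space oper" where "re_part T = (1/2) *\<^sub>R (T + star T)"
definition im_part :: "'h oper \<Rightarrow> 'h :: chilbert_space oper" where "im_part T = scaleCo (- \<i> / 2) (T - star T)"

lemma scaleCo_zero [simp]: "scaleCo c 0 = 0"
  by (rule oper_eqI) simp

lemma scaleCo_one [simp]: "scaleCo 1 T = T"
  by (rule oper_eqI) simp

lemma scaleCo_Complex: "scaleCo c T = Re c *\<^sub>R T + Im c *\<^sub>R scaleCo \<i> T"
proof -
  have "scaleCo c T = scaleCo (complex_of_real (Re c) + complex_of_real (Im c) * \<i>) T"
    by (simp add: complex_eq mult.commute flip: complex_eq)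
  then show ?thesis by (simp only: scaleCo_distrib(3) scaleCo_distrib(4)[symmetric] scaleCo_of_real)
qed

lemma scaleCo_minus_one: "scaleCo (- 1) T = - T"
  using scaleCo_of_real[of "- 1" T] by simp

lemma scaleCo_uminus: "scaleCo (- c) T = - scaleCo c T"
  using scaleCo_distrib(4)[of "- 1" c T] by (simp add: scaleCo_minus_one)

lemma re_im:
  "T = re_part T + scaleCo \<i> (im_part T)" "star (re_part T) = re_part T" "star (im_part T) = im_part T"
proof -
  have "scaleCo \<i> (im_part T) = (1/2) *\<^sub>R (T - star T)"
    using scaleCo_of_real[of "1/2" "T - star T"] by (simp add: im_part_def scaleCo_distrib(4))
  then show "T = re_part T + scaleCo \<i> (im_part T)"
    by (simp add: re_part_def scaleR_add_right scaleR_diff_right flip: scaleR_add_left)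
  show "star (re_part T) = re_part T" by (simp add: re_part_def add.commute)
  have "scaleCo (\<i> / 2) (star T - T) = scaleCo (- 1) (scaleCo (\<i> / 2) (T - star T))"
    unfolding scaleCo_minus_one by (simp add: scaleCo_distrib)
  also have "\<dots> = scaleCo (- \<i> / 2) (T - star T)" by (simp only: scaleCo_distrib(4)) simp
  finally show "star (im_part T) = im_part T" by (simp add: im_part_def)
qed

lemma re_im_unique:
  assumes "star A = A" "star B = B" "T = A + scaleCo \<i> B"
  shows "re_part T = A" "im_part T = B"
proof -
  have sT: "star T = A - scaleCo \<i> B"
  proof -
    have "star T = star A + scaleCo (cnj \<i>) (star B)" unfolding assms(3) by simp
    then show ?thesis unfolding assms(1,2) complex_cnj_i scaleCo_uminus by simp
  qed
  have "T + star T = 2 *\<^sub>R A" unfolding sT unfolding assms(3) by (simp add: scaleR_2)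
  then show "re_part T = A" by (simp add: re_part_def)
  have "T - star T = 2 *\<^sub>R scaleCo \<i> B" unfolding sT unfolding assms(3) by (simp add: scaleR_2)
  also have "\<dots> = scaleCo (2 * \<i>) B"
    using scaleCo_of_real[of 2 "scaleCo \<i> B"] by (simp add: scaleCo_distrib(4))
  finally have "T - star T = scaleCo (2 * \<i>) B" .
  then show "im_part T = B" by (simp add: im_part_def scaleCo_distrib(4))
qed

lemma (in cstar_subalgebra) re_im_mem: "T \<in> M \<Longrightarrow> re_part T \<in> M" "T \<in> M \<Longrightarrow> im_part T \<in> M"
  by (simp_all add: re_part_def im_part_def)

context cone_order_iso
begin

text \<open>The linear extension of \<open>\<phi>\<close> to the self-adjoint part: shift into the cone and back.\<close>

definition J0 :: "'h oper \<Rightarrow> 'h oper"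
  where "J0 T = \<phi> (T + (norm T + 1) *\<^sub>R 1) - (norm T + 1) *\<^sub>R 1"

text \<open>
  The value does not depend on the shift, because \<open>\<phi>\<close> is additive and fixes scalars.
\<close>

lemma J0_shift:
  assumes T: "T \<in> M" "star T = T" and c: "0 < c" "pd (T + c *\<^sub>R 1)"
  shows "\<phi> (T + c *\<^sub>R 1) = J0 T + c *\<^sub>R 1"
proof -
  define k where "k = norm T + 1"
  have k: "0 < k" "pd (T + k *\<^sub>R 1)" using T by (simp_all add: k_def add_nonneg_pos pd_shift)
  have "\<phi> (T + c *\<^sub>R 1) + k *\<^sub>R 1 = \<phi> ((T + c *\<^sub>R 1) + k *\<^sub>R 1)"
    using T c k by (simp add: \<phi>_add \<phi>_scalar)
  also have "(T + c *\<^sub>R 1) + k *\<^sub>R 1 = (T + k *\<^sub>R 1) + c *\<^sub>R 1" by (simp only: add_ac)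
  also have "\<phi> \<dots> = \<phi> (T + k *\<^sub>R 1) + c *\<^sub>R 1"
    using T c k by (simp add: \<phi>_add \<phi>_scalar)
  finally show ?thesis by (simp add: J0_def k_def algebra_simps)
qed

lemma J0_eq_\<phi>: "X \<in> M \<Longrightarrow> pd X \<Longrightarrow> J0 X = \<phi> X"
proof -
  assume X: "X \<in> M" "pd X"
  have "\<phi> (X + 1 *\<^sub>R 1) = J0 X + 1 *\<^sub>R 1" using X by (intro J0_shift) (simp_all add: pd_add one_nonneg)
  moreover have "\<phi> (X + 1 *\<^sub>R 1) = \<phi> X + 1 *\<^sub>R 1" using X \<phi>_scalar[of 1] by (simp add: \<phi>_add)
  ultimately show ?thesis by simp
qed

lemma J0_mem:
  assumes T: "T \<in> M" "star T = T"
  shows "J0 T \<in> N" "star (J0 T) = J0 T"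
proof -
  have "T + (norm T + 1) *\<^sub>R 1 \<in> M" "pd (T + (norm T + 1) *\<^sub>R 1)" using T by (simp_all add: pd_shift)
  from \<phi>_mem[OF this] \<phi>_pd[OF this] show "J0 T \<in> N" "star (J0 T) = J0 T" by (simp_all add: J0_def)
qed

lemma J0_add:
  assumes S: "S \<in> M" "star S = S" and T: "T \<in> M" "star T = T"
  shows "J0 (S + T) = J0 S + J0 T"
proof -
  define k where "k = norm S + 1"
  define l where "l = norm T + 1"
  have k: "0 < k" "pd (S + k *\<^sub>R 1)" using S by (simp_all add: k_def add_nonneg_pos pd_shift)
  have l: "0 < l" "pd (T + l *\<^sub>R 1)" using T by (simp_all add: l_def add_nonneg_pos pd_shift)
  have eq: "(S + T) + (k + l) *\<^sub>R 1 = (S + k *\<^sub>R 1) + (T + l *\<^sub>R 1)" by (simp add: algebra_simps)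
  have "pd ((S + T) + (k + l) *\<^sub>R 1)" unfolding eq by (intro pd_add k l pd_nonneg)
  then have "J0 (S + T) + (k + l) *\<^sub>R 1 = \<phi> ((S + T) + (k + l) *\<^sub>R 1)"
    using S T k(1) l(1) by (intro J0_shift[symmetric]) simp_all
  also have "\<dots> = \<phi> (S + k *\<^sub>R 1) + \<phi> (T + l *\<^sub>R 1)" unfolding eq using S T k l by (intro \<phi>_add) simp_all
  also have "\<dots> = (J0 S + k *\<^sub>R 1) + (J0 T + l *\<^sub>R 1)" using S T k l by (simp only: J0_shift)
  finally show ?thesis by (simp add: algebra_simps)
qed

lemma J0_zero [simp]: "J0 0 = 0"
  using J0_add[of 0 0] by simp

lemma J0_uminus: "T \<in> M \<Longrightarrow> star T = T \<Longrightarrow> J0 (- T) = - J0 T"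
  using J0_add[of T "- T"] by (simp add: add_eq_0_iff)

lemma J0_diff: "S \<in> M \<Longrightarrow> star S = S \<Longrightarrow> T \<in> M \<Longrightarrow> star T = T \<Longrightarrow> J0 (S - T) = J0 S - J0 T"
  using J0_add[of S "- T"] by (simp add: J0_uminus)

lemma J0_scale:
  assumes T: "T \<in> M" "star T = T"
  shows "J0 (r *\<^sub>R T) = r *\<^sub>R J0 T"
proof -
  have pos: "J0 (r *\<^sub>R T) = r *\<^sub>R J0 T" if "0 < r" for r
  proof -
    define k where "k = norm T + 1"
    have k: "0 < k" "pd (T + k *\<^sub>R 1)" using T by (simp_all add: k_def add_nonneg_pos pd_shift)
    have eq: "r *\<^sub>R T + (r * k) *\<^sub>R 1 = r *\<^sub>R (T + k *\<^sub>R 1)" by (simp add: algebra_simps)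
    have "J0 (r *\<^sub>R T) + (r * k) *\<^sub>R 1 = \<phi> (r *\<^sub>R T + (r * k) *\<^sub>R 1)"
      using T k that eq pd_scale[OF k(2) that] by (intro J0_shift[symmetric]) simp_all
    also have "\<dots> = r *\<^sub>R \<phi> (T + k *\<^sub>R 1)" unfolding eq using T k that by (intro \<phi>_scale) simp_all
    also have "\<dots> = r *\<^sub>R (J0 T + k *\<^sub>R 1)" using T k by (simp only: J0_shift)
    finally show ?thesis by (simp add: algebra_simps)
  qed
  consider "0 < r" | "r = 0" | "r < 0" by linarith
  then show ?thesis
  proof cases
    case 3
    then have "J0 (- (- r *\<^sub>R T)) = - J0 (- r *\<^sub>R T)" using T by (intro J0_uminus) simp_all
    then show ?thesis using pos[of "- r"] 3 by simp
  qed (simp_all add: pos)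
qed

lemma J0_one: "J0 1 = 1"
  using J0_eq_\<phi>[of 1] \<phi>_scalar[of 1] by simp

lemma J0_le_iff:
  assumes S: "S \<in> M" "star S = S" and T: "T \<in> M" "star T = T"
  shows "J0 S \<le> J0 T \<longleftrightarrow> S \<le> T"
proof -
  define c where "c = max (norm S) (norm T) + 1"
  have c: "0 < c" "pd (S + c *\<^sub>R 1)" "pd (T + c *\<^sub>R 1)"
    using S T by (auto simp: c_def le_max_iff_disj intro!: pd_shift add_nonneg_pos)
  have "\<phi> (S + c *\<^sub>R 1) \<le> \<phi> (T + c *\<^sub>R 1) \<longleftrightarrow> S + c *\<^sub>R 1 \<le> T + c *\<^sub>R 1"
    using S T c by (intro \<phi>_le) simp_all
  then show ?thesis using S T c by (simp add: J0_shift)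
qed

lemma J0_surj:
  assumes Y: "Y \<in> N" "star Y = Y"
  shows "\<exists>T\<in>M. star T = T \<and> J0 T = Y"
proof -
  define c where "c = norm Y + 1"
  have c: "0 < c" "pd (Y + c *\<^sub>R 1)" using Y by (simp_all add: c_def add_nonneg_pos pd_shift)
  obtain X where X: "X \<in> M" "pd X" "\<phi> X = Y + c *\<^sub>R 1" using \<phi>_surj[of "Y + c *\<^sub>R 1"] Y c by auto
  have "J0 (X - c *\<^sub>R 1) = J0 X - c *\<^sub>R J0 1" using X by (simp add: J0_diff J0_scale)
  then have "J0 (X - c *\<^sub>R 1) = Y" using X by (simp add: J0_one J0_eq_\<phi>)
  then show ?thesis using X by (intro bexI[of _ "X - c *\<^sub>R 1"]) simp_all
qed

lemma J0_inj: "S \<in> M \<Longrightarrow> star S = S \<Longrightarrow> T \<in> M \<Longrightarrow> star T = T \<Longrightarrow> J0 S = J0 T \<Longrightarrow> S = T"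
  by (rule antisym) (simp_all add: J0_le_iff[symmetric])

lemma J0_norm_le:
  assumes T: "T \<in> M" "star T = T"
  shows "norm (J0 T) \<le> norm T"
proof (rule norm_leI)
  have "J0 T \<le> J0 (norm T *\<^sub>R 1)" using T by (subst J0_le_iff) (simp_all add: le_norm)
  then show "J0 T \<le> norm T *\<^sub>R 1" by (simp add: J0_scale J0_one)
  have "J0 ((- norm T) *\<^sub>R 1) \<le> J0 T" using T neg_norm_le[OF T(2)] by (subst J0_le_iff) simp_all
  then show "- (norm T *\<^sub>R 1) \<le> J0 T" by (simp only: J0_scale J0_one A.one_mem star_simps(7)) simp
qed simp

lemma J0_proj:
  assumes P: "P \<in> M" "proj P"
  shows "J0 P = \<tau> P"
proof -
  have "1 *\<^sub>R P + 2 *\<^sub>R (1 - P) = 2 *\<^sub>R 1 - P" "1 *\<^sub>R \<tau> P + 2 *\<^sub>R (1 - \<tau> P) = 2 *\<^sub>R 1 - \<tau> P"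
    by (simp_all add: scaleR_diff_right scaleR_2)
  moreover have "pd (1 *\<^sub>R P + 2 *\<^sub>R (1 - P))" using P by (intro pd_two_valued) simp_all
  ultimately have "J0 (2 *\<^sub>R 1 - P) = 2 *\<^sub>R 1 - \<tau> P"
    using \<phi>_two_valued[OF P, of 1 2] J0_eq_\<phi>[of "2 *\<^sub>R 1 - P"] P by simp
  then show ?thesis using P by (simp add: J0_diff J0_scale J0_one)
qed

text \<open>
  Orthogonality of \<open>P\<close> and \<open>Q\<close> means that \<open>P + Q\<close> is a projection, and \<open>J0\<close> preserves sums and projections.
\<close>

lemma J0_orthogonal:
  assumes P: "P \<in> M" "proj P" and Q: "Q \<in> M" "proj Q" and orth: "P * Q = 0" "Q * P = 0"
  shows "J0 P * J0 Q = 0"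
proof (rule orthogonal_of_anticommute)
  show p: "proj (J0 P)" "proj (J0 Q)" using P Q by (simp_all add: J0_proj \<tau>_proj)
  have "proj (P + Q)" unfolding proj_def using P Q orth by (simp add: distrib_left distrib_right)
  then have "proj (J0 (P + Q))" using P Q by (simp add: J0_proj \<tau>_proj)
  then have "(J0 P + J0 Q) * (J0 P + J0 Q) = J0 P + J0 Q"
    using P Q proj_idem[of "J0 (P + Q)"] by (simp add: J0_add)
  then show "J0 P * J0 Q + J0 Q * J0 P = 0" using p by (simp add: distrib_left distrib_right algebra_simps)
qed

text \<open>Squares are preserved for finite combinations of orthogonal projections, and these are dense.\<close>

lemma simple_approximation:
  assumes D: "D \<in> M" "pd D" and r: "1 < r"
  shows "\<exists>E\<in>M. star E = E \<and> E \<le> D \<and> D \<le> r *\<^sub>R E \<and> J0 (E * E) = J0 E * J0 E"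
proof -
  obtain d where d: "0 < d" "d *\<^sub>R 1 \<le> D" using D by (auto simp: pd_def)
  have "\<exists>E\<in>M. star E = E \<and> 1 * E = E \<and> E \<le> 1 * D * 1 \<and> 1 * D * 1 \<le> r *\<^sub>R E \<and> J0 (E * E) = J0 E * J0 E \<and> J0 1 * J0 E = J0 E"
  proof (rule A.spectral_induct[OF D(1) pd_star[OF D(2)] d r, where \<Phi> = "\<lambda>Q. \<exists>E\<in>M. star E = E \<and> Q * E = E \<and>
      E \<le> Q * D * Q \<and> Q * D * Q \<le> r *\<^sub>R E \<and> J0 (E * E) = J0 E * J0 E \<and> J0 Q * J0 E = J0 E"])
    fix Q l assume Q: "Q \<in> M" "proj Q" and l: "0 < l" "l *\<^sub>R Q \<le> Q * D * Q" "Q * D * Q \<le> (r * l) *\<^sub>R Q"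
    have "proj (J0 Q)" using Q by (simp add: J0_proj \<tau>_proj)
    then show "\<exists>E\<in>M. star E = E \<and> Q * E = E \<and> E \<le> Q * D * Q \<and> Q * D * Q \<le> r *\<^sub>R E \<and> J0 (E * E) = J0 E * J0 E \<and> J0 Q * J0 E = J0 E"
      using Q l by (intro bexI[of _ "l *\<^sub>R Q"]) (simp_all add: J0_scale)
  next
    fix P Q assume P: "P \<in> M" "proj P" and Q: "Q \<in> M" "proj Q" and comm: "P * D = D * P" "Q * D = D * Q"
      and orth: "P * Q = 0" "Q * P = 0"
    assume "\<exists>E\<in>M. star E = E \<and> P * E = E \<and> E \<le> P * D * P \<and> P * D * P \<le> r *\<^sub>R E \<and> J0 (E * E) = J0 E * J0 E \<and> J0 P * J0 E = J0 E"
      and "\<exists>E\<in>M. star E = E \<and> Q * E = E \<and> E \<le> Q * D * Q \<and> Q * D * Q \<le> r *\<^sub>R E \<and> J0 (E * E) = J0 E * J0 E \<and> J0 Q * J0 E = J0 E"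
    then obtain E F where E: "E \<in> M" "star E = E" "P * E = E" "E \<le> P * D * P" "P * D * P \<le> r *\<^sub>R E"
        "J0 (E * E) = J0 E * J0 E" "J0 P * J0 E = J0 E"
      and F: "F \<in> M" "star F = F" "Q * F = F" "F \<le> Q * D * Q" "Q * D * Q \<le> r *\<^sub>R F"
        "J0 (F * F) = J0 F * J0 F" "J0 Q * J0 F = J0 F" by blast
    have PDQ: "P * D * Q = 0" "Q * D * P = 0" using comm orth by (simp_all add: mult.assoc)
    have split: "(P + Q) * D * (P + Q) = P * D * P + Q * D * Q" by (simp add: distrib_left distrib_right PDQ)
    have EP: "E * P = E" and FQ: "F * Q = F"
      using arg_cong[OF E(3), of star] arg_cong[OF F(3), of star]
      unfolding star_simps(5) E(2) F(2) proj_star[OF P(2)] proj_star[OF Q(2)] .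
    have "E * F = E * P * (Q * F)" using EP F by simp
    also have "\<dots> = E * (P * Q) * F" by (simp only: mult.assoc)
    finally have EF: "E * F = 0" using orth by simp
    have FE: "F * E = 0" using arg_cong[OF EF, of star] unfolding star_simps(5,6) E(2) F(2) .
    have PF: "P * F = 0" "Q * E = 0"
      using arg_cong[OF F(3), of "\<lambda>X. P * X"] arg_cong[OF E(3), of "\<lambda>X. Q * X"]
      unfolding mult.assoc[symmetric] orth mult_zero_left by simp_all
    have sJ: "star (J0 E) = J0 E" "star (J0 F) = J0 F" "star (J0 P) = J0 P" "star (J0 Q) = J0 Q"
      using E F P Q by (simp_all add: J0_mem)
    have JPQ: "J0 P * J0 Q = 0" "J0 Q * J0 P = 0"
      using J0_orthogonal[OF P Q orth] J0_orthogonal[OF Q P orth(2,1)] by simp_all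
    have JEP: "J0 E * J0 P = J0 E" using arg_cong[OF E(7), of star] unfolding star_simps(5) sJ .
    have "J0 E * J0 F = J0 E * J0 P * (J0 Q * J0 F)" using JEP F by simp
    also have "\<dots> = J0 E * (J0 P * J0 Q) * J0 F" by (simp only: mult.assoc)
    finally have JEF: "J0 E * J0 F = 0" using JPQ by simp
    have JFE: "J0 F * J0 E = 0" using arg_cong[OF JEF, of star] unfolding star_simps(5,6) sJ .
    have JPF: "J0 P * J0 F = 0" "J0 Q * J0 E = 0"
      using arg_cong[OF F(7), of "\<lambda>X. J0 P * X"] arg_cong[OF E(7), of "\<lambda>X. J0 Q * X"]
      unfolding mult.assoc[symmetric] JPQ mult_zero_left by simp_all
    show "\<exists>E\<in>M. star E = E \<and> (P + Q) * E = E \<and> E \<le> (P + Q) * D * (P + Q) \<and> (P + Q) * D * (P + Q) \<le> r *\<^sub>R E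
        \<and> J0 (E * E) = J0 E * J0 E \<and> J0 (P + Q) * J0 E = J0 E"
    proof (intro bexI[of _ "E + F"] conjI)
      show "star (E + F) = E + F" "E + F \<in> M" using E F by simp_all
      show "(P + Q) * (E + F) = E + F" using E F PF by (simp add: distrib_left distrib_right)
      show "E + F \<le> (P + Q) * D * (P + Q)" unfolding split using E F by (intro add_mono)
      show "(P + Q) * D * (P + Q) \<le> r *\<^sub>R (E + F)" unfolding split scaleR_add_right using E F by (intro add_mono)
      have "J0 ((E + F) * (E + F)) = J0 (E * E + F * F)" by (simp add: distrib_left distrib_right EF FE)
      also have "\<dots> = (J0 E + J0 F) * (J0 E + J0 F)"
        using E F by (simp add: J0_add distrib_left distrib_right JEF JFE)
      also have "\<dots> = J0 (E + F) * J0 (E + F)" using E F by (simp add: J0_add)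
      finally show "J0 ((E + F) * (E + F)) = J0 (E + F) * J0 (E + F)" .
      show "J0 (P + Q) * J0 (E + F) = J0 (E + F)"
        using E F P Q by (simp add: J0_add distrib_left distrib_right JPF)
    qed
  qed
  then show ?thesis by auto
qed

text \<open>
  Both sides are continuous in \<open>D\<close>, as \<open>J0\<close> is a contraction; the simple approximations satisfy the equation.
\<close>

lemma J0_square_pd:
  assumes D: "D \<in> M" "pd D"
  shows "J0 (D * D) = J0 D * J0 D"
proof -
  have "norm (J0 (D * D) - J0 D * J0 D) \<le> 0"
  proof (rule field_le_epsilon)
    fix e :: real assume "0 < e"
    define r where "r = 1 + e / (4 * (norm D * norm D) + 1)"
    have den: "0 < 4 * (norm D * norm D) + 1" by (simp add: add_nonneg_pos)
    have r: "1 < r" using \<open>0 < e\<close> den by (simp add: r_def)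
    obtain E where E: "E \<in> M" "star E = E" "E \<le> D" "D \<le> r *\<^sub>R E" "J0 (E * E) = J0 E * J0 E"
      using simple_approximation[OF D r] by blast
    define h where "h = (r - 1) * norm D"
    have h: "0 \<le> h" using r by (simp add: h_def)
    have "0 \<le> r *\<^sub>R E" using pd_nonneg[OF D(2)] E(4) by (rule order_trans)
    then have E0: "0 \<le> E" using nonneg_scaleD[of r E] r by simp
    have nE: "norm E \<le> norm D"
      using norm_le_iff_pos[OF E0, of "norm D"] order_trans[OF E(3) le_norm] D by simp
    have "D - E \<le> (r - 1) *\<^sub>R E" using E(4) by (simp add: algebra_simps)
    also have "\<dots> \<le> (r - 1) *\<^sub>R norm D *\<^sub>R 1"
      using r D order_trans[OF E(3) le_norm] by (intro scaleR_left_mono) simp_all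
    finally have "D - E \<le> h *\<^sub>R 1" by (simp add: h_def)
    then have nDE: "norm (D - E) \<le> h" using norm_le_iff_pos[of "D - E" h] E(3) h by simp
    have sD: "star D = D" using D by simp
    have diff: "norm (U * U - V * V) \<le> h * (norm D + norm D)"
      if "norm (U - V) \<le> h" "norm U \<le> norm D" "norm V \<le> norm D" for U V :: "'h oper"
    proof -
      have "norm (U * U - V * V) = norm (U * (U - V) + (U - V) * V)" by (simp add: algebra_simps)
      also have "\<dots> \<le> norm (U * (U - V)) + norm ((U - V) * V)" by (rule norm_triangle_ineq)
      also have "\<dots> \<le> norm U * norm (U - V) + norm (U - V) * norm V" by (intro add_mono norm_mult_ineq)
      also have "\<dots> \<le> norm D * h + h * norm D" using that h by (intro add_mono mult_mono) simp_all
      finally show ?thesis by (simp add: algebra_simps)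
    qed
    have J: "norm (J0 D - J0 E) \<le> h" "norm (J0 D) \<le> norm D" "norm (J0 E) \<le> norm D"
      using J0_norm_le[of "D - E"] J0_norm_le[of D] J0_norm_le[of E] D E sD nDE nE by (simp_all add: J0_diff)
    have "norm (J0 (D * D - E * E)) \<le> norm (D * D - E * E)" using D E sD by (intro J0_norm_le) simp_all
    also have "\<dots> \<le> h * (norm D + norm D)" using nDE nE by (intro diff) simp_all
    finally have 1: "norm (J0 (D * D) - J0 E * J0 E) \<le> h * (norm D + norm D)"
      using D E sD by (simp add: J0_diff)
    have 2: "norm (J0 E * J0 E - J0 D * J0 D) \<le> h * (norm D + norm D)"
      using diff[OF J] by (simp add: norm_minus_commute)
    have "norm (J0 (D * D) - J0 D * J0 D) \<le> norm (J0 (D * D) - J0 E * J0 E) + norm (J0 E * J0 E - J0 D * J0 D)"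
      using norm_triangle_ineq[of "J0 (D * D) - J0 E * J0 E" "J0 E * J0 E - J0 D * J0 D"] by simp
    also have "\<dots> \<le> (r - 1) * (4 * (norm D * norm D))" using 1 2 by (simp add: h_def algebra_simps)
    also have "\<dots> \<le> (r - 1) * (4 * (norm D * norm D) + 1)" using r by (intro mult_left_mono) simp_all
    also have "\<dots> = e" using den by (simp add: r_def)
    finally show "norm (J0 (D * D) - J0 D * J0 D) \<le> 0 + e" by simp
  qed
  then show ?thesis by simp
qed

lemma J0_square:
  assumes T: "T \<in> M" "star T = T"
  shows "J0 (T * T) = J0 T * J0 T"
proof -
  define c where "c = norm T + 1"
  have D: "T + c *\<^sub>R 1 \<in> M" "pd (T + c *\<^sub>R 1)" using T by (simp_all add: c_def pd_shift)
  have expand: "(S + c *\<^sub>R 1) * (S + c *\<^sub>R 1) = S * S + ((2 * c) *\<^sub>R S + (c * c) *\<^sub>R 1)" for S :: "'h oper"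
    by (simp add: algebra_simps flip: scaleR_add_left)
  have "J0 ((T + c *\<^sub>R 1) * (T + c *\<^sub>R 1)) = (J0 T + c *\<^sub>R 1) * (J0 T + c *\<^sub>R 1)"
    using J0_square_pd[OF D] T by (simp add: J0_add J0_scale J0_one)
  then show ?thesis unfolding expand using T by (simp add: J0_add J0_scale J0_one)
qed

text \<open>
  Polarization of squares.
\<close>

lemma J0_jordan:
  assumes S: "S \<in> M" "star S = S" and T: "T \<in> M" "star T = T"
  shows "J0 (S * T + T * S) = J0 S * J0 T + J0 T * J0 S"
proof -
  have "J0 ((S + T) * (S + T)) = J0 (S + T) * J0 (S + T)" using S T by (intro J0_square) simp_all
  moreover have "(S + T) * (S + T) = (S * S + T * T) + (S * T + T * S)" by (simp add: algebra_simps)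
  moreover have "J0 ((S * S + T * T) + (S * T + T * S)) = (J0 S * J0 S + J0 T * J0 T) + J0 (S * T + T * S)"
    using S T by (simp add: J0_add J0_square add.commute)
  ultimately show ?thesis using S T by (simp add: J0_add algebra_simps)
qed

definition J :: "'h oper \<Rightarrow> 'h oper"
  where "J T = J0 (re_part T) + scaleCo \<i> (J0 (im_part T))"

lemma J_eq:
  assumes "A \<in> M" "star A = A" "B \<in> M" "star B = B"
  shows "J (A + scaleCo \<i> B) = J0 A + scaleCo \<i> (J0 B)"
  using re_im_unique[OF assms(2,4) refl] by (simp add: J_def)

lemma decompose:
  assumes "T \<in> M"
  obtains A B where "A \<in> M" "star A = A" "B \<in> M" "star B = B" "T = A + scaleCo \<i> B"
  using re_im[of T] A.re_im_mem[OF assms] by blast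

lemma J_add: "S \<in> M \<Longrightarrow> T \<in> M \<Longrightarrow> J (S + T) = J S + J T"
proof -
  assume "S \<in> M" "T \<in> M"
  then obtain A B C D where *: "A \<in> M" "star A = A" "B \<in> M" "star B = B" "C \<in> M" "star C = C" "D \<in> M" "star D = D"
    and S: "S = A + scaleCo \<i> B" and T: "T = C + scaleCo \<i> D" by (metis decompose)
  have "S + T = (A + C) + scaleCo \<i> (B + D)" by (simp add: S T scaleCo_distrib)
  then have "J (S + T) = J0 (A + C) + scaleCo \<i> (J0 (B + D))" using * by (simp only: J_eq A.add_mem star_simps)
  then show ?thesis using * by (simp add: S T J_eq J0_add scaleCo_distrib)
qed

lemma J_scaleR: "T \<in> M \<Longrightarrow> J (r *\<^sub>R T) = r *\<^sub>R J T"
proof -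
  assume "T \<in> M"
  then obtain A B where *: "A \<in> M" "star A = A" "B \<in> M" "star B = B" and T: "T = A + scaleCo \<i> B" by (rule decompose)
  have "r *\<^sub>R T = r *\<^sub>R A + scaleCo \<i> (r *\<^sub>R B)" by (simp add: T scaleCo_distrib scaleR_add_right)
  then have "J (r *\<^sub>R T) = J0 (r *\<^sub>R A) + scaleCo \<i> (J0 (r *\<^sub>R B))" using * by (simp only: J_eq A.scaleR_mem star_simps)
  then show ?thesis using * by (simp add: T J_eq J0_scale scaleCo_distrib scaleR_add_right)
qed

lemma J_i: "T \<in> M \<Longrightarrow> J (scaleCo \<i> T) = scaleCo \<i> (J T)"
proof -
  assume "T \<in> M"
  then obtain A B where *: "A \<in> M" "star A = A" "B \<in> M" "star B = B" and T: "T = A + scaleCo \<i> B" by (rule decompose)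
  have "scaleCo \<i> T = - B + scaleCo \<i> A" by (simp add: T scaleCo_distrib scaleCo_minus_one add.commute)
  then have "J (scaleCo \<i> T) = J0 (- B) + scaleCo \<i> (J0 A)" using * by (simp only: J_eq A.uminus_mem star_simps)
  then show ?thesis using * by (simp add: T J_eq J0_uminus scaleCo_distrib scaleCo_minus_one)
qed

lemma J_scaleCo: "T \<in> M \<Longrightarrow> J (scaleCo c T) = scaleCo c (J T)"
  unfolding scaleCo_Complex[of c] by (simp add: J_add J_scaleR J_i)

lemma J_star: "T \<in> M \<Longrightarrow> J (star T) = star (J T)"
proof -
  assume "T \<in> M"
  then obtain A B where *: "A \<in> M" "star A = A" "B \<in> M" "star B = B" and T: "T = A + scaleCo \<i> B" by (rule decompose)
  have neg: "scaleCo (- \<i>) X = scaleCo \<i> (- X)" for X :: "'h oper"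
    using scaleCo_distrib(4)[of \<i> "- 1" X] by (simp add: scaleCo_minus_one)
  have "star T = A + scaleCo \<i> (- B)" using * by (simp add: T neg)
  then have "J (star T) = J0 A + scaleCo \<i> (J0 (- B))" using * by (simp only: J_eq A.uminus_mem star_simps)
  then show ?thesis using * J0_mem by (simp add: T J_eq J0_uminus neg)
qed

lemma J_mem: "T \<in> M \<Longrightarrow> J T \<in> N"
  using A.re_im_mem[of T] re_im(2,3)[of T] by (simp add: J_def J0_mem)

lemma J_jordan: "S \<in> M \<Longrightarrow> T \<in> M \<Longrightarrow> J (S * T + T * S) = J S * J T + J T * J S"
proof -
  have J0J: "J X = J0 X" if "X \<in> M" "star X = X" for X
    using J_eq[OF that A.zero_mem star_simps(6)] by simp
  have half: "J (A * T + T * A) = J A * J T + J T * J A" if A: "A \<in> M" "star A = A" and "T \<in> M" for A T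
  proof -
    obtain C D where *: "C \<in> M" "star C = C" "D \<in> M" "star D = D" and T: "T = C + scaleCo \<i> D"
      using \<open>T \<in> M\<close> by (rule decompose)
    have "A * T + T * A = (A * C + C * A) + scaleCo \<i> (A * D + D * A)" by (simp add: T algebra_simps scaleCo_distrib)
    then have "J (A * T + T * A) = J0 (A * C + C * A) + scaleCo \<i> (J0 (A * D + D * A))"
      using A * by (simp only:) (subst J_eq; simp add: add.commute)
    then show ?thesis using A * by (simp add: T J_eq J0J J0_jordan algebra_simps scaleCo_distrib)
  qed
  assume "S \<in> M" "T \<in> M"
  then obtain A B where *: "A \<in> M" "star A = A" "B \<in> M" "star B = B" and S: "S = A + scaleCo \<i> B" using decompose by blast
  have "S * T + T * S = (A * T + T * A) + scaleCo \<i> (B * T + T * B)" by (simp add: S algebra_simps scaleCo_distrib)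
  then have "J (S * T + T * S) = J (A * T + T * A) + scaleCo \<i> (J (B * T + T * B))"
    using * \<open>T \<in> M\<close> by (simp add: J_add J_i)
  also have "\<dots> = (J A * J T + J T * J A) + scaleCo \<i> (J B * J T + J T * J B)"
    by (simp only: half[OF *(1,2) \<open>T \<in> M\<close>] half[OF *(3,4) \<open>T \<in> M\<close>])
  also have "\<dots> = (J A + scaleCo \<i> (J B)) * J T + J T * (J A + scaleCo \<i> (J B))"
    by (simp add: algebra_simps scaleCo_distrib)
  also have "J A + scaleCo \<i> (J B) = J S" using * by (simp add: S J_add J_i)
  finally show ?thesis .
qed

lemma J_bij: "bij_betw J M N"
  unfolding bij_betw_def
proof
  show "inj_on J M"
  proof (rule inj_onI)
    fix S T assume ST: "S \<in> M" "T \<in> M" "J S = J T"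
    note m = A.re_im_mem[OF ST(1)] A.re_im_mem[OF ST(2)] re_im(2,3)[of S] re_im(2,3)[of T]
    have "J0 (re_part S) = J0 (re_part T)" "J0 (im_part S) = J0 (im_part T)"
      using re_im_unique[OF J0_mem(2)[OF m(1,5)] J0_mem(2)[OF m(2,6)] J_def]
        re_im_unique[OF J0_mem(2)[OF m(3,7)] J0_mem(2)[OF m(4,8)] J_def] ST(3) by simp_all
    then have "re_part S = re_part T" "im_part S = im_part T" using m J0_inj by blast+
    then show "S = T" using re_im(1)[of S] re_im(1)[of T] by simp
  qed
  show "J ` M = N"
  proof
    show "J ` M \<subseteq> N" using J_mem by blast
    show "N \<subseteq> J ` M"
    proof
      fix Y assume Y: "Y \<in> N"
      obtain A where A: "A \<in> M" "star A = A" "J0 A = re_part Y" using J0_surj[of "re_part Y"] B.re_im_mem[OF Y] re_im[of Y] by blast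
      obtain B where B: "B \<in> M" "star B = B" "J0 B = im_part Y" using J0_surj[of "im_part Y"] B.re_im_mem[OF Y] re_im[of Y] by blast
      have "J (A + scaleCo \<i> B) = Y" using J_eq[OF A(1,2) B(1,2)] A B re_im(1)[of Y] by simp
      then show "Y \<in> J ` M" using A B by (intro image_eqI[of _ _ "A + scaleCo \<i> B"]) simp_all
    qed
  qed
qed

lemma J_eq_\<phi>: "X \<in> M \<Longrightarrow> pd X \<Longrightarrow> J X = \<phi> X"
  using J_eq[of X 0] by (simp add: J0_eq_\<phi>)

end

section \<open>Jordan isomorphisms preserve means\<close>

text \<open>
  The converse direction, for Jordan isomorphisms in the type of operators.
\<close>

locale jordan_iso = A: aw_star M + B: aw_star N
  for M N :: "'h :: chilbert_space oper set" +
  fixes J :: "'h oper \<Rightarrow> 'h oper"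
  assumes bij: "bij_betw J M N"
    and J_add: "S \<in> M \<Longrightarrow> T \<in> M \<Longrightarrow> J (S + T) = J S + J T"
    and J_scaleCo: "T \<in> M \<Longrightarrow> J (scaleCo c T) = scaleCo c (J T)"
    and J_star: "T \<in> M \<Longrightarrow> J (star T) = star (J T)"
    and J_jordan: "S \<in> M \<Longrightarrow> T \<in> M \<Longrightarrow> J (S * T + T * S) = J S * J T + J T * J S"
begin

lemma J_mem: "T \<in> M \<Longrightarrow> J T \<in> N"
  using bij by (rule bij_betwE[rule_format])

lemma J_scaleR: "T \<in> M \<Longrightarrow> J (r *\<^sub>R T) = r *\<^sub>R J T"
  using J_scaleCo[of T "complex_of_real r"] by simp

lemma J_diff: "S \<in> M \<Longrightarrow> T \<in> M \<Longrightarrow> J (S - T) = J S - J T"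
  using J_add[of S "- T"] J_scaleR[of T "- 1"] by simp

lemma J_square: "T \<in> M \<Longrightarrow> J (T * T) = J T * J T"
proof -
  assume T: "T \<in> M"
  then have "2 *\<^sub>R J (T * T) = 2 *\<^sub>R (J T * J T)" using J_jordan[OF T T] by (simp add: J_add scaleR_2)
  then show ?thesis by simp
qed

text \<open>The triple product is a combination of Jordan products: \<open>2 S T S = S \<circ> (S \<circ> T) - S\<^sup>2 \<circ> T\<close>.\<close>

lemma J_triple:
  assumes S: "S \<in> M" and T: "T \<in> M"
  shows "J (S * T * S) = J S * J T * J S"
proof -
  define P where "P = S * T + T * S"
  have P: "P \<in> M" using S T by (simp add: P_def)
  have "2 *\<^sub>R (S * T * S) = (S * P + P * S) - ((S * S) * T + T * (S * S))"
    by (simp add: P_def algebra_simps scaleR_2)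
  then have "J (2 *\<^sub>R (S * T * S)) = J (S * P + P * S) - J ((S * S) * T + T * (S * S))"
    using S T P by (simp only: J_diff A.add_mem A.mult_mem)
  also have "\<dots> = (J S * J P + J P * J S) - ((J S * J S) * J T + J T * (J S * J S))"
    using S T P by (simp only: J_jordan J_square A.mult_mem)
  also have "J P = J S * J T + J T * J S" unfolding P_def by (rule J_jordan[OF S T])
  also have "(J S * (J S * J T + J T * J S) + (J S * J T + J T * J S) * J S) - ((J S * J S) * J T + J T * (J S * J S))
      = 2 *\<^sub>R (J S * J T * J S)" by (simp add: algebra_simps scaleR_2)
  finally have "2 *\<^sub>R J (S * T * S) = 2 *\<^sub>R (J S * J T * J S)" using S T by (simp only: J_scaleR A.mult_mem)
  then show ?thesis by simp
qed

lemma J_one: "J 1 = 1"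
proof -
  obtain T where T: "T \<in> M" "J T = 1" using bij B.one_mem by (metis bij_betw_imp_surj_on imageE)
  have "J (1 * T + T * 1) = J 1 * J T + J T * J 1" using T by (intro J_jordan) simp_all
  then have "2 *\<^sub>R J T = 2 *\<^sub>R J 1" using T by (simp add: J_add scaleR_2)
  then show ?thesis using T by simp
qed

lemma J_nonneg: "T \<in> M \<Longrightarrow> 0 \<le> T \<Longrightarrow> 0 \<le> J T"
proof -
  assume T: "T \<in> M" "0 \<le> T"
  have R: "rt T \<in> M" by (rule rt_mem[OF T(2) A.cstar_subalgebra_axioms T(1)])
  have "star (J (rt T)) = J (rt T)" using J_star[OF R] T(2) by simp
  then have "0 \<le> J (rt T) * J (rt T)" using star_mult_nonneg[of "J (rt T)"] by simp
  then show ?thesis using J_square[OF R] rt_square[OF T(2)] by simp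
qed

lemma J_mono: "S \<in> M \<Longrightarrow> T \<in> M \<Longrightarrow> S \<le> T \<Longrightarrow> J S \<le> J T"
  using J_nonneg[of "T - S"] by (simp add: J_diff)

lemma J_pd: "T \<in> M \<Longrightarrow> pd T \<Longrightarrow> pd (J T)"
proof -
  assume T: "T \<in> M" "pd T"
  then obtain e where e: "0 < e" "e *\<^sub>R 1 \<le> T" by (auto simp: pd_def)
  have "J (e *\<^sub>R 1) \<le> J T" using T e by (intro J_mono) simp_all
  then show ?thesis using e by (intro pdI[of e]) (simp_all add: J_scaleR J_one)
qed

lemma J_proj: "P \<in> M \<Longrightarrow> proj P \<Longrightarrow> proj (J P)"
  using J_square[of P] J_star[of P] unfolding proj_def by simp

lemma J_iv:
  assumes S: "S \<in> M" "pd S"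
  shows "J (iv S) = iv (J S)"
proof -
  have V: "iv S \<in> M" by (rule iv_mem[OF S(2) A.cstar_subalgebra_axioms S(1)])
  have "J (S * iv S * S) = J S * J (iv S) * J S" by (rule J_triple[OF S(1) V])
  then have "J S = J S * J (iv S) * J S" using S by simp
  then have "iv (J S) * J S * iv (J S) = iv (J S) * (J S * J (iv S) * J S) * iv (J S)" by simp
  then show ?thesis using J_pd[OF S] by (simp add: mult.assoc)
qed

text \<open>
  That \<open>P\<close> commutes with \<open>D\<close> can be expressed by Jordan and triple products: \<open>P D + D P = 2 P D P\<close>.
\<close>

lemma J_commute_proj:
  assumes P: "P \<in> M" "proj P" and D: "D \<in> M" "P * D = D * P"
  shows "J P * J D = J D * J P"
proof -
  have p: "proj (J P)" by (rule J_proj[OF P])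
  have "P * D * P = P * D" by (rule compress_commute[OF P(2) D(2)[symmetric]])
  then have "P * D + D * P = 2 *\<^sub>R (P * D * P)" using D(2) by (simp add: scaleR_2)
  then have "J (P * D + D * P) = J (2 *\<^sub>R (P * D * P))" by (rule arg_cong)
  then have "J P * J D + J D * J P = 2 *\<^sub>R (J P * J D * J P)"
    unfolding J_jordan[OF P(1) D(1)] J_scaleR[OF A.mult_mem[OF A.mult_mem[OF P(1) D(1)] P(1)]] J_triple[OF P(1) D(1)] .
  then have eq: "J P * J D + J D * J P = J P * J D * J P + J P * J D * J P" by (simp only: scaleR_2)
  have "J P * (J P * J D + J D * J P) = J P * (J P * J D * J P + J P * J D * J P)" by (simp only: eq)
  then have 1: "J P * J D = J P * J D * J P" using p by (simp add: distrib_left mult.assoc)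
  have "(J P * J D + J D * J P) * J P = (J P * J D * J P + J P * J D * J P) * J P" by (simp only: eq)
  then have "J D * J P = J P * J D * J P" using p by (simp add: distrib_right mult.assoc)
  then show ?thesis using 1 by simp
qed

lemma J_orthogonal:
  assumes "P \<in> M" "proj P" "Q \<in> M" "proj Q" "P * Q = 0" "Q * P = 0"
  shows "J P * J Q = 0"
proof (rule orthogonal_of_anticommute)
  show "proj (J P)" "proj (J Q)" using assms by (simp_all add: J_proj)
  show "J P * J Q + J Q * J P = 0"
    using J_jordan[of P Q] assms J_scaleR[OF A.zero_mem, of 0] by simp
qed

lemma inverse_jordan_iso: "jordan_iso N M (inv_into M J)"
proof -
  let ?K = "inv_into M J"
  have K: "?K Y \<in> M" "J (?K Y) = Y" if "Y \<in> N" for Y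
    using that bij by (simp_all add: bij_betw_def f_inv_into_f inv_into_into)
  have inj: "X = Y" if "X \<in> M" "Y \<in> M" "J X = J Y" for X Y
    using that bij by (meson bij_betw_imp_inj_on inj_onD)
  show ?thesis
  proof
    show "bij_betw ?K N M" by (rule bij_betw_inv_into[OF bij])
    show "?K (S + T) = ?K S + ?K T" if "S \<in> N" "T \<in> N" for S T
      using that by (rule_tac inj) (simp_all add: K J_add)
    show "?K (scaleCo c T) = scaleCo c (?K T)" if "T \<in> N" for T c
      using that by (rule_tac inj) (simp_all add: K J_scaleCo)
    show "?K (star T) = star (?K T)" if "T \<in> N" for T
      using that by (rule_tac inj) (simp_all add: K J_star)
    show "?K (S * T + T * S) = ?K S * ?K T + ?K T * ?K S" if "S \<in> N" "T \<in> N" for S T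
      using that by (rule_tac inj) (simp_all only: K J_jordan A.add_mem A.mult_mem B.add_mem B.mult_mem)
  qed
qed

text \<open>
  \<open>1 \<sigma> D\<close> is approximated, up to a factor \<open>r\<close>, by combinations \<open>F\<close> of spectral projections of \<open>D\<close>,
  and \<open>J F\<close> approximates \<open>1 \<sigma> J D\<close> in the same way.
\<close>

lemma norm_mean_le:
  assumes "symmetric_mean \<sigma>" and X: "X \<in> M" "pd X" and Y: "Y \<in> M" "pd Y"
  shows "norm (\<sigma> (J X) (J Y)) \<le> norm (\<sigma> X Y)"
proof -
  interpret symmetric_mean \<sigma> by fact
  define S where "S = rt X"
  have S: "S \<in> M" "pd S" "S * S = X"
    using X by (simp_all add: S_def pd_rt rt_square pd_nonneg rt_mem A.cstar_subalgebra_axioms)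
  have iS: "iv S \<in> M" "pd (iv S)" using S by (simp_all add: iv_mem A.cstar_subalgebra_axioms)
  define D where "D = iv S * Y * iv S"
  have D: "D \<in> M" "pd D" using iS Y by (simp_all add: D_def pd_conj)
  have SDS: "S * D * S = Y" using S by (simp add: D_def mult.assoc)
  define c where "c = norm (\<sigma> X Y)"
  have \<sigma>XY: "\<sigma> X Y = S * \<sigma> 1 D * S" using mean_square[OF S(2) D(2)] S SDS by simp
  note JS = J_mem[OF S(1)] J_pd[OF S(1,2)] and JD = J_mem[OF D(1)] J_pd[OF D]
  have JXY: "J S * J S = J X" "J S * J D * J S = J Y"
    using J_square[OF S(1)] J_triple[OF S(1) D(1)] S(3) SDS by simp_all
  obtain d where d: "0 < d" "d *\<^sub>R 1 \<le> D" using D by (auto simp: pd_def)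
  have bound: "norm (\<sigma> (J X) (J Y)) \<le> r * c" if r: "1 < r" for r
  proof -
    have "\<exists>F\<in>M. F \<le> 1 * \<sigma> 1 D * 1 \<and> J 1 * \<sigma> 1 (J D) * J 1 \<le> r *\<^sub>R J F"
    proof (rule A.spectral_induct[OF D(1) pd_star[OF D(2)] d r,
          where \<Phi> = "\<lambda>Q. \<exists>F\<in>M. F \<le> Q * \<sigma> 1 D * Q \<and> J Q * \<sigma> 1 (J D) * J Q \<le> r *\<^sub>R J F"])
      fix Q l assume Q: "Q \<in> M" "proj Q" "Q * D = D * Q" and l: "0 < l" "l *\<^sub>R Q \<le> Q * D * Q" "Q * D * Q \<le> (r * l) *\<^sub>R Q"
      have JQ: "proj (J Q)" "J Q * J D = J D * J Q" using Q D by (simp_all add: J_proj J_commute_proj)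
      have "J (Q * D * Q) \<le> J ((r * l) *\<^sub>R Q)" using Q D l by (intro J_mono) simp_all
      then have "J Q * J D * J Q \<le> (r * l) *\<^sub>R J Q"
        unfolding J_triple[OF Q(1) D(1)] J_scaleR[OF Q(1)] .
      then have "J Q * \<sigma> 1 (J D) * J Q \<le> f (r * l) *\<^sub>R J Q"
        using JQ JD l r by (intro mean_local_le) simp_all
      also have "\<dots> \<le> (r * f l) *\<^sub>R J Q"
        using l r JQ by (intro scaleR_right_mono f_scale_le proj_nonneg) simp_all
      also have "\<dots> = r *\<^sub>R J (f l *\<^sub>R Q)" using Q by (simp add: J_scaleR)
      finally have "J Q * \<sigma> 1 (J D) * J Q \<le> r *\<^sub>R J (f l *\<^sub>R Q)" .
      moreover have "f l *\<^sub>R Q \<le> Q * \<sigma> 1 D * Q" using Q D l by (intro mean_local_ge)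
      ultimately show "\<exists>F\<in>M. F \<le> Q * \<sigma> 1 D * Q \<and> J Q * \<sigma> 1 (J D) * J Q \<le> r *\<^sub>R J F"
        using Q by (intro bexI[of _ "f l *\<^sub>R Q"]) simp_all
    next
      fix P Q assume P: "P \<in> M" "proj P" "P * D = D * P" and Q: "Q \<in> M" "proj Q" "Q * D = D * Q"
        and orth: "P * Q = 0" "Q * P = 0"
      assume "\<exists>F\<in>M. F \<le> P * \<sigma> 1 D * P \<and> J P * \<sigma> 1 (J D) * J P \<le> r *\<^sub>R J F"
        "\<exists>F\<in>M. F \<le> Q * \<sigma> 1 D * Q \<and> J Q * \<sigma> 1 (J D) * J Q \<le> r *\<^sub>R J F"
      then obtain F G where F: "F \<in> M" "F \<le> P * \<sigma> 1 D * P" "J P * \<sigma> 1 (J D) * J P \<le> r *\<^sub>R J F"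
        and G: "G \<in> M" "G \<le> Q * \<sigma> 1 D * Q" "J Q * \<sigma> 1 (J D) * J Q \<le> r *\<^sub>R J G" by blast
      have split: "(U + V) * Z * (U + V) = U * Z * U + V * Z * V"
        if "U * Z = Z * U" "V * Z = Z * V" "U * V = 0" "V * U = 0" for U V Z :: "'h oper"
      proof -
        have "U * Z * V = 0" "V * Z * U = 0" using that by (simp_all add: mult.assoc)
        then show ?thesis by (simp add: distrib_left distrib_right)
      qed
      have JPQ: "J P * J Q = 0" "J Q * J P = 0" using J_orthogonal P Q orth by blast+
      have 1: "(P + Q) * \<sigma> 1 D * (P + Q) = P * \<sigma> 1 D * P + Q * \<sigma> 1 D * Q"
        using P Q D orth by (intro split mean_commutes_proj)
      have 2: "J (P + Q) * \<sigma> 1 (J D) * J (P + Q) = J P * \<sigma> 1 (J D) * J P + J Q * \<sigma> 1 (J D) * J Q"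
        unfolding J_add[OF P(1) Q(1)]
        using P Q D JD JPQ by (intro split mean_commutes_proj J_proj J_commute_proj)
      show "\<exists>F\<in>M. F \<le> (P + Q) * \<sigma> 1 D * (P + Q) \<and> J (P + Q) * \<sigma> 1 (J D) * J (P + Q) \<le> r *\<^sub>R J F"
        unfolding 1 2 using add_mono[OF F(2) G(2)] add_mono[OF F(3) G(3)] F(1) G(1)
        by (intro bexI[of _ "F + G"]) (simp_all add: J_add scaleR_add_right)
    qed
    then obtain F where F: "F \<in> M" "F \<le> \<sigma> 1 D" "\<sigma> 1 (J D) \<le> r *\<^sub>R J F" by (auto simp: J_one)
    have "F \<le> c *\<^sub>R (iv S * iv S)"
    proof -
      have "\<sigma> X Y \<le> c *\<^sub>R 1" unfolding c_def using X Y by (intro le_norm) (simp add: pd_mean)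
      then have "iv S * \<sigma> X Y * iv S \<le> iv S * (c *\<^sub>R 1) * iv S" using S by (intro conj_mono_sa) simp_all
      then show ?thesis using F(2) S unfolding \<sigma>XY by (simp add: mult.assoc)
    qed
    then have "J F \<le> J (c *\<^sub>R (iv S * iv S))" using F iS by (intro J_mono) simp_all
    also have "\<dots> = c *\<^sub>R (iv (J S) * iv (J S))" using S iS by (simp add: J_scaleR J_square J_iv)
    finally have "r *\<^sub>R J F \<le> r *\<^sub>R c *\<^sub>R (iv (J S) * iv (J S))" using r by (intro scaleR_left_mono) simp_all
    with F(3) have "\<sigma> 1 (J D) \<le> r *\<^sub>R c *\<^sub>R (iv (J S) * iv (J S))" by (rule order_trans)
    then have "J S * \<sigma> 1 (J D) * J S \<le> J S * (r *\<^sub>R c *\<^sub>R (iv (J S) * iv (J S))) * J S"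
      using JS by (intro conj_mono_sa) simp_all
    also have "\<dots> = (r * c) *\<^sub>R 1" using JS by (simp add: mult.assoc)
    also have "J S * \<sigma> 1 (J D) * J S = \<sigma> (J X) (J Y)" using mean_square[OF JS(2) JD(2)] by (simp add: JXY)
    finally have "\<sigma> (J X) (J Y) \<le> (r * c) *\<^sub>R 1" .
    moreover have "0 \<le> \<sigma> (J X) (J Y)" using X Y by (intro pd_nonneg pd_mean J_pd)
    moreover have "0 \<le> r * c" using r by (simp add: c_def)
    ultimately show ?thesis using norm_le_iff_pos by blast
  qed
  show ?thesis
  proof (rule field_le_epsilon)
    fix e :: real assume "0 < e"
    have "0 < c" unfolding c_def using X Y by (intro norm_pos_of_pd pd_mean)
    then show "norm (\<sigma> (J X) (J Y)) \<le> norm (\<sigma> X Y) + e"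
      using bound[of "1 + e / c"] \<open>0 < e\<close> by (simp add: c_def distrib_right)
  qed
qed

lemma norm_mean_eq:
  assumes "symmetric_mean \<sigma>" and X: "X \<in> M" "pd X" and Y: "Y \<in> M" "pd Y"
  shows "norm (\<sigma> (J X) (J Y)) = norm (\<sigma> X Y)"
proof (rule antisym)
  interpret inv: jordan_iso N M "inv_into M J" by (rule inverse_jordan_iso)
  have "inv_into M J (J X) = X" "inv_into M J (J Y) = Y"
    using X Y bij by (simp_all add: bij_betw_imp_inj_on)
  then show "norm (\<sigma> X Y) \<le> norm (\<sigma> (J X) (J Y))"
    using inv.norm_mean_le[OF assms(1) J_mem[OF X(1)] J_pd[OF X] J_mem[OF Y(1)] J_pd[OF Y]] by simp
qed (rule norm_mean_le[OF assms])

end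

lemma (in cone_order_iso) jordan_iso_J: "jordan_iso M N J"
  by unfold_locales (simp_all only: J_bij J_add J_scaleCo J_star J_jordan)

section \<open>Norm preserving maps\<close>

text \<open>
  Scalars are fixed since \<open>\<phi>\<close> preserves norms of single elements and \<open>t 1\<close> is the largest element of the cone
  with norm at most \<open>t\<close>.
\<close>

theorem norm_mean_preserving_imp_order_iso:
  assumes M: "aw_mean_2 \<sigma> M" and N: "aw_mean_2 \<sigma> N"
    and mem: "\<And>X. X \<in> M \<Longrightarrow> pd X \<Longrightarrow> \<phi> X \<in> N \<and> pd (\<phi> X)"
    and surj: "\<And>Y. Y \<in> N \<Longrightarrow> pd Y \<Longrightarrow> \<exists>X\<in>M. pd X \<and> \<phi> X = Y"
    and norm: "\<And>X Y. X \<in> M \<Longrightarrow> pd X \<Longrightarrow> Y \<in> M \<Longrightarrow> pd Y \<Longrightarrow> norm (\<sigma> X Y) = norm (\<sigma> (\<phi> X) (\<phi> Y))"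
  shows "cone_order_iso M N \<phi>"
proof -
  interpret M: aw_mean_2 \<sigma> M by fact
  interpret N: aw_mean_2 \<sigma> N by fact
  have le: "\<phi> X \<le> \<phi> Y \<longleftrightarrow> X \<le> Y" if X: "X \<in> M" "pd X" and Y: "Y \<in> M" "pd Y" for X Y
  proof -
    have "\<phi> X \<le> \<phi> Y \<longleftrightarrow> (\<forall>Z\<in>N. pd Z \<longrightarrow> norm (\<sigma> (\<phi> X) Z) \<le> norm (\<sigma> (\<phi> Y) Z))"
      using mem X Y by (intro N.order_iff_norm_mean) auto
    also have "\<dots> \<longleftrightarrow> (\<forall>W\<in>M. pd W \<longrightarrow> norm (\<sigma> (\<phi> X) (\<phi> W)) \<le> norm (\<sigma> (\<phi> Y) (\<phi> W)))"
      using mem surj by metis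
    also have "\<dots> \<longleftrightarrow> (\<forall>W\<in>M. pd W \<longrightarrow> norm (\<sigma> X W) \<le> norm (\<sigma> Y W))"
      using norm[OF X] norm[OF Y] by (metis (mono_tags, lifting))
    also have "\<dots> \<longleftrightarrow> X \<le> Y" using M.order_iff_norm_mean[OF X Y] by blast
    finally show ?thesis .
  qed
  have norm1: "norm (\<phi> X) = norm X" if "X \<in> M" "pd X" for X
    using norm[OF that that] mem[OF that] that by (simp add: M.mean_self)
  have scalar: "\<phi> (t *\<^sub>R 1) = t *\<^sub>R 1" if t: "0 < t" for t
  proof (rule antisym)
    have t1: "t *\<^sub>R 1 \<in> M" "pd (t *\<^sub>R 1 :: 'a oper)" using t by simp_all
    show "\<phi> (t *\<^sub>R 1) \<le> t *\<^sub>R 1" using mem[OF t1] norm1[OF t1] t by (intro le_scalar) simp_all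
    obtain X where X: "X \<in> M" "pd X" "\<phi> X = t *\<^sub>R 1" using surj[of "t *\<^sub>R 1"] t by auto
    have "norm X = t" using norm1[OF X(1,2)] X(3) t by simp
    then have "X \<le> t *\<^sub>R 1" using X by (intro le_scalar) simp_all
    then show "t *\<^sub>R 1 \<le> \<phi> (t *\<^sub>R 1)" using le[OF X(1,2) t1] X(3) by simp
  qed
  show ?thesis
    by unfold_locales (use mem surj le scalar in auto)
qed

section \<open>Transfer to operator algebras\<close>

definition lift_set :: "('h \<Rightarrow>\<^sub>L 'h :: chilbert_space) set \<Rightarrow> 'h oper set"
  where "lift_set \<A> = {T. Rep_oper T \<in> \<A>}"

lemma lift_set_Rep: "Rep_oper T \<in> \<A> \<longleftrightarrow> T \<in> lift_set \<A>"
  by (simp add: lift_set_def)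

lemma lift_set_obtain:
  assumes "T \<in> \<A>" "\<A> \<subseteq> BH"
  obtains S where "S \<in> lift_set \<A>" "T = Rep_oper S"
  using assms Abs_oper_inverse[of T] by (metis lift_set_Rep subsetD)

lemma positive_op_iff: "positive_op (Rep_oper T) \<longleftrightarrow> 0 \<le> T"
  using Rep_oper[of T] by (simp add: positive_op_def less_eq_oper_def nonneg_oper_def app.rep_eq)

lemma op_le_iff: "Rep_oper S \<preceq> Rep_oper T \<longleftrightarrow> S \<le> T"
  unfolding op_le_def minus_oper.rep_eq[symmetric] positive_op_iff by simp

lemma projection_iff: "projection (Rep_oper P) \<longleftrightarrow> proj P"
  unfolding projection_def proj_def star.rep_eq[symmetric] times_oper.rep_eq[symmetric] Rep_oper_inject
  using Rep_oper[of P] by auto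

lemma continuous_Rep_oper: "continuous_on UNIV (Rep_oper :: 'h :: chilbert_space oper \<Rightarrow> _)"
proof -
  have "bounded_linear (Rep_oper :: 'h oper \<Rightarrow> _)"
    by (rule bounded_linear_intro[where K = 1]) (simp_all add: plus_oper.rep_eq scaleR_oper.rep_eq norm_oper.rep_eq)
  from bounded_linear.continuous_on[OF this continuous_on_id] show ?thesis .
qed

lemma cstar_subalgebra_lift:
  assumes "unital_cstar_subalgebra \<A>"
  shows "cstar_subalgebra (lift_set \<A>)"
proof
  have "closed (Rep_oper -` \<A>)"
    using assms continuous_Rep_oper by (intro closed_vimage) (auto simp: unital_cstar_subalgebra_def)
  then show "closed (lift_set \<A>)" by (simp add: lift_set_def vimage_def)
qed (use assms in \<open>auto simp: unital_cstar_subalgebra_def lift_set_def one_oper.rep_eq plus_oper.rep_eq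
    scaleCo.rep_eq times_oper.rep_eq star.rep_eq\<close>)

lemma aw_star_lift:
  assumes "AW_star_subalgebra \<A>"
  shows "aw_star (lift_set \<A>)"
proof -
  have cs: "unital_cstar_subalgebra \<A>" and BH: "\<A> \<subseteq> BH"
    using assms by (auto simp: AW_star_subalgebra_def unital_cstar_subalgebra_def)
  show ?thesis
  proof (intro aw_star.intro cstar_subalgebra_lift[OF cs] aw_star_axioms.intro)
    fix S :: "'a oper set" assume S: "S \<subseteq> lift_set \<A>" "S \<noteq> {}"
    then have "Rep_oper ` S \<subseteq> \<A>" "Rep_oper ` S \<noteq> {}" by (auto simp: lift_set_Rep)
    then obtain P' where P': "P' \<in> \<A>" "projection P'" "right_annihilator \<A> (Rep_oper ` S) = (\<lambda>X. P' o\<^sub>L X) ` \<A>"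
      using assms unfolding AW_star_subalgebra_def by blast
    then obtain P where P: "P \<in> lift_set \<A>" "P' = Rep_oper P" using lift_set_obtain BH by metis
    have "X \<in> lift_set \<A> \<and> (\<forall>s\<in>S. s * X = 0) \<longleftrightarrow> X \<in> (\<lambda>X. P * X) ` lift_set \<A>" for X
    proof -
      have "X \<in> lift_set \<A> \<and> (\<forall>s\<in>S. s * X = 0) \<longleftrightarrow> Rep_oper X \<in> right_annihilator \<A> (Rep_oper ` S)"
        by (simp add: right_annihilator_def lift_set_Rep Rep_oper_inject[symmetric] times_oper.rep_eq zero_oper.rep_eq)
      also have "\<dots> \<longleftrightarrow> (\<exists>Y\<in>\<A>. Rep_oper X = P' o\<^sub>L Y)" unfolding P'(3) by blast
      also have "\<dots> \<longleftrightarrow> (\<exists>Y\<in>lift_set \<A>. Rep_oper X = P' o\<^sub>L Rep_oper Y)"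
        using lift_set_obtain[OF _ BH] by (metis lift_set_Rep)
      also have "\<dots> \<longleftrightarrow> X \<in> (\<lambda>X. P * X) ` lift_set \<A>"
        unfolding P(2) times_oper.rep_eq[symmetric] Rep_oper_inject by blast
      finally show ?thesis .
    qed
    then have "{X \<in> lift_set \<A>. \<forall>s\<in>S. s * X = 0} = (\<lambda>X. P * X) ` lift_set \<A>" by blast
    then show "\<exists>P\<in>lift_set \<A>. proj P \<and> {X \<in> lift_set \<A>. \<forall>s\<in>S. s * X = 0} = (\<lambda>X. P * X) ` lift_set \<A>"
      using P P'(2) by (auto simp: projection_iff)
  qed
qed

text \<open>
  With \<open>R\<close> the root of \<open>T\<close> and \<open>S\<close> the inverse, \<open>1 = R S R \<le> c R R = c T\<close> for \<open>c > \<parallel>S\<parallel>\<close>.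
\<close>

lemma pd_of_inverse:
  fixes T :: "'h :: chilbert_space oper"
  assumes "0 \<le> T" "S * T = 1" "T * S = 1"
  shows "pd T"
proof -
  have sT: "star T = T" using assms(1) by (rule nonneg_star)
  have "star S = S * T * star S" using assms by simp
  also have "\<dots> = S * star (S * T)" by (simp add: sT mult.assoc)
  finally have sS: "star S = S" using assms by simp
  define c where "c = norm S + 1"
  have c: "0 < c" by (simp add: c_def add_nonneg_pos)
  have comm: "S * rt T = rt T * S" using assms by (intro rt_commute) simp_all
  have "rt T * S * rt T \<le> rt T * (c *\<^sub>R 1) * rt T"
    using assms(1) sS by (intro conj_mono_sa le_scalar) (simp_all add: c_def)
  also have "\<dots> = c *\<^sub>R T" using rt_square[OF assms(1)] by simp
  also have "rt T * S * rt T = S * (rt T * rt T)" by (simp only: comm[symmetric] mult.assoc)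
  also have "\<dots> = 1" by (simp only: rt_square[OF assms(1)] assms(2))
  finally have "(1 / c) *\<^sub>R 1 \<le> (1 / c) *\<^sub>R c *\<^sub>R T" using c by (intro scaleR_left_mono) simp_all
  then show ?thesis using c by (intro pdI[of "1 / c"]) simp_all
qed

lemma pd_cone_iff:
  assumes "cstar_subalgebra (lift_set \<A>)" "\<A> \<subseteq> BH"
  shows "Rep_oper T \<in> pd_cone \<A> \<longleftrightarrow> T \<in> lift_set \<A> \<and> pd T"
proof
  assume "Rep_oper T \<in> pd_cone \<A>"
  then obtain S' where T: "T \<in> lift_set \<A>" "0 \<le> T" and S': "S' \<in> \<A>" "S' o\<^sub>L Rep_oper T = id_blinfun" "Rep_oper T o\<^sub>L S' = id_blinfun"
    by (auto simp: pd_cone_def positive_op_iff lift_set_Rep)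
  obtain S where "S \<in> lift_set \<A>" "S' = Rep_oper S" using lift_set_obtain[OF S'(1) assms(2)] .
  then have "S * T = 1" "T * S = 1"
    using S'(2,3) by (simp_all add: Rep_oper_inject[symmetric] times_oper.rep_eq one_oper.rep_eq)
  then show "T \<in> lift_set \<A> \<and> pd T" using T pd_of_inverse by blast
next
  assume T: "T \<in> lift_set \<A> \<and> pd T"
  then have "iv T \<in> lift_set \<A>" using iv_mem assms(1) by blast
  moreover have "Rep_oper (iv T) o\<^sub>L Rep_oper T = id_blinfun" "Rep_oper T o\<^sub>L Rep_oper (iv T) = id_blinfun"
    using T by (simp_all flip: times_oper.rep_eq one_oper.rep_eq)
  ultimately show "Rep_oper T \<in> pd_cone \<A>"
    using T unfolding pd_cone_def by (auto simp: positive_op_iff pd_nonneg lift_set_Rep intro!: bexI[of _ "Rep_oper (iv T)"])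
qed

lemma pd_cone_obtain:
  assumes "T \<in> pd_cone \<A>" "cstar_subalgebra (lift_set \<A>)" "\<A> \<subseteq> BH"
  obtains S where "S \<in> lift_set \<A>" "pd S" "T = Rep_oper S"
proof -
  have "T \<in> \<A>" using assms(1) by (simp add: pd_cone_def)
  then obtain S where "T = Rep_oper S" using lift_set_obtain assms(3) by metis
  then show ?thesis using that assms pd_cone_iff by metis
qed

lemma lift_set_BH: "lift_set BH = UNIV"
  using Rep_oper by (auto simp: lift_set_def)

lemma pd_cone_BH_iff: "Rep_oper T \<in> pd_cone BH \<longleftrightarrow> pd T"
  using pd_cone_iff[of BH T] by (simp add: lift_set_BH cstar_UNIV)

text \<open>
  Only the values on the positive definite cone are meaningful; elsewhere \<open>\<sigma>\<close> may leave the algebra.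
\<close>

definition lift_op :: "(('h \<Rightarrow>\<^sub>L 'h) \<Rightarrow> ('h \<Rightarrow>\<^sub>L 'h) \<Rightarrow> ('h \<Rightarrow>\<^sub>L 'h :: chilbert_space)) \<Rightarrow> 'h oper \<Rightarrow> 'h oper \<Rightarrow> 'h oper"
  where "lift_op \<sigma> S T = Abs_oper (\<sigma> (Rep_oper S) (Rep_oper T))"

lemma
  assumes "kubo_ando_mean \<sigma>" "pd S" "pd T"
  shows Rep_lift_op: "Rep_oper (lift_op \<sigma> S T) = \<sigma> (Rep_oper S) (Rep_oper T)" and pd_lift_op: "pd (lift_op \<sigma> S T)"
proof -
  have mem: "\<sigma> (Rep_oper S) (Rep_oper T) \<in> pd_cone BH"
    using assms by (simp add: kubo_ando_mean_def kubo_ando_connection_def pd_cone_BH_iff)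
  then show eq: "Rep_oper (lift_op \<sigma> S T) = \<sigma> (Rep_oper S) (Rep_oper T)"
    by (simp add: lift_op_def Abs_oper_inverse pd_cone_def)
  show "pd (lift_op \<sigma> S T)" using mem by (simp add: pd_cone_BH_iff[symmetric] eq)
qed

lemma symmetric_mean_lift:
  assumes \<sigma>: "kubo_ando_mean \<sigma>" "symmetric_connection \<sigma>" and nontrivial: "(1 :: 'h :: chilbert_space oper) \<noteq> 0"
  shows "symmetric_mean (lift_op \<sigma> :: 'h oper \<Rightarrow> _)"
proof
  note rep = Rep_lift_op[OF \<sigma>(1)]
  have con: "kubo_ando_connection \<sigma>" using \<sigma>(1) by (simp add: kubo_ando_mean_def)
  fix A B C D :: "'h oper"
  show "(1 :: 'h oper) \<noteq> 0" by fact
  show "pd (lift_op \<sigma> A B)" if "pd A" "pd B" using pd_lift_op[OF \<sigma>(1) that] .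
  show "lift_op \<sigma> A B \<le> lift_op \<sigma> C D" if AB: "pd A" "pd B" and le: "A \<le> C" "B \<le> D"
  proof -
    have CD: "pd C" "pd D" using AB le pd_mono by blast+
    have "\<sigma> (Rep_oper A) (Rep_oper B) \<preceq> \<sigma> (Rep_oper C) (Rep_oper D)"
      using con AB CD le unfolding kubo_ando_connection_def by (simp add: pd_cone_BH_iff op_le_iff)
    then show ?thesis unfolding rep[OF AB, symmetric] rep[OF CD, symmetric] op_le_iff .
  qed
  show "C * lift_op \<sigma> A B * C \<le> lift_op \<sigma> (C * A * C) (C * B * C)" if ABC: "pd A" "pd B" "pd C"
  proof -
    have CC: "pd (C * A * C)" "pd (C * B * C)" using ABC by (simp_all add: pd_conj)
    have "Rep_oper C o\<^sub>L \<sigma> (Rep_oper A) (Rep_oper B) o\<^sub>L Rep_oper C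
        \<preceq> \<sigma> (Rep_oper C o\<^sub>L Rep_oper A o\<^sub>L Rep_oper C) (Rep_oper C o\<^sub>L Rep_oper B o\<^sub>L Rep_oper C)"
      using con ABC unfolding kubo_ando_connection_def by (simp add: pd_cone_BH_iff)
    then show ?thesis
      unfolding rep[OF ABC(1,2), symmetric] times_oper.rep_eq[symmetric] rep[OF CC, symmetric] op_le_iff .
  qed
  show "lift_op \<sigma> 1 1 = (1 :: 'h oper)"
    using \<sigma>(1) rep[of "1 :: 'h oper" 1] by (simp add: Rep_oper_inject[symmetric] one_oper.rep_eq kubo_ando_mean_def)
  show "lift_op \<sigma> A B = lift_op \<sigma> B A" if "pd A" "pd B"
    using \<sigma>(2) that unfolding symmetric_connection_def lift_op_def by (simp add: pd_cone_BH_iff)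
qed

text \<open>On a space of dimension at most one every operator is a scalar.\<close>

lemma scalar_of_dim_le_1:
  fixes T :: "'h :: chilbert_space oper"
  assumes "\<not> (\<exists>e g :: 'h. norm e = 1 \<and> norm g = 1 \<and> cinner e g = 0)"
  shows "\<exists>c. T = scaleCo c 1"
proof (cases "\<exists>e :: 'h. e \<noteq> 0")
  case False
  then have "T = scaleCo 0 1" by (intro oper_eqI) (metis)
  then show ?thesis by blast
next
  case True
  then obtain v :: 'h where "v \<noteq> 0" by blast
  define e where "e = (1 / norm v) *\<^sub>R v"
  have e: "norm e = 1" using \<open>v \<noteq> 0\<close> by (simp add: e_def)
\<comment> \<open>otherwise the component orthogonal to \<open>e\<close> could be normalized.\<close>
  have x: "x = cinner x e *\<^sub>C e" for x
  proof (rule ccontr)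
    assume *: "x \<noteq> cinner x e *\<^sub>C e"
    define y where "y = x - cinner x e *\<^sub>C e"
    have "y \<noteq> 0" using * by (simp add: y_def)
    have "cinner e y = 0" using e cinner_commute[of e x] by (simp add: y_def cinner_simps cinner_self)
    then have "cinner e ((1 / norm y) *\<^sub>R y) = 0" by (simp add: cinner_simps)
    moreover have "norm ((1 / norm y) *\<^sub>R y) = 1" using \<open>y \<noteq> 0\<close> by simp
    ultimately show False using assms e by blast
  qed
  have "T = scaleCo (cinner (app T e) e) 1"
  proof (rule oper_eqI)
    fix x
    have "app T x = cinner x e *\<^sub>C app T e" by (subst x) simp
    also have "app T e = cinner (app T e) e *\<^sub>C e" by (rule x)
    finally have "app T x = cinner (app T e) e *\<^sub>C cinner x e *\<^sub>C e" by (simp add: scaleC_scaleC mult.commute)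
    then show "app T x = app (scaleCo (cinner (app T e) e) 1) x" using x[of x] by simp
  qed
  then show ?thesis by blast
qed

theorem theorem6:
  fixes \<A> \<B> :: "('h \<Rightarrow>\<^sub>L 'h :: chilbert_space) set"
    and \<sigma> :: "('h \<Rightarrow>\<^sub>L 'h) \<Rightarrow> ('h \<Rightarrow>\<^sub>L 'h) \<Rightarrow> ('h \<Rightarrow>\<^sub>L 'h)"
    and \<phi> :: "('h \<Rightarrow>\<^sub>L 'h) \<Rightarrow> ('h \<Rightarrow>\<^sub>L 'h)"
  assumes "AW_star_subalgebra \<A>" and "AW_star_subalgebra \<B>"
    and "kubo_ando_mean \<sigma>" and "symmetric_connection \<sigma>"
    and "\<phi> ` pd_cone \<A> = pd_cone \<B>"
  shows "(\<forall>A\<in>pd_cone \<A>. \<forall>B\<in>pd_cone \<A>. norm (\<sigma> A B) = norm (\<sigma> (\<phi> A) (\<phi> B)))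
    \<longleftrightarrow> (\<exists>J. jordan_star_iso \<A> \<B> J \<and> (\<forall>A\<in>pd_cone \<A>. \<phi> A = J A))"
proof
  define M where "M = lift_set \<A>"
  define N where "N = lift_set \<B>"
  have BH: "\<A> \<subseteq> BH" "\<B> \<subseteq> BH"
    using assms(1,2) by (auto simp: AW_star_subalgebra_def unital_cstar_subalgebra_def)
  interpret M: aw_star M unfolding M_def by (rule aw_star_lift[OF assms(1)])
  interpret N: aw_star N unfolding N_def by (rule aw_star_lift[OF assms(2)])
  define \<psi> where "\<psi> X = Abs_oper (\<phi> (Rep_oper X))" for X
  have memA: "Rep_oper X \<in> \<A> \<longleftrightarrow> X \<in> M" and memB: "Rep_oper X \<in> \<B> \<longleftrightarrow> X \<in> N" for X
    by (simp_all add: M_def N_def lift_set_Rep)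
  have coneA: "Rep_oper X \<in> pd_cone \<A> \<longleftrightarrow> X \<in> M \<and> pd X" for X
    unfolding M_def by (rule pd_cone_iff[OF M.cstar_subalgebra_axioms[unfolded M_def] BH(1)])
  have coneB: "Rep_oper X \<in> pd_cone \<B> \<longleftrightarrow> X \<in> N \<and> pd X" for X
    unfolding N_def by (rule pd_cone_iff[OF N.cstar_subalgebra_axioms[unfolded N_def] BH(2)])
  have \<psi>_Rep: "Rep_oper (\<psi> X) = \<phi> (Rep_oper X)" if "X \<in> M" "pd X" for X
  proof -
    have "\<phi> (Rep_oper X) \<in> pd_cone \<B>" using assms(5) that coneA by blast
    then have "\<phi> (Rep_oper X) \<in> BH" using BH(2) by (auto simp: pd_cone_def)
    then show ?thesis by (simp add: \<psi>_def Abs_oper_inverse)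
  qed
  have \<psi>_mem: "\<psi> X \<in> N \<and> pd (\<psi> X)" if "X \<in> M" "pd X" for X
    using assms(5) that coneA coneB[of "\<psi> X"] \<psi>_Rep[OF that] by auto
  have norm_\<sigma>: "norm (\<sigma> (Rep_oper X) (Rep_oper Y)) = norm (lift_op \<sigma> X Y)" if "pd X" "pd Y" for X Y
    using Rep_lift_op[OF assms(3) that] by (simp add: norm_oper.rep_eq)
  have obtain_cone: "\<exists>X. X \<in> M \<and> pd X \<and> A = Rep_oper X" if "A \<in> pd_cone \<A>" for A
    using pd_cone_obtain[OF that _ BH(1)] M.cstar_subalgebra_axioms unfolding M_def by metis
  {
    assume pres: "\<forall>A\<in>pd_cone \<A>. \<forall>B\<in>pd_cone \<A>. norm (\<sigma> A B) = norm (\<sigma> (\<phi> A) (\<phi> B))"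
    have pres': "norm (lift_op \<sigma> X Y) = norm (lift_op \<sigma> (\<psi> X) (\<psi> Y))" if "X \<in> M" "pd X" "Y \<in> M" "pd Y" for X Y
      using pres that coneA \<psi>_mem by (simp add: norm_\<sigma>[symmetric] \<psi>_Rep)
    have "\<exists>K. jordan_iso M N K \<and> (\<forall>X\<in>M. pd X \<longrightarrow> \<psi> X = K X)"
    proof (cases "\<exists>e g :: 'h. norm e = 1 \<and> norm g = 1 \<and> cinner e g = 0")
      case True
      have nontrivial: "(1 :: 'h oper) \<noteq> 0"
      proof
        assume "(1 :: 'h oper) = 0"
        then have zero: "app (1 :: 'h oper) x = app 0 x" for x by simp
        obtain e :: 'h where "norm e = 1" using True by blast
        then show False using zero[of e] by simp
      qed
      interpret symmetric_mean "lift_op \<sigma>" by (rule symmetric_mean_lift[OF assms(3,4) nontrivial])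
      have aw: "aw_mean_2 (lift_op \<sigma>) M" "aw_mean_2 (lift_op \<sigma>) N"
        using True by unfold_locales
      interpret cone_order_iso M N \<psi>
      proof (rule norm_mean_preserving_imp_order_iso[OF aw])
        show "\<exists>X\<in>M. pd X \<and> \<psi> X = Y" if "Y \<in> N" "pd Y" for Y
        proof -
          have "Rep_oper Y \<in> \<phi> ` pd_cone \<A>" using that coneB assms(5) by simp
          then obtain A where "A \<in> pd_cone \<A>" "Rep_oper Y = \<phi> A" by blast
          then obtain X where X: "X \<in> M" "pd X" "Rep_oper Y = \<phi> (Rep_oper X)" using obtain_cone by metis
          then have "\<psi> X = Y" by (simp add: \<psi>_Rep Rep_oper_inject[symmetric])
          then show ?thesis using X by blast
        qed
      qed (use \<psi>_mem pres' in auto)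
      show ?thesis using jordan_iso_J J_eq_\<phi> by metis
    next
      case False
\<comment> \<open>in dimension at most one both algebras consist of scalars, and \<open>\<phi>\<close> preserves norms.\<close>
      have scalar: "\<exists>c. T = scaleCo c 1" for T :: "'h oper" using scalar_of_dim_le_1[OF False] .
      have MN: "M = UNIV" "N = UNIV" using scalar M.scaleC_mem[OF M.one_mem] N.scaleC_mem[OF N.one_mem] by (metis UNIV_eq_I)+
      have comm: "S * T = T * S" for S T :: "'h oper"
      proof -
        obtain a b where "S = scaleCo a 1" "T = scaleCo b 1" using scalar by blast
        then show ?thesis by (simp add: scaleCo_distrib(4) mult.commute)
      qed
      have pos: "X = norm X *\<^sub>R 1" if "pd X" for X :: "'h oper"
        using that comm by (intro scalar_of_commute_proj pd_nonneg)
      have "\<psi> X = X" if X: "X \<in> M" "pd X" for X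
      proof (cases "(1 :: 'h oper) = 0")
        case True
        then have "T = 0" for T :: "'h oper" by (metis mult_1_right mult_zero_right)
        then show ?thesis by metis
      next
        case False
        interpret symmetric_mean "lift_op \<sigma>" by (rule symmetric_mean_lift[OF assms(3,4) False])
        have "norm (\<psi> X) = norm X" using pres'[OF X X] \<psi>_mem[OF X] X by (simp add: mean_self)
        then show ?thesis using pos[of X] pos[of "\<psi> X"] X \<psi>_mem[OF X] by simp
      qed
      moreover have "jordan_iso M N (\<lambda>X. X)"
        by unfold_locales (simp_all add: MN bij_betw_def)
      ultimately show ?thesis by blast
    qed
    then obtain K where "jordan_iso M N K" and K\<psi>: "\<And>X. X \<in> M \<Longrightarrow> pd X \<Longrightarrow> \<psi> X = K X" by blast
    interpret K: jordan_iso M N K by fact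
    define J where "J A = Rep_oper (K (Abs_oper A))" for A
    have J_Rep: "J (Rep_oper X) = Rep_oper (K X)" for X by (simp add: J_def Rep_oper_inverse)
    have lift: "\<exists>X\<in>M. A = Rep_oper X" if "A \<in> \<A>" for A using lift_set_obtain[OF that BH(1)] M_def by metis
    have "jordan_star_iso \<A> \<B> J"
      unfolding jordan_star_iso_def
    proof (intro conjI ballI allI)
      have MA: "bij_betw Rep_oper M \<A>" and NB: "bij_betw Rep_oper N \<B>"
        unfolding bij_betw_def using lift lift_set_obtain[OF _ BH(2)] memA memB
        by (auto simp: inj_on_def Rep_oper_inject M_def N_def) (metis image_eqI lift_set_Rep)+
      have comp: "bij_betw (Rep_oper \<circ> (K \<circ> inv_into M Rep_oper)) \<A> \<B>"
        by (rule bij_betw_trans[OF bij_betw_trans[OF bij_betw_inv_into[OF MA] K.bij] NB])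
      have "(Rep_oper \<circ> (K \<circ> inv_into M Rep_oper)) A = J A" if "A \<in> \<A>" for A
      proof -
        from lift[OF that] obtain X where "X \<in> M" "A = Rep_oper X" by blast
        then show ?thesis using MA by (simp add: J_Rep bij_betw_imp_inj_on)
      qed
      then show "bij_betw J \<A> \<B>" using comp bij_betw_cong[of \<A> "Rep_oper \<circ> (K \<circ> inv_into M Rep_oper)" J \<B>] by blast
    next
      fix S T assume "S \<in> \<A>" "T \<in> \<A>"
      then obtain X Y where X: "X \<in> M" "S = Rep_oper X" and Y: "Y \<in> M" "T = Rep_oper Y" using lift by metis
      show "J (S + T) = J S + J T"
        using X Y by (simp only: J_Rep plus_oper.rep_eq[symmetric] K.J_add)
      show "J ((S o\<^sub>L T) + (T o\<^sub>L S)) = (J S o\<^sub>L J T) + (J T o\<^sub>L J S)"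
        using X Y by (simp only: J_Rep plus_oper.rep_eq[symmetric] times_oper.rep_eq[symmetric] K.J_jordan)
    next
      fix c T assume "T \<in> \<A>"
      then obtain X where X: "X \<in> M" "T = Rep_oper X" using lift by metis
      show "J (c *\<^sub>C T) = c *\<^sub>C J T" using X by (simp only: J_Rep scaleCo.rep_eq[symmetric] K.J_scaleCo)
    next
      fix T assume "T \<in> \<A>"
      then obtain X where X: "X \<in> M" "T = Rep_oper X" using lift by metis
      show "J (adj T) = adj (J T)" using X by (simp only: J_Rep star.rep_eq[symmetric] K.J_star)
    qed
    moreover have "\<phi> A = J A" if A: "A \<in> pd_cone \<A>" for A
    proof -
      obtain X where X: "X \<in> M" "pd X" "A = Rep_oper X" using obtain_cone[OF A] by blast
      then show ?thesis using K\<psi>[OF X(1,2)] \<psi>_Rep[OF X(1,2)] by (simp add: J_Rep)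
    qed
    ultimately show "\<exists>J. jordan_star_iso \<A> \<B> J \<and> (\<forall>A\<in>pd_cone \<A>. \<phi> A = J A)" by blast
  next
    assume "\<exists>J. jordan_star_iso \<A> \<B> J \<and> (\<forall>A\<in>pd_cone \<A>. \<phi> A = J A)"
    then obtain J where J: "jordan_star_iso \<A> \<B> J" and \<phi>J: "\<And>A. A \<in> pd_cone \<A> \<Longrightarrow> \<phi> A = J A" by blast
    define K where "K X = Abs_oper (J (Rep_oper X))" for X
    have bij: "bij_betw J \<A> \<B>" using J by (simp add: jordan_star_iso_def)
    have K_Rep: "Rep_oper (K X) = J (Rep_oper X)" if "X \<in> M" for X
    proof -
      have "J (Rep_oper X) \<in> \<B>" using bij that memA by (meson bij_betwE)
      then show ?thesis using BH(2) by (auto simp: K_def Abs_oper_inverse)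
    qed
    have K: "jordan_iso M N K"
    proof
      show "bij_betw K M N"
        unfolding bij_betw_def
      proof
        show "inj_on K M"
        proof (rule inj_onI)
          fix X Y assume XY: "X \<in> M" "Y \<in> M" "K X = K Y"
          then have "J (Rep_oper X) = J (Rep_oper Y)" by (metis K_Rep)
          then have "Rep_oper X = Rep_oper Y"
            using bij XY memA by (meson bij_betw_imp_inj_on inj_onD)
          then show "X = Y" by (simp add: Rep_oper_inject)
        qed
        show "K ` M = N"
        proof (rule set_eqI)
          fix Y
          have "Y \<in> K ` M \<longleftrightarrow> (\<exists>X\<in>M. Rep_oper Y = J (Rep_oper X))"
            by (simp add: image_iff K_Rep Rep_oper_inject[symmetric] cong: bex_cong)
          also have "\<dots> \<longleftrightarrow> (\<exists>A\<in>\<A>. Rep_oper Y = J A)"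
            using lift_set_obtain[OF _ BH(1)] memA by (metis M_def)
          also have "\<dots> \<longleftrightarrow> Y \<in> N" using bij memB by (auto simp: bij_betw_def)
          finally show "Y \<in> K ` M \<longleftrightarrow> Y \<in> N" .
        qed
      qed
    qed (use J memA in \<open>simp_all add: Rep_oper_inject[symmetric] K_Rep plus_oper.rep_eq times_oper.rep_eq scaleCo.rep_eq
        star.rep_eq jordan_star_iso_def\<close>)
    interpret K: jordan_iso M N K by (rule K)
    show "\<forall>A\<in>pd_cone \<A>. \<forall>B\<in>pd_cone \<A>. norm (\<sigma> A B) = norm (\<sigma> (\<phi> A) (\<phi> B))"
    proof (intro ballI)
      fix A B assume AB: "A \<in> pd_cone \<A>" "B \<in> pd_cone \<A>"
      obtain X where X: "X \<in> M" "pd X" "A = Rep_oper X" using obtain_cone[OF AB(1)] by blast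
      obtain Y where Y: "Y \<in> M" "pd Y" "B = Rep_oper Y" using obtain_cone[OF AB(2)] by blast
      have "norm (lift_op \<sigma> (K X) (K Y)) = norm (lift_op \<sigma> X Y)"
      proof (cases "(1 :: 'h oper) = 0")
        case True
        then have "T = 0" for T :: "'h oper" by (metis mult_1_right mult_zero_right)
        then show ?thesis by metis
      next
        case False
        show ?thesis by (rule K.norm_mean_eq[OF symmetric_mean_lift[OF assms(3,4) False] X(1,2) Y(1,2)])
      qed
      moreover have "\<phi> A = Rep_oper (K X)" "\<phi> B = Rep_oper (K Y)"
        using X Y AB by (simp_all add: \<phi>J K_Rep)
      ultimately show "norm (\<sigma> A B) = norm (\<sigma> (\<phi> A) (\<phi> B))"
        using X Y by (simp add: norm_\<sigma> K.J_pd)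
    qed
  }
qed

end
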